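(* Let $(X,d)$ and $(Y,\varrho)$ be uniformly perfect compact doubling metric spaces and let $f\colon X\to Y$ be $\eta$-quasisymmetric. Suppose there is a constant $L\ge1$, depending only on $\eta$, such that every $\eta$-quasisymmetric weak tangent mapping $\hat f\colon(\hat X,\hat d)\to(\hat Y,\hat\varrho)$ of $f$ which satisfies $$\hat\varrho(\hat f(p),\hat f(w))=\hat d(p,w)$$ for some $p,w\in\hat X$ with $w\neq p$ is $L$-bi-Lipschitz. Then $f$ is quasi-Lipschitz.
   Context: Basic notions. $B(x,r)$ denotes the closed ball. A metric space is doubling with constant $M\in\mathbb{N}$ if every closed ball of radius $r>0$ can be covered by $M$ closed balls of radius $r/2$; it is doubling if this holds for some $M$. A metric space $X$ is uniformly perfect with constant $D\ge1$ if for all $x\in X$, $r>0$ we have $B(x,r)\setminus B(x,r/D)\ne\emptyset$ whenever $X\setminus B(x,r)\ne\emptyset$; it is uniformly perfect if this holds for some $D$. Quasisymmetric mappings. For a homeomorphism $\eta\colon[0,\infty)\to[0,\infty)$, a homeomorphism $f\colon X\to Y$ (onto $Y$) is $\eta$-quasisymmetric if $\frac{\varrho(f(x),f(y))}{\varrho(f(x),f(z))}\le\eta\bigl(\frac{d(x,y)}{d(x,z)}\bigr)$ for all $x,y,z\in X$ with $x\neq z$. Bi-Lipschitz and quasi-Lipschitz mappings. A map $g$ is $L$-bi-Lipschitz if $L^{-1}d(x,y)\le\varrho(g(x),g(y))\le L\,d(x,y)$ for all $x,y$. A map $f\colon X\to Y$ is quasi-Lipschitz if $\frac{\log\varrho(f(x),f(y))}{\log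 d(x,y)}\to1$ uniformly as $d(x,y)\to0$ ($x\ne y$). Convergence of sets and maps in Euclidean space. Non-empty closed sets $F_i\subset\mathbb{R}^m$ converge to a non-empty closed set $F\subset\mathbb{R}^m$ if for all $R>0$ both $\sup_{x\in F_i\cap B(0,R)}\mathrm{dist}(x,F)\to0$ and $\sup_{y\in F\cap B(0,R)}\mathrm{dist}(y,F_i)\to0$. In this case maps $\phi_i\colon F_i\to Z$ into a metric space $Z$ converge to $\phi\colon F\to Z$ if $\phi_i(x_i)\to\phi(x)$ whenever $x_i\in F_i$ and $x_i\to x\in F$. Convergence of pointed metric spaces. A pointed metric space is a triple $(X,d,p)$ with $(X,d)$ complete and doubling and $p\in X$. Let $(X_i,d_i,p_i)$ and $(X,d,p)$ be pointed metric spaces, all doubling with the same constant. Then $(X_i,d_i,p_i)$ converges to $(X,d,p)$ if for some $0<\alpha\le1$, some $m\in\mathbb{N}$ and some bi-Lipschitz embeddings $h_i\colon(X_i,d_i^\alpha)\to\mathbb{R}^m$, $h\colon(X,d^\alpha)\to\mathbb{R}^m$ (with a common bi-Lipschitz constant) with $h_i(p_i)=0$ and $h(p)=0$, the sets $h_i(X_i)$ converge to $h(X)$, and the functions $(x,y)\mapsto d_i(h_i^{-1}(x),h_i^{-1}(y))$ on $h_i(X_i)\times h_i(X_i)$ converge to $(x,y)\mapsto d(h^{-1}(x),h^{-1}(y))$ on $h(X)\times h(X)$. Mapping packages. A mapping package is a triple $((X,d,p),(Y,\varrho,q),f)$ of two pointed metric spaces and a map $f\colon X\to Y$ with $f(p)=q$.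 Packages $((X_i,d_i,p_i),(Y_i,\varrho_i,q_i),f_i)$ converge to $((X,d,p),(Y,\varrho,q),f)$ if for some $0<\alpha,\alpha'\le1$, some $m,m'\in\mathbb{N}$ and some bi-Lipschitz embeddings $h_i\colon(X_i,d_i^\alpha)\to\mathbb{R}^m$, $h\colon(X,d^\alpha)\to\mathbb{R}^m$ (with a common bi-Lipschitz constant) and $g_i\colon(Y_i,\varrho_i^{\alpha'})\to\mathbb{R}^{m'}$, $g\colon(Y,\varrho^{\alpha'})\to\mathbb{R}^{m'}$ (with a common bi-Lipschitz constant) with $h_i(p_i)=0$, $h(p)=0$, $g_i(q_i)=0$ and $g(q)=0$, the convergence $(X_i,d_i,p_i)\to(X,d,p)$ holds with the embeddings $h_i,h$ (that is, $h_i(X_i)$ converge to $h(X)$ and $(x,y)\mapsto d_i(h_i^{-1}(x),h_i^{-1}(y))$ converge to $(x,y)\mapsto d(h^{-1}(x),h^{-1}(y))$), the convergence $(Y_i,\varrho_i,q_i)\to(Y,\varrho,q)$ holds with the embeddings $g_i,g$ (that is, $g_i(Y_i)$ converge to $g(Y)$ and $(x,y)\mapsto\varrho_i(g_i^{-1}(x),g_i^{-1}(y))$ converge to $(x,y)\mapsto\varrho(g^{-1}(x),g^{-1}(y))$), and $g_i\circ f_i\circ h_i^{-1}$ converges to $g\circ f\circ h^{-1}$. Weak tangents. For a complete doubling metric space $(X,d)$, a pointed metric space $(\hat X,\hat d,\hat p)$ is a weak tangent of $(X,d)$ if there are $p_i\in X$ and $r_i>0$ with $r_i\to0$ such that $(X,d/r_i,p_i)$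 converges to $(\hat X,\hat d,\hat p)$. If $f\colon X\to Y$ is a map between complete doubling metric spaces and $(\hat X,\hat d,\hat p)$, $(\hat Y,\hat\varrho,\hat q)$ are weak tangents of $X$ and $Y$, then $\hat f\colon\hat X\to\hat Y$ is a weak tangent mapping of $f$ if, for sequences $p_i\in X$, $q_i=f(p_i)$ and positive reals $r_i\to0$, $t_i\to0$ defining these weak tangents, the mapping packages $((X,d/r_i,p_i),(Y,\varrho/t_i,q_i),f)$ converge to $((\hat X,\hat d,\hat p),(\hat Y,\hat\varrho,\hat q),\hat f)$. *)

theory Defs
  imports "HOL-Analysis.Analysis"
begin

section \<open>Metric notions\<close>

definition doubling_with :: "nat \<Rightarrow> 'a metric \<Rightarrow> bool" where
  "doubling_with M X \<longleftrightarrow>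
     (\<forall>x\<in>mspace X. \<forall>r>0. \<exists>C\<subseteq>mspace X. finite C \<and> card C \<le> M \<and>
        mcball_of X x r \<subseteq> (\<Union>c\<in>C. mcball_of X c (r / 2)))"

definition doubling :: "'a metric \<Rightarrow> bool" where
  "doubling X \<longleftrightarrow> (\<exists>M. doubling_with M X)"

definition uniformly_perfect :: "'a metric \<Rightarrow> bool" where
  "uniformly_perfect X \<longleftrightarrow>
     (\<exists>D\<ge>1. \<forall>x\<in>mspace X. \<forall>r>0. mspace X - mcball_of X x r \<noteq> {} \<longrightarrow>
        mcball_of X x r - mcball_of X x (r / D) \<noteq> {})"

definition quasisymmetric ::
  "(real \<Rightarrow> real) \<Rightarrow> 'a metric \<Rightarrow> 'b metric \<Rightarrow> ('a \<Rightarrow> 'b) \<Rightarrow> bool" where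
  "quasisymmetric \<eta> X Y f \<longleftrightarrow>
     homeomorphic_map (top_of_set {0..}) (top_of_set {0..}) \<eta> \<and>
     homeomorphic_map (mtopology_of X) (mtopology_of Y) f \<and>
     (\<forall>x\<in>mspace X. \<forall>y\<in>mspace X. \<forall>z\<in>mspace X. x \<noteq> z \<longrightarrow>
        mdist Y (f x) (f y) / mdist Y (f x) (f z) \<le> \<eta> (mdist X x y / mdist X x z))"

definition bi_lipschitz :: "real \<Rightarrow> 'a metric \<Rightarrow> 'b metric \<Rightarrow> ('a \<Rightarrow> 'b) \<Rightarrow> bool" where
  "bi_lipschitz L X Y g \<longleftrightarrow> L \<ge> 1 \<and> g ` mspace X \<subseteq> mspace Y \<and>
     (\<forall>x\<in>mspace X. \<forall>y\<in>mspace X.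
        inverse L * mdist X x y \<le> mdist Y (g x) (g y) \<and>
        mdist Y (g x) (g y) \<le> L * mdist X x y)"

text \<open>If two distinct points had the same image, the quotient below would evaluate to
  \<open>0\<close> (as \<open>ln 0 = 0\<close>), so non-injectivity at small scales is excluded, as it
  should be.\<close>

definition quasi_lipschitz :: "'a metric \<Rightarrow> 'b metric \<Rightarrow> ('a \<Rightarrow> 'b) \<Rightarrow> bool" where
  "quasi_lipschitz X Y f \<longleftrightarrow> f ` mspace X \<subseteq> mspace Y \<and>
     (\<forall>\<epsilon>>0. \<exists>\<delta>>0. \<forall>x\<in>mspace X. \<forall>y\<in>mspace X. x \<noteq> y \<and> mdist X x y < \<delta> \<longrightarrow>
        \<bar>ln (mdist Y (f x) (f y)) / ln (mdist X x y) - 1\<bar> < \<epsilon>)"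

definition snowflake :: "real \<Rightarrow> 'a metric \<Rightarrow> 'a metric" where
  "snowflake \<alpha> X = metric (mspace X, \<lambda>x y. mdist X x y powr \<alpha>)"

definition rescale :: "real \<Rightarrow> 'a metric \<Rightarrow> 'a metric" where
  "rescale r X = metric (mspace X, \<lambda>x y. mdist X x y / r)"

text \<open>The space \<open>\<real>\<^sup>m\<close> with its Euclidean distance, on the carrier used by
  \<^const>\<open>Euclidean_space\<close>: sequences that vanish from index \<open>m\<close> on. The dimension
  has to be a term because it is existentially quantified in the notions of convergence.\<close>

definition Rn :: "nat \<Rightarrow> (nat \<Rightarrow> real) metric" where
  "Rn m = metric (topspace (Euclidean_space m), \<lambda>x y. L2_set (\<lambda>i. x i - y i) {..<m})"

text \<open>The arguments passed to the constructor of type \<open>metric\<close> really are metrics.\<close>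

lemma powr_subadditive:
  fixes a b c \<alpha> :: real
  assumes "0 < \<alpha>" "\<alpha> \<le> 1" "0 \<le> a" "0 \<le> b" "0 \<le> c" "c \<le> a + b"
  shows "c powr \<alpha> \<le> a powr \<alpha> + b powr \<alpha>"
proof (cases "a = 0 \<or> b = 0")
  case True
  then show ?thesis using assms powr_mono2[of \<alpha> c "a + b"] by auto
next
  case False
  then have pos: "0 < a" "0 < b" using assms by auto
  have split: "t powr \<alpha> = t * t powr (\<alpha> - 1)" if "t > 0" for t :: real
    using that by (simp add: powr_diff)
  have "c powr \<alpha> \<le> (a + b) powr \<alpha>"
    using assms by (intro powr_mono2) auto
  also have "\<dots> = a * (a + b) powr (\<alpha> - 1) + b * (a + b) powr (\<alpha> - 1)"
    using pos by (simp add: split distrib_right)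
  also have "\<dots> \<le> a * a powr (\<alpha> - 1) + b * b powr (\<alpha> - 1)"
    using pos assms by (intro add_mono mult_left_mono powr_mono2') auto
  also have "\<dots> = a powr \<alpha> + b powr \<alpha>" using pos by (simp add: split)
  finally show ?thesis .
qed

lemma Metric_space_snowflake:
  assumes "0 < \<alpha>" "\<alpha> \<le> 1"
  shows "Metric_space (mspace X) (\<lambda>x y. mdist X x y powr \<alpha>)"
proof
  fix x y z
  show "mdist X x y powr \<alpha> = mdist X y x powr \<alpha>" by (simp add: mdist_commute)
  assume "x \<in> mspace X" "y \<in> mspace X"
  then show "mdist X x y powr \<alpha> = 0 \<longleftrightarrow> x = y" by simp
  assume "z \<in> mspace X"
  with \<open>x \<in> mspace X\<close> \<open>y \<in> mspace X\<close>
  show "mdist X x z powr \<alpha> \<le> mdist X x y powr \<alpha> + mdist X y z powr \<alpha>"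
    using assms by (intro powr_subadditive) (auto intro: mdist_triangle)
qed simp

lemma mspace_snowflake: "0 < \<alpha> \<Longrightarrow> \<alpha> \<le> 1 \<Longrightarrow> mspace (snowflake \<alpha> X) = mspace X"
  and mdist_snowflake:
    "0 < \<alpha> \<Longrightarrow> \<alpha> \<le> 1 \<Longrightarrow> mdist (snowflake \<alpha> X) = (\<lambda>x y. mdist X x y powr \<alpha>)"
  using Metric_space_snowflake[of \<alpha> X]
  by (simp_all add: snowflake_def Metric_space.mspace_metric Metric_space.mdist_metric)

lemma Metric_space_rescale:
  assumes "0 < r"
  shows "Metric_space (mspace X) (\<lambda>x y. mdist X x y / r)"
proof
  fix x y z
  show "0 \<le> mdist X x y / r" using assms by simp
  show "mdist X x y / r = mdist X y x / r" by (simp add: mdist_commute)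
  assume "x \<in> mspace X" "y \<in> mspace X"
  then show "mdist X x y / r = 0 \<longleftrightarrow> x = y" using assms by simp
  assume "z \<in> mspace X"
  with \<open>x \<in> mspace X\<close> \<open>y \<in> mspace X\<close>
  have "mdist X x z \<le> mdist X x y + mdist X y z" by (rule mdist_triangle)
  then show "mdist X x z / r \<le> mdist X x y / r + mdist X y z / r"
    using assms by (simp add: add_divide_distrib[symmetric] divide_right_mono)
qed

lemma mspace_rescale: "0 < r \<Longrightarrow> mspace (rescale r X) = mspace X"
  and mdist_rescale: "0 < r \<Longrightarrow> mdist (rescale r X) = (\<lambda>x y. mdist X x y / r)"
  using Metric_space_rescale[of r X]
  by (simp_all add: rescale_def Metric_space.mspace_metric Metric_space.mdist_metric)

lemma Metric_space_Rn:
  "Metric_space (topspace (Euclidean_space m)) (\<lambda>x y. L2_set (\<lambda>i. x i - y i) {..<m})"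
proof
  fix x y z :: "nat \<Rightarrow> real"
  show "L2_set (\<lambda>i. x i - y i) {..<m} = L2_set (\<lambda>i. y i - x i) {..<m}"
    by (simp add: L2_set_def power2_commute)
  show "L2_set (\<lambda>i. x i - z i) {..<m}
      \<le> L2_set (\<lambda>i. x i - y i) {..<m} + L2_set (\<lambda>i. y i - z i) {..<m}"
    using L2_set_triangle_ineq[of "\<lambda>i. x i - y i" "\<lambda>i. y i - z i" "{..<m}"] by simp
  assume xy: "x \<in> topspace (Euclidean_space m)" "y \<in> topspace (Euclidean_space m)"
  show "L2_set (\<lambda>i. x i - y i) {..<m} = 0 \<longleftrightarrow> x = y"
  proof
    assume "L2_set (\<lambda>i. x i - y i) {..<m} = 0"
    then have eq: "x i = y i" if "i < m" for i
      using that by (simp add: L2_set_eq_0_iff)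
    have "x i = y i" for i
      using xy eq[of i] by (cases "i < m") (auto simp: topspace_Euclidean_space)
    then show "x = y" ..
  qed (simp add: L2_set_def)
qed simp

lemma mspace_Rn: "mspace (Rn m) = {x. \<forall>i\<ge>m. x i = 0}"
  and mdist_Rn: "mdist (Rn m) = (\<lambda>x y. L2_set (\<lambda>i. x i - y i) {..<m})"
  using Metric_space_Rn[of m]
  by (simp_all add: Rn_def Metric_space.mspace_metric Metric_space.mdist_metric
      topspace_Euclidean_space)

section \<open>Convergence\<close>

text \<open>The suprema and distances are taken in \<open>ennreal\<close>, so that the supremum over an
  empty set is \<open>0\<close>.\<close>

definition sets_converge ::
  "nat \<Rightarrow> (nat \<Rightarrow> (nat \<Rightarrow> real) set) \<Rightarrow> (nat \<Rightarrow> real) set \<Rightarrow> bool" where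
  "sets_converge m Fs F \<longleftrightarrow>
     (\<forall>i. Fs i \<noteq> {} \<and> closedin (mtopology_of (Rn m)) (Fs i)) \<and>
     F \<noteq> {} \<and> closedin (mtopology_of (Rn m)) F \<and>
     (\<forall>R>0.
        (\<lambda>i. SUP x \<in> Fs i \<inter> mcball_of (Rn m) (\<lambda>_. 0) R. INF y \<in> F. ennreal (mdist (Rn m) x y))
          \<longlonglongrightarrow> 0 \<and>
        (\<lambda>i. SUP y \<in> F \<inter> mcball_of (Rn m) (\<lambda>_. 0) R. INF x \<in> Fs i. ennreal (mdist (Rn m) y x))
          \<longlonglongrightarrow> 0)"

definition maps_converge ::
  "'a metric \<Rightarrow> 'b metric \<Rightarrow> (nat \<Rightarrow> 'a set) \<Rightarrow> (nat \<Rightarrow> 'a \<Rightarrow> 'b) \<Rightarrow>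
   'a set \<Rightarrow> ('a \<Rightarrow> 'b) \<Rightarrow> bool" where
  "maps_converge E Z Fs \<phi>s F \<phi> \<longleftrightarrow>
     (\<forall>xs x. (\<forall>i. xs i \<in> Fs i) \<and> x \<in> F \<and> limitin (mtopology_of E) xs x sequentially \<longrightarrow>
        limitin (mtopology_of Z) (\<lambda>i. \<phi>s i (xs i)) (\<phi> x) sequentially)"

type_synonym 'a pointed = "'a metric \<times> 'a"

definition pointed_metric_space :: "'a pointed \<Rightarrow> bool" where
  "pointed_metric_space = (\<lambda>(X, p). mcomplete_of X \<and> doubling X \<and> p \<in> mspace X)"

definition pulled_dist :: "'a metric \<Rightarrow> ('a \<Rightarrow> 'b) \<Rightarrow> 'b \<times> 'b \<Rightarrow> real" where
  "pulled_dist X h = (\<lambda>(x, y). mdist X (inv_into (mspace X) h x) (inv_into (mspace X) h y))"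

text \<open>Convergence of pointed metric spaces realised by given exponent, dimension and
  embeddings; mapping packages need the same embeddings again.\<close>

definition pointed_converge_via ::
  "real \<Rightarrow> nat \<Rightarrow> (nat \<Rightarrow> 'a \<Rightarrow> nat \<Rightarrow> real) \<Rightarrow> ('c \<Rightarrow> nat \<Rightarrow> real) \<Rightarrow>
   (nat \<Rightarrow> 'a pointed) \<Rightarrow> 'c pointed \<Rightarrow> bool" where
  "pointed_converge_via \<alpha> m hs h Xps Xp \<longleftrightarrow>
     (\<forall>i. pointed_metric_space (Xps i)) \<and> pointed_metric_space Xp \<and>
     (\<exists>M. (\<forall>i. doubling_with M (fst (Xps i))) \<and> doubling_with M (fst Xp)) \<and>
     0 < \<alpha> \<and> \<alpha> \<le> 1 \<and>
     (\<exists>L. (\<forall>i. bi_lipschitz L (snowflake \<alpha> (fst (Xps i))) (Rn m) (hs i)) \<and>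
          bi_lipschitz L (snowflake \<alpha> (fst Xp)) (Rn m) h) \<and>
     (\<forall>i. hs i (snd (Xps i)) = (\<lambda>_. 0)) \<and> h (snd Xp) = (\<lambda>_. 0) \<and>
     sets_converge m (\<lambda>i. hs i ` mspace (fst (Xps i))) (h ` mspace (fst Xp)) \<and>
     maps_converge (prod_metric (Rn m) (Rn m)) euclidean_metric
       (\<lambda>i. hs i ` mspace (fst (Xps i)) \<times> hs i ` mspace (fst (Xps i)))
       (\<lambda>i. pulled_dist (fst (Xps i)) (hs i))
       (h ` mspace (fst Xp) \<times> h ` mspace (fst Xp))
       (pulled_dist (fst Xp) h)"

definition pointed_converge :: "(nat \<Rightarrow> 'a pointed) \<Rightarrow> 'c pointed \<Rightarrow> bool" where
  "pointed_converge Xps Xp \<longleftrightarrow> (\<exists>\<alpha> m hs h. pointed_converge_via \<alpha> m hs h Xps Xp)"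

type_synonym ('a, 'b) package = "'a pointed \<times> 'b pointed \<times> ('a \<Rightarrow> 'b)"

definition mapping_package :: "('a, 'b) package \<Rightarrow> bool" where
  "mapping_package = (\<lambda>((X, p), (Y, q), f).
     pointed_metric_space (X, p) \<and> pointed_metric_space (Y, q) \<and>
     f ` mspace X \<subseteq> mspace Y \<and> f p = q)"

text \<open>The map \<open>g \<circ> f \<circ> h\<^sup>-\<^sup>1\<close> defined on \<open>h(X)\<close>.\<close>

definition pulled_map ::
  "('b \<Rightarrow> 'e) \<Rightarrow> ('a, 'b) package \<Rightarrow> ('a \<Rightarrow> 'd) \<Rightarrow> 'd \<Rightarrow> 'e" where
  "pulled_map g P h = (case P of ((X, p), (Y, q), f) \<Rightarrow> g \<circ> f \<circ> inv_into (mspace X) h)"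

definition package_converge ::
  "(nat \<Rightarrow> ('a, 'b) package) \<Rightarrow> ('c, 'd) package \<Rightarrow> bool" where
  "package_converge Ps P \<longleftrightarrow>
     (\<forall>i. mapping_package (Ps i)) \<and> mapping_package P \<and>
     (\<exists>\<alpha> \<alpha>' m m' hs h gs g.
        pointed_converge_via \<alpha> m hs h (\<lambda>i. fst (Ps i)) (fst P) \<and>
        pointed_converge_via \<alpha>' m' gs g (\<lambda>i. fst (snd (Ps i))) (fst (snd P)) \<and>
        maps_converge (Rn m) (Rn m')
          (\<lambda>i. hs i ` mspace (fst (fst (Ps i)))) (\<lambda>i. pulled_map (gs i) (Ps i) (hs i))
          (h ` mspace (fst (fst P))) (pulled_map g P h))"

section \<open>Weak tangents\<close>

definition weak_tangent :: "'a metric \<Rightarrow> 'c pointed \<Rightarrow> bool" where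
  "weak_tangent X Xp \<longleftrightarrow> mcomplete_of X \<and> doubling X \<and>
     (\<exists>ps r. (\<forall>i. ps i \<in> mspace X) \<and> (\<forall>i. 0 < r i) \<and> r \<longlonglongrightarrow> 0 \<and>
        pointed_converge (\<lambda>i. (rescale (r i) X, ps i)) Xp)"

definition weak_tangent_map ::
  "'a metric \<Rightarrow> 'b metric \<Rightarrow> ('a \<Rightarrow> 'b) \<Rightarrow> 'c pointed \<Rightarrow> 'd pointed \<Rightarrow> ('c \<Rightarrow> 'd) \<Rightarrow> bool" where
  "weak_tangent_map X Y f Xp Yq fh \<longleftrightarrow> f ` mspace X \<subseteq> mspace Y \<and>
     weak_tangent X Xp \<and> weak_tangent Y Yq \<and>
     (\<exists>ps r t. (\<forall>i. ps i \<in> mspace X) \<and>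
        (\<forall>i. 0 < r i) \<and> r \<longlonglongrightarrow> 0 \<and> (\<forall>i. 0 < t i) \<and> t \<longlonglongrightarrow> 0 \<and>
        package_converge
          (\<lambda>i. ((rescale (r i) X, ps i), (rescale (t i) Y, f (ps i)), f)) (Xp, Yq, fh))"

text \<open>Quantifying over all weak tangents inside a formula requires a fixed carrier type.
  Nothing is lost by taking \<open>nat \<Rightarrow> real\<close>: every weak tangent comes with an injection
  \<open>h\<close> into some \<open>\<real>\<^sup>m\<close>, along which its metric can be transported, and all the
  notions above are invariant under isometries.\<close>

type_synonym tangent_point = "nat \<Rightarrow> real"

end

theory Submission
  imports Defs
begin

text \<open>Write \<open>\<rho>\<close> for the distance of \<open>Y\<close> and \<open>d\<close> for that of \<open>X\<close>. The heart of the matter is that the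
expansion ratio \<open>\<rho> (f p) (f x) / d p x\<close> changes by a factor of at most \<open>2 * L\<close> when the scale
\<open>d p x\<close> shrinks by an arbitrarily large prescribed factor \<open>1 / \<theta>\<close>, provided that the scale is
small (lemma \<open>scale_comparison\<close>). Otherwise there are \<open>p\<^sub>i\<close>, \<open>w\<^sub>i\<close>, \<open>x\<^sub>i\<close> with \<open>r\<^sub>i = d p\<^sub>i w\<^sub>i\<close>
tending to \<open>0\<close> at which this fails. Divide the distances of \<open>X\<close> by \<open>r\<^sub>i\<close> and those of \<open>Y\<close> by
\<open>t\<^sub>i = \<rho> (f p\<^sub>i) (f w\<^sub>i)\<close>. A subsequence of the rescaled packages converges to an
\<open>\<eta>\<close>-quasisymmetric weak tangent mapping, and the limits of \<open>p\<^sub>i\<close> and \<open>w\<^sub>i\<close> have distance \<open>1\<close>, as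
have their images. Hence the tangent mapping is \<open>L\<close>-bi-Lipschitz, which contradicts the choice of
the \<open>x\<^sub>i\<close> in the limit.

Now fix \<open>\<epsilon>\<close>. Uniform perfectness supplies points at all scales, up to a constant factor \<open>D\<close>. With
\<open>\<mu> = \<theta> * D\<close>, any small distance \<open>d p x\<close> is therefore reached from a fixed scale in about
\<open>ln (1 / d p x) / ln (1 / \<mu>)\<close> steps. Each of them changes the logarithm of the expansion ratio by at
most \<open>ln (2 * L)\<close>, so that
\<open>\<bar>ln (\<rho> (f p) (f x)) - ln (d p x)\<bar> \<le> C + ln (2 * L) / ln (1 / \<mu>) * ln (1 / d p x)\<close>. The constant
in front of the last logarithm is as small as one likes, since neither \<open>L\<close> nor \<open>D\<close> depends on \<open>\<theta>\<close>;
this is lemma \<open>quasi_lipschitz_from_scale_comparison\<close>.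

The longest part is the existence of the tangent mapping, which has to be exhibited with embeddings
into Euclidean spaces. The embeddings come from Assouad's theorem for the exponent \<open>1/2\<close>
(\<open>assouad_embedding\<close>): one embedding of \<open>X\<close> and one of \<open>Y\<close> suffice, because translating and
rescaling an embedding of \<open>X\<close> gives an embedding of the rescaled space with the same constant
(\<open>rescaled_embedding\<close>). Convergence is controlled by countably many net points. Along a
subsequence their coordinates and mutual distances converge, and equicontinuity transfers the
convergence to all sequences of points whose images converge (\<open>transfer_convergent\<close>). This
produces the limit metric (\<open>pointed_converge_limit\<close>) and, because a quasisymmetric map that is
normalised at two points is equicontinuous with constants that depend only on \<open>\<eta>\<close>, also the limit
mapping (\<open>package_converge_limit\<close>).\<close>

section \<open>Nets, colourings and bump functions in doubling spaces\<close>

lemma doubling_with_iterate: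
  assumes "doubling_with M X" "x \<in> mspace X" "0 < r"
  shows "\<exists>C\<subseteq>mspace X. finite C \<and> card C \<le> M ^ n \<and>
           mcball_of X x r \<subseteq> (\<Union>c\<in>C. mcball_of X c (r / 2 ^ n))"
proof (induction n)
  case 0
  show ?case using assms by (intro exI[of _ "{x}"]) auto
next
  case (Suc n)
  then obtain C where C: "C \<subseteq> mspace X" "finite C" "card C \<le> M ^ n"
    "mcball_of X x r \<subseteq> (\<Union>c\<in>C. mcball_of X c (r / 2 ^ n))" by blast
  have "\<exists>D\<subseteq>mspace X. finite D \<and> card D \<le> M \<and>
      mcball_of X c (r / 2 ^ n) \<subseteq> (\<Union>d\<in>D. mcball_of X d (r / 2 ^ n / 2))" if "c \<in> C" for c
  proof -
    have "c \<in> mspace X" "0 < r / 2 ^ n" using that C(1) assms(3) by auto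
    then show ?thesis using assms(1) unfolding doubling_with_def by blast
  qed
  then obtain D where D: "\<And>c. c \<in> C \<Longrightarrow> D c \<subseteq> mspace X \<and> finite (D c) \<and> card (D c) \<le> M \<and>
      mcball_of X c (r / 2 ^ n) \<subseteq> (\<Union>d\<in>D c. mcball_of X d (r / 2 ^ n / 2))"
    by metis
  have "card (\<Union>c\<in>C. D c) \<le> (\<Sum>c\<in>C. card (D c))"
    using C(2) by (rule card_UN_le)
  also have "\<dots> \<le> card C * M"
    using D sum_bounded_above[of C "\<lambda>c. card (D c)" M] by simp
  also have "\<dots> \<le> M ^ Suc n" using C(3) by (simp add: mult.commute)
  finally have "card (\<Union>c\<in>C. D c) \<le> M ^ Suc n" .
  moreover have "mcball_of X x r \<subseteq> (\<Union>d\<in>(\<Union>c\<in>C. D c). mcball_of X d (r / 2 ^ Suc n))"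
  proof
    fix y assume "y \<in> mcball_of X x r"
    then obtain c where c: "c \<in> C" "y \<in> mcball_of X c (r / 2 ^ n)" using C(4) by blast
    then obtain d where "d \<in> D c" "y \<in> mcball_of X d (r / 2 ^ n / 2)" using D[OF c(1)] by blast
    then show "y \<in> (\<Union>d\<in>(\<Union>c\<in>C. D c). mcball_of X d (r / 2 ^ Suc n))"
      using c(1) by (auto simp: mult.commute)
  qed
  moreover have "(\<Union>c\<in>C. D c) \<subseteq> mspace X" "finite (\<Union>c\<in>C. D c)" using C(2) D by auto
  ultimately show ?case by (intro exI[of _ "\<Union>c\<in>C. D c"] conjI)
qed

text \<open>In a covering by small balls, no ball contains two points of a set whose points are further apart
  than the diameter of the balls, so the set has at most as many points as there are balls.\<close>

lemma separated_card:
  assumes "doubling_with M X" "x \<in> mspace X" "0 < r" "S \<subseteq> mcball_of X x r"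
    and sep: "\<And>a b. a \<in> S \<Longrightarrow> b \<in> S \<Longrightarrow> a \<noteq> b \<Longrightarrow> 2 * (r / 2 ^ n) < mdist X a b"
  shows "finite S \<and> card S \<le> M ^ n"
proof -
  obtain C where C: "C \<subseteq> mspace X" "finite C" "card C \<le> M ^ n"
    "mcball_of X x r \<subseteq> (\<Union>c\<in>C. mcball_of X c (r / 2 ^ n))"
    using doubling_with_iterate[OF assms(1-3), of n] by (elim exE conjE)
  have "\<exists>c\<in>C. a \<in> mcball_of X c (r / 2 ^ n)" if "a \<in> S" for a
    using that C(4) assms(4) by blast
  then obtain g where g: "\<And>a. a \<in> S \<Longrightarrow> g a \<in> C \<and> a \<in> mcball_of X (g a) (r / 2 ^ n)" by metis
  have "inj_on g S"
  proof (rule inj_onI, rule ccontr)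
    fix a b assume ab: "a \<in> S" "b \<in> S" "g a = g b" "a \<noteq> b"
    have "mdist X a b \<le> mdist X a (g a) + mdist X (g a) b"
      using g[OF ab(1)] g[OF ab(2)] ab(3) by (intro mdist_triangle) auto
    also have "\<dots> \<le> r / 2 ^ n + r / 2 ^ n"
      using g[OF ab(1)] g[OF ab(2)] ab(3) by (intro add_mono) (auto simp: mdist_commute)
    finally show False using sep[OF ab(1,2,4)] by simp
  qed
  moreover have "g ` S \<subseteq> C" using g by auto
  ultimately have "finite S" "card S \<le> card C"
    using inj_on_finite[of g S C] card_inj_on_le[of g S C] C(2) by simp_all
  then show ?thesis using C(3) by simp
qed

text \<open>The cardinalities of \<open>\<epsilon>\<close>-separated sets are bounded, and one of largest cardinality is an
  \<open>\<epsilon>\<close>-net because no point can be added to it.\<close>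

lemma maximal_separated_set:
  assumes "doubling_with M X" "x0 \<in> mspace X" "mspace X \<subseteq> mcball_of X x0 \<Delta>" "0 < \<epsilon>"
  obtains N where "N \<subseteq> mspace X" "finite N"
    "\<And>p q. p \<in> N \<Longrightarrow> q \<in> N \<Longrightarrow> p \<noteq> q \<Longrightarrow> \<epsilon> \<le> mdist X p q"
    "\<And>x. x \<in> mspace X \<Longrightarrow> \<exists>p\<in>N. mdist X x p < \<epsilon>"
proof -
  define r where "r = max \<Delta> 1"
  obtain n where n: "2 * r / \<epsilon> < 2 ^ n" using real_arch_pow[of 2 "2 * r / \<epsilon>"] by auto
  have r: "0 < r" by (simp add: r_def)
  have small: "2 * (r / 2 ^ n) < \<epsilon>" using n assms(4) by (simp add: field_simps)
  define P where "P S \<longleftrightarrow> S \<subseteq> mspace X \<and> (\<forall>p\<in>S. \<forall>q\<in>S. p \<noteq> q \<longrightarrow> \<epsilon> \<le> mdist X p q)" for S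
  have bnd: "finite S \<and> card S \<le> M ^ n" if "P S" for S
  proof (rule separated_card[OF assms(1,2) r])
    show "S \<subseteq> mcball_of X x0 r"
    proof
      fix y assume "y \<in> S"
      then have "y \<in> mcball_of X x0 \<Delta>" using \<open>P S\<close> assms(3) unfolding P_def by blast
      then show "y \<in> mcball_of X x0 r" by (auto simp: r_def)
    qed
    show "2 * (r / 2 ^ n) < mdist X a b" if "a \<in> S" "b \<in> S" "a \<noteq> b" for a b
    proof -
      have "\<epsilon> \<le> mdist X a b" using \<open>P S\<close> that unfolding P_def by blast
      then show ?thesis using small by linarith
    qed
  qed
  have "P {}" by (simp add: P_def)
  then obtain N where N: "P N" "\<And>S. P S \<Longrightarrow> card S \<le> card N"
    using bnd ex_has_greatest_nat[of P "{}" card "Suc (M ^ n)"] by (auto simp: less_Suc_eq_le)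
  have fin: "finite N" using bnd N by blast
  show ?thesis
  proof (rule that[of N])
    fix x assume x: "x \<in> mspace X"
    show "\<exists>p\<in>N. mdist X x p < \<epsilon>"
    proof (rule ccontr)
      assume "\<not> ?thesis"
      then have far: "\<forall>p\<in>N. \<epsilon> \<le> mdist X x p" by auto
      then have "x \<notin> N" using x assms(4) by (metis mdist_zero not_less)
      moreover have "P (insert x N)"
        using N(1) far x by (auto simp: P_def mdist_commute)
      ultimately show False using N(2)[of "insert x N"] fin by simp
    qed
  qed (use N fin in \<open>auto simp: P_def\<close>)
qed

text \<open>Vertices are coloured one after the other; the at most \<open>B\<close> neighbours of a new vertex leave one of
  the \<open>B + 1\<close> colours free.\<close>

lemma greedy_colouring:
  assumes "finite V" "symp E" "\<And>v. v \<in> V \<Longrightarrow> card {u \<in> V. u \<noteq> v \<and> E v u} \<le> B"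
  shows "\<exists>col. (\<forall>v\<in>V. col v \<le> B) \<and> (\<forall>u\<in>V. \<forall>v\<in>V. u \<noteq> v \<and> E u v \<longrightarrow> col u \<noteq> (col v :: nat))"
  using assms(1,3)
proof (induction V)
  case empty
  then show ?case by simp
next
  case (insert v V)
  have deg: "card {u \<in> V. u \<noteq> w \<and> E w u} \<le> B" if "w \<in> V" for w
  proof -
    have "card {u \<in> V. u \<noteq> w \<and> E w u} \<le> card {u \<in> insert v V. u \<noteq> w \<and> E w u}"
      using insert.hyps by (intro card_mono) auto
    then show ?thesis using insert.prems[of w] that by simp
  qed
  have "\<exists>col. (\<forall>v\<in>V. col v \<le> B) \<and> (\<forall>u\<in>V. \<forall>v\<in>V. u \<noteq> v \<and> E u v \<longrightarrow> col u \<noteq> col v)"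
    by (rule insert.IH) (rule deg)
  then obtain col where col: "\<forall>v\<in>V. col v \<le> B"
    "\<forall>u\<in>V. \<forall>v\<in>V. u \<noteq> v \<and> E u v \<longrightarrow> col u \<noteq> col v"
    by (elim exE conjE)
  define A where "A = {u \<in> V. E v u}"
  have "A = {u \<in> insert v V. u \<noteq> v \<and> E v u}" using insert.hyps by (auto simp: A_def)
  then have "card A \<le> B" using insert.prems[of v] by simp
  then have "card (col ` A) \<le> B" using insert.hyps card_image_le[of A col] by (simp add: A_def)
  then have "\<not> {..B} \<subseteq> col ` A"
    using card_mono[of "col ` A" "{..B}"] insert.hyps by (auto simp: A_def)
  then obtain c where c: "c \<le> B" "c \<notin> col ` A" by auto
  have cv: "col u \<noteq> c" if "u \<in> V" "E v u \<or> E u v" for u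
    using that c(2) sympD[OF assms(2), of u v] unfolding A_def by blast
  show ?case
  proof (intro exI[of _ "col(v := c)"] conjI ballI impI)
    fix u assume "u \<in> insert v V"
    then show "(col(v := c)) u \<le> B" using col(1) c(1) by auto
  next
    fix u w assume "u \<in> insert v V" "w \<in> insert v V" "u \<noteq> w \<and> E u w"
    then show "(col(v := c)) u \<noteq> (col(v := c)) w"
      using col(2) cv[of u] cv[of w] by (cases "u = v"; cases "w = v") auto
  qed
qed

text \<open>Functions at scale \<open>\<epsilon>\<close> that tell apart any two points whose distance is comparable with \<open>\<epsilon>\<close>. The
  points of an \<open>\<epsilon>\<close>-net are coloured so that points of equal colour are more than \<open>20 * \<epsilon>\<close> apart,
  and \<open>u c\<close> is the tent function of width \<open>2 * \<epsilon>\<close> over the points of colour \<open>c\<close>. If \<open>p\<close> is a net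
  point near \<open>x\<close>, then a point \<open>y\<close> with \<open>4 * \<epsilon> \<le> mdist X x y \<le> 16 * \<epsilon>\<close> is outside the tent over
  \<open>p\<close> and, by the choice of the colouring, also outside the tents over all other points that have
  the colour of \<open>p\<close>. The number of colours depends only on the doubling constant: at most \<open>M ^ 6\<close>
  points of the net lie within \<open>20 * \<epsilon>\<close> of a given one, as \<open>2 * 20 / 2 ^ 6 < 1\<close>.\<close>

lemma bump_family:
  assumes dbl: "doubling_with M X" and x0: "x0 \<in> mspace X" "mspace X \<subseteq> mcball_of X x0 \<Delta>"
    and \<epsilon>: "0 < \<epsilon>"
  shows "\<exists>u :: nat \<Rightarrow> 'a \<Rightarrow> real.
    (\<forall>c. \<forall>x\<in>mspace X. 0 \<le> u c x \<and> u c x \<le> 1) \<and>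
    (\<forall>c. \<forall>x\<in>mspace X. \<forall>y\<in>mspace X. \<bar>u c x - u c y\<bar> \<le> mdist X x y / \<epsilon>) \<and>
    (\<forall>x\<in>mspace X. \<forall>y\<in>mspace X. 4 * \<epsilon> \<le> mdist X x y \<and> mdist X x y \<le> 16 * \<epsilon> \<longrightarrow>
       (\<exists>c\<le>M ^ 6. 1 / 2 \<le> \<bar>u c x - u c y\<bar>))"
proof -
  obtain N where N: "N \<subseteq> mspace X" "finite N"
    "\<And>p q. p \<in> N \<Longrightarrow> q \<in> N \<Longrightarrow> p \<noteq> q \<Longrightarrow> \<epsilon> \<le> mdist X p q"
    "\<And>x. x \<in> mspace X \<Longrightarrow> \<exists>p\<in>N. mdist X x p < \<epsilon>"
    by (rule maximal_separated_set[OF assms]) metis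
  have deg: "card {q \<in> N. q \<noteq> p \<and> mdist X p q \<le> 20 * \<epsilon>} \<le> M ^ 6" if "p \<in> N" for p
  proof -
    define Q where "Q = {q \<in> N. q \<noteq> p \<and> mdist X p q \<le> 20 * \<epsilon>}"
    have pX: "p \<in> mspace X" using that N(1) by blast
    have "Q \<subseteq> mcball_of X p (20 * \<epsilon>)" using pX N(1) by (auto simp: Q_def)
    moreover have "2 * (20 * \<epsilon> / 2 ^ 6) < mdist X a b" if "a \<in> Q" "b \<in> Q" "a \<noteq> b" for a b
    proof -
      have "\<epsilon> \<le> mdist X a b" using N(3)[of a b] that by (simp add: Q_def)
      then show ?thesis using \<epsilon> by simp
    qed
    ultimately have "card Q \<le> M ^ 6"
      using separated_card[OF dbl pX, of "20 * \<epsilon>" Q 6] \<epsilon> by simp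
    then show ?thesis by (simp add: Q_def)
  qed
  have "symp (\<lambda>p q. mdist X p q \<le> 20 * \<epsilon>)" by (rule sympI) (simp add: mdist_commute)
  then have "\<exists>col. (\<forall>p\<in>N. col p \<le> M ^ 6) \<and>
      (\<forall>p\<in>N. \<forall>q\<in>N. p \<noteq> q \<and> mdist X p q \<le> 20 * \<epsilon> \<longrightarrow> col p \<noteq> col q)"
    using deg by (intro greedy_colouring[OF N(2)])
  then obtain col :: "'a \<Rightarrow> nat" where col0: "\<forall>p\<in>N. col p \<le> M ^ 6"
    "\<forall>p\<in>N. \<forall>q\<in>N. p \<noteq> q \<and> mdist X p q \<le> 20 * \<epsilon> \<longrightarrow> col p \<noteq> col q" by (elim exE conjE)
  have col: "col p \<le> M ^ 6" if "p \<in> N" for p using col0(1) that by simp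
  have far: "20 * \<epsilon> < mdist X p q" if "p \<in> N" "q \<in> N" "p \<noteq> q" "col p = col q" for p q
    using col0(2) that by (rule_tac ccontr) (simp add: not_less)
  define S where "S c x = insert 0 ((\<lambda>p. 1 - mdist X x p / (2 * \<epsilon>)) ` {p \<in> N. col p = c})" for c x
  define u where "u c x = Max (S c x)" for c x
  have fin: "finite (S c x)" for c x using N(2) by (simp add: S_def)
  have ge0: "0 \<le> u c x" for c x unfolding u_def using fin by (intro Max_ge) (auto simp: S_def)
  have le1: "u c x \<le> 1" for c x
    unfolding u_def using fin \<epsilon> by (intro Max.boundedI) (auto simp: S_def)
  have lip1: "u c x \<le> u c y + mdist X x y / \<epsilon>" if "x \<in> mspace X" "y \<in> mspace X" for c x y
    unfolding u_def[of c x]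
  proof (intro Max.boundedI fin)
    fix a assume "a \<in> S c x"
    then consider "a = 0" | p where "p \<in> N" "col p = c" "a = 1 - mdist X x p / (2 * \<epsilon>)"
      by (auto simp: S_def)
    then show "a \<le> u c y + mdist X x y / \<epsilon>"
    proof cases
      case 1
      then show ?thesis using ge0[of c y] \<epsilon> by simp
    next
      case 2
      have "1 - mdist X y p / (2 * \<epsilon>) \<le> u c y"
        unfolding u_def using 2 fin by (intro Max_ge) (auto simp: S_def)
      moreover have "mdist X y p \<le> mdist X x y + mdist X x p"
        using mdist_triangle[of y X x p] that 2 N(1) by (auto simp: mdist_commute)
      then have "mdist X y p / (2 * \<epsilon>) \<le> (mdist X x y + mdist X x p) / (2 * \<epsilon>)"
        using \<epsilon> by (intro divide_right_mono) auto
      moreover have "mdist X x y / (2 * \<epsilon>) \<le> mdist X x y / \<epsilon>"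
        using \<epsilon> by (intro divide_left_mono) auto
      ultimately show ?thesis using 2 by (simp add: add_divide_distrib)
    qed
  qed (simp add: S_def)
  have lip: "\<bar>u c x - u c y\<bar> \<le> mdist X x y / \<epsilon>" if "x \<in> mspace X" "y \<in> mspace X" for c x y
    using lip1[OF that, of c] lip1[OF that(2,1), of c] by (simp add: mdist_commute)
  have "\<exists>c\<le>M ^ 6. 1 / 2 \<le> \<bar>u c x - u c y\<bar>"
    if x: "x \<in> mspace X" and y: "y \<in> mspace X" and d: "4 * \<epsilon> \<le> mdist X x y" "mdist X x y \<le> 16 * \<epsilon>"
    for x y
  proof -
    obtain p where p: "p \<in> N" "mdist X x p < \<epsilon>" using N(4) x by blast
    have pX: "p \<in> mspace X" using p N by blast
    have "1 - mdist X x p / (2 * \<epsilon>) \<le> u (col p) x"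
      unfolding u_def using p fin by (intro Max_ge) (auto simp: S_def)
    moreover have "mdist X x p / (2 * \<epsilon>) \<le> 1 / 2" using p \<epsilon> by (simp add: field_simps)
    moreover have "u (col p) y \<le> 0"
      unfolding u_def
    proof (intro Max.boundedI fin)
      fix a assume "a \<in> S (col p) y"
      then consider "a = 0" | q where "q \<in> N" "col q = col p" "a = 1 - mdist X y q / (2 * \<epsilon>)"
        by (auto simp: S_def)
      then show "a \<le> 0"
      proof cases
        case 2
        have qX: "q \<in> mspace X" using 2 N by blast
        have t: "mdist X x y \<le> mdist X x q + mdist X y q"
          "mdist X p q \<le> mdist X x p + mdist X x q" "mdist X x q \<le> mdist X x y + mdist X y q"
          using mdist_triangle[of x X q y] mdist_triangle[of p X x q] mdist_triangle[of x X y q]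
            x y pX qX by (auto simp: mdist_commute)
        have "2 * \<epsilon> \<le> mdist X y q"
        proof (cases "q = p")
          case True
          then show ?thesis using t p d by simp
        next
          case False
          then have "20 * \<epsilon> < mdist X p q" using far[of p q] p 2 by simp
          then show ?thesis using t p d by linarith
        qed
        then have "1 \<le> mdist X y q / (2 * \<epsilon>)" using \<epsilon> by (simp add: field_simps)
        then show ?thesis using 2 by simp
      qed simp
    qed (simp add: S_def)
    ultimately have "1 / 2 \<le> \<bar>u (col p) x - u (col p) y\<bar>" by linarith
    then show ?thesis using col[OF p(1)] by blast
  qed
  then show ?thesis using ge0 le1 lip by (intro exI[of _ u]) auto
qed

section \<open>Assouad's embedding for the exponent one half\<close>

lemma mdist_self [simp]: "x \<in> mspace X \<Longrightarrow> mdist X x x = 0"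
  by simp

text \<open>In the following lemmas on series \<open>A * q ^ j\<close> is the square root of the \<open>j\<close>-th scale, and \<open>w j\<close> is the
  difference of the values at two points of distance \<open>d\<close> of a function with values in the unit
  interval whose Lipschitz constant is the inverse of that scale. The
  coarse scales are controlled by the Lipschitz bound: their weighted contributions grow
  geometrically with \<open>j\<close>, so that the last one dominates.\<close>

lemma geometric_head:
  fixes w :: "nat \<Rightarrow> real"
  assumes "0 < q" "q \<le> 1 / 128" "0 < A" "0 \<le> d" "\<And>j. \<bar>w j\<bar> \<le> d / (A * q ^ j)\<^sup>2"
  shows "\<bar>\<Sum>j<k. A * q ^ j * w j\<bar> \<le> d / (A * q ^ k) / 127"
proof (induction k)
  case 0
  then show ?case using assms by simp
next
  case (Suc k)
  define B where "B = A * q ^ k"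
  have B: "0 < B" using assms by (simp add: B_def)
  have "\<bar>B * w k\<bar> = B * \<bar>w k\<bar>" using B by (simp add: abs_mult)
  also have "\<dots> \<le> B * (d / B\<^sup>2)"
    using assms(5)[of k] B unfolding B_def[symmetric] by (intro mult_left_mono) auto
  also have "\<dots> = d / B" using B by (simp add: power2_eq_square)
  finally have w: "\<bar>B * w k\<bar> \<le> d / B" .
  have IH: "\<bar>\<Sum>j<k. A * q ^ j * w j\<bar> \<le> d / B / 127" using Suc by (simp add: B_def)
  have "B * q \<le> B / 128" using mult_left_mono[OF assms(2), of B] B by simp
  then have "d / (B / 128) \<le> d / (B * q)"
    using B assms by (intro divide_left_mono) auto
  moreover define t where "t = d / B"
  ultimately have "t * 128 \<le> d / (B * q)" by simp
  moreover have "\<bar>\<Sum>j<Suc k. A * q ^ j * w j\<bar> \<le> t / 127 + t"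
    using w IH by (simp add: B_def[symmetric] t_def)
  moreover have "\<bar>x\<bar> \<le> z / 127" if "t * 128 \<le> z" "\<bar>x\<bar> \<le> t / 127 + t" for x z :: real
    using that by linarith
  ultimately have "\<bar>\<Sum>j<Suc k. A * q ^ j * w j\<bar> \<le> d / (B * q) / 127" by blast
  moreover have "A * q ^ Suc k = B * q" by (simp add: B_def)
  ultimately show ?case by (simp only:)
qed

text \<open>For the fine scales the trivial bound \<open>1\<close> suffices.\<close>

lemma geometric_tail:
  fixes w :: "nat \<Rightarrow> real"
  assumes "0 < q" "q < 1" "0 < A" "\<And>j. \<bar>w j\<bar> \<le> 1"
  shows summable_geometric_bounded: "summable (\<lambda>j. A * q ^ j * w j)"
    and "\<bar>\<Sum>j. A * q ^ (j + k) * w (j + k)\<bar> \<le> A * q ^ k / (1 - q)"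
proof -
  have g: "(\<lambda>j. A * q ^ k * q ^ j) sums (A * q ^ k / (1 - q))" for k
    using sums_mult[OF geometric_sums[of q], of "A * q ^ k"] assms by simp
  have le: "\<bar>A * q ^ j * w j\<bar> \<le> A * q ^ j" for j
  proof -
    have "\<bar>A * q ^ j * w j\<bar> = A * q ^ j * \<bar>w j\<bar>" using assms by (simp add: abs_mult)
    also have "\<dots> \<le> A * q ^ j * 1" using assms by (intro mult_left_mono) auto
    finally show ?thesis by simp
  qed
  have le': "\<bar>A * q ^ (j + k) * w (j + k)\<bar> \<le> A * q ^ k * q ^ j" for j k
    using le[of "j + k"] by (simp add: power_add mult_ac)
  have sm: "summable (\<lambda>j. \<bar>A * q ^ (j + k) * w (j + k)\<bar>)" for k
    by (rule summable_comparison_test'[OF sums_summable[OF g[of k]], of 0]) (use le' in simp)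
  show "summable (\<lambda>j. A * q ^ j * w j)"
    using summable_rabs_cancel sm[of 0] by simp
  have "\<bar>\<Sum>j. A * q ^ (j + k) * w (j + k)\<bar> \<le> (\<Sum>j. \<bar>A * q ^ (j + k) * w (j + k)\<bar>)"
    by (rule summable_rabs[OF sm])
  also have "\<dots> \<le> (\<Sum>j. A * q ^ k * q ^ j)"
    by (rule suminf_le[OF le' sm sums_summable[OF g]])
  also have "\<dots> = A * q ^ k / (1 - q)" by (rule sums_unique[OF g, symmetric])
  finally show "\<bar>\<Sum>j. A * q ^ (j + k) * w (j + k)\<bar> \<le> A * q ^ k / (1 - q)" .
qed

lemma geometric_tail':
  fixes w :: "nat \<Rightarrow> real"
  assumes "0 < q" "q \<le> 1 / 128" "0 < A" "\<And>j. \<bar>w j\<bar> \<le> 1"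
  shows "\<bar>\<Sum>j. A * q ^ (j + k) * w (j + k)\<bar> \<le> A * q ^ k * (128 / 127)"
proof -
  have "\<bar>\<Sum>j. A * q ^ (j + k) * w (j + k)\<bar> \<le> A * q ^ k / (1 - q)"
    using assms by (intro geometric_tail(2)) auto
  also have "\<dots> \<le> A * q ^ k / (127 / 128)"
    using assms by (intro divide_left_mono) auto
  finally show ?thesis by simp
qed

text \<open>Split the series at the first scale that does not exceed \<open>d\<close>.\<close>

lemma hoelder_series_upper:
  fixes w :: "nat \<Rightarrow> real"
  assumes q: "0 < q" "q \<le> 1 / 128" and A: "0 < A" and d: "0 < d" and w1: "\<And>j. \<bar>w j\<bar> \<le> 1"
    and wd: "\<And>j. \<bar>w j\<bar> \<le> d / (A * q ^ j)\<^sup>2"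
  shows "\<bar>\<Sum>j. A * q ^ j * w j\<bar> \<le> 4 * sqrt d"
proof -
  define k where "k = (LEAST k. A * q ^ k \<le> sqrt d)"
  have "0 < sqrt d / A" using A d by simp
  then obtain n where "q ^ n < sqrt d / A"
    using real_arch_pow_inv[of "sqrt d / A" q] q by auto
  then have ex: "A * q ^ n \<le> sqrt d" using A by (simp add: field_simps)
  have k: "A * q ^ k \<le> sqrt d" unfolding k_def by (rule LeastI[of _ n]) (fact ex)
  have head: "\<bar>\<Sum>j<k. A * q ^ j * w j\<bar> \<le> 2 * sqrt d"
  proof (cases k)
    case 0
    then show ?thesis using d by simp
  next
    case (Suc l)
    then have "\<not> A * q ^ l \<le> sqrt d" using not_less_Least[of l "\<lambda>k. A * q ^ k \<le> sqrt d"] k_def by simp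
    then have l: "sqrt d \<le> A * q ^ l" by simp
    have "A * q ^ l * \<bar>w l\<bar> \<le> A * q ^ l * (d / (A * q ^ l)\<^sup>2)"
      using wd[of l] A q by (intro mult_left_mono) auto
    also have "\<dots> = d / (A * q ^ l)" using A q by (simp add: power2_eq_square)
    finally have "\<bar>A * q ^ l * w l\<bar> \<le> d / (A * q ^ l)" using A q by (simp add: abs_mult)
    moreover have "\<bar>\<Sum>j<l. A * q ^ j * w j\<bar> \<le> d / (A * q ^ l) / 127"
      using geometric_head[OF q A _ wd] d by simp
    moreover have "d / (A * q ^ l) \<le> sqrt d"
    proof -
      have "d / (A * q ^ l) \<le> d / sqrt d"
        using l d A q by (intro divide_left_mono mult_pos_pos) auto
      then show ?thesis using d by (simp add: real_div_sqrt)
    qed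
    moreover have "\<bar>x + y\<bar> \<le> 2 * b" if "\<bar>y\<bar> \<le> a" "\<bar>x\<bar> \<le> a / 127" "a \<le> b" for x y a b :: real
      using that by linarith
    ultimately show ?thesis unfolding Suc sum.lessThan_Suc by blast
  qed
  have "\<bar>\<Sum>j. A * q ^ (j + k) * w (j + k)\<bar> \<le> A * q ^ k * (128 / 127)"
    by (rule geometric_tail'[OF q A w1])
  also have "\<dots> \<le> sqrt d * (128 / 127)" using k by (intro mult_right_mono) auto
  also have "\<dots> \<le> 2 * sqrt d" using d by simp
  finally have tail: "\<bar>\<Sum>j. A * q ^ (j + k) * w (j + k)\<bar> \<le> 2 * sqrt d" .
  have "(\<Sum>j. A * q ^ j * w j) = (\<Sum>j. A * q ^ (j + k) * w (j + k)) + (\<Sum>j<k. A * q ^ j * w j)"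
    using q by (intro suminf_split_initial_segment geometric_tail(1) A w1) auto
  then show ?thesis using head tail by linarith
qed

text \<open>If the \<open>k\<close>-th function separates the two points and \<open>d\<close> is comparable with the \<open>k\<close>-th scale, the
  \<open>k\<close>-th term is at least \<open>A * q ^ k / 2\<close>. Because consecutive scales are so far apart, the terms
  before and after it add up to at most \<open>17 / 127\<close> times \<open>A * q ^ k\<close> and cannot cancel it.\<close>

lemma hoelder_series_lower:
  fixes w :: "nat \<Rightarrow> real"
  assumes q: "0 < q" "q \<le> 1 / 128" and A: "0 < A" and d: "0 < d" and w1: "\<And>j. \<bar>w j\<bar> \<le> 1"
    and wd: "\<And>j. \<bar>w j\<bar> \<le> d / (A * q ^ j)\<^sup>2"
    and k: "d \<le> 16 * (A * q ^ k)\<^sup>2" "1 / 2 \<le> \<bar>w k\<bar>"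
  shows "sqrt d / 16 \<le> \<bar>\<Sum>j. A * q ^ j * w j\<bar>"
proof -
  define B where "B = A * q ^ k"
  have B: "0 < B" using A q by (simp add: B_def)
  have "d / B \<le> 16 * B\<^sup>2 / B" using k(1) B by (intro divide_right_mono) (auto simp: B_def)
  then have dB: "d / B \<le> 16 * B" using B by (simp add: power2_eq_square)
  have head: "\<bar>\<Sum>j<k. A * q ^ j * w j\<bar> \<le> d / B / 127"
    using geometric_head[OF q A _ wd, of k] d by (simp add: B_def)
  have "B * (1 / 2) \<le> B * \<bar>w k\<bar>" using k(2) B by (intro mult_left_mono) auto
  then have mid: "B / 2 \<le> \<bar>B * w k\<bar>" using B by (simp add: abs_mult)
  have "B * q \<le> B / 128" using mult_left_mono[OF q(2), of B] B by simp
  moreover have "\<bar>\<Sum>j. A * q ^ (j + Suc k) * w (j + Suc k)\<bar> \<le> A * q ^ Suc k * (128 / 127)"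
    by (rule geometric_tail'[OF q A w1])
  moreover have "A * q ^ Suc k = B * q" by (simp add: B_def)
  ultimately have tail: "\<bar>\<Sum>j. A * q ^ (j + Suc k) * w (j + Suc k)\<bar> \<le> B / 127" by linarith
  have "(\<Sum>j. A * q ^ j * w j) =
    (\<Sum>j. A * q ^ (j + Suc k) * w (j + Suc k)) + (\<Sum>j<Suc k. A * q ^ j * w j)"
    using q by (intro suminf_split_initial_segment geometric_tail(1) A w1) auto
  then have split: "(\<Sum>j. A * q ^ j * w j) =
    (\<Sum>j. A * q ^ (j + Suc k) * w (j + Suc k)) + ((\<Sum>j<k. A * q ^ j * w j) + B * w k)"
    unfolding B_def sum.lessThan_Suc .
  have "B / 4 \<le> \<bar>\<Sum>j. A * q ^ j * w j\<bar>"
  proof -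
    have "B / 4 \<le> \<bar>x + (y + z)\<bar>"
      if "\<bar>x\<bar> \<le> B / 127" "\<bar>y\<bar> \<le> a / 127" "B / 2 \<le> \<bar>z\<bar>" "a \<le> 16 * B" for x y z a
      using that B by linarith
    then show ?thesis unfolding split using head mid tail dB by blast
  qed
  moreover have "sqrt d \<le> 4 * B"
    using k(1) B by (intro real_le_lsqrt) (auto simp: B_def power_mult_distrib)
  ultimately show ?thesis by linarith
qed

lemma abs_le_mdist_Rn: "c < m \<Longrightarrow> \<bar>x c - y c\<bar> \<le> mdist (Rn m) x y"
  using member_le_L2_set[of "{..<m}" c "\<lambda>i. \<bar>x i - y i\<bar>"]
  by (simp add: mdist_Rn L2_set_def)

lemma mdist_Rn_le_sum: "mdist (Rn m) x y \<le> (\<Sum>c<m. \<bar>x c - y c\<bar>)"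
  using L2_set_le_sum_abs[of "\<lambda>i. x i - y i" "{..<m}"] by (simp add: mdist_Rn)

lemma bi_lipschitz_half_iff:
  "bi_lipschitz L (snowflake (1/2) X) Y g \<longleftrightarrow> L \<ge> 1 \<and> g ` mspace X \<subseteq> mspace Y \<and>
     (\<forall>x\<in>mspace X. \<forall>y\<in>mspace X.
        sqrt (mdist X x y) / L \<le> mdist Y (g x) (g y) \<and>
        mdist Y (g x) (g y) \<le> L * sqrt (mdist X x y))"
  by (simp add: bi_lipschitz_def mspace_snowflake mdist_snowflake powr_half_sqrt field_simps)

text \<open>Use the scales \<open>s / 4 ^ k\<close> with their bump functions. Summing over all scales would let neighbouring
  terms cancel, so the scales are divided into seven residue classes; within one class the square
  roots of the scales decrease by the factor \<open>2 ^ 7 = 128\<close>, as required for the lower estimate.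
  There is one coordinate for every residue class and every colour. Every distance is comparable
  with one of the scales, and the coordinate that belongs to this scale and a suitable colour gives
  the lower bound.\<close>

theorem assouad_embedding:
  assumes dbl: "doubling_with M X" and x0: "x0 \<in> mspace X" "mspace X \<subseteq> mcball_of X x0 \<Delta>"
  shows "\<exists>m L h. bi_lipschitz L (snowflake (1/2) X) (Rn m) h"
proof -
  define s where "s = max \<Delta> 1"
  have s: "0 < s" "\<Delta> \<le> s" by (auto simp: s_def)
  define good where "good \<epsilon> u \<longleftrightarrow>
    (\<forall>c. \<forall>x\<in>mspace X. 0 \<le> u c x \<and> u c x \<le> 1) \<and>
    (\<forall>c. \<forall>x\<in>mspace X. \<forall>y\<in>mspace X. \<bar>u c x - u c y\<bar> \<le> mdist X x y / \<epsilon>) \<and>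
    (\<forall>x\<in>mspace X. \<forall>y\<in>mspace X. 4 * \<epsilon> \<le> mdist X x y \<and> mdist X x y \<le> 16 * \<epsilon> \<longrightarrow>
       (\<exists>c\<le>M ^ 6. 1 / 2 \<le> \<bar>u c x - u c y\<bar>))" for \<epsilon> :: real and u :: "nat \<Rightarrow> 'a \<Rightarrow> real"
  have "\<exists>u. good (s / 4 ^ k) u" for k
    unfolding good_def using s(1) by (intro bump_family[OF assms]) simp
  then obtain u where u: "\<And>k. good (s / 4 ^ k) (u k)" by metis
  have u01: "0 \<le> u k c x \<and> u k c x \<le> 1" if "x \<in> mspace X" for k c x
    using u[of k] that unfolding good_def by blast
  have ulip: "\<bar>u k c x - u k c y\<bar> \<le> mdist X x y / (s / 4 ^ k)"
    if "x \<in> mspace X" "y \<in> mspace X" for k c x y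
    using u[of k] that unfolding good_def by blast
  have usep: "\<exists>c\<le>M ^ 6. 1 / 2 \<le> \<bar>u k c x - u k c y\<bar>"
    if "x \<in> mspace X" "y \<in> mspace X" "4 * (s / 4 ^ k) \<le> mdist X x y"
      "mdist X x y \<le> 16 * (s / 4 ^ k)" for k x y
    using u[of k] that unfolding good_def by blast
  define q where "q = (1 / 128 :: real)"
  have q: "0 < q" "q \<le> 1 / 128" "q < 1" by (auto simp: q_def)
  define m where "m = 7 * (M ^ 6 + 1)"
  define A where "A a = sqrt s * (1/2) ^ a" for a :: nat
  have A: "0 < A a" for a using s by (simp add: A_def)
  have A2: "(A a * q ^ j)\<^sup>2 = s / 4 ^ (a + 7 * j)" for a j
  proof -
    have "(A a * q ^ j)\<^sup>2 = s * (((1/2) ^ a)\<^sup>2 * ((1/128) ^ j)\<^sup>2)"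
      using s by (simp only: A_def q_def power_mult_distrib real_sqrt_pow2 mult.assoc)
    also have "((1/2::real) ^ a)\<^sup>2 = (1/4) ^ a"
      by (simp only: power_mult[symmetric] mult.commute[of a 2]) (simp add: power_mult power2_eq_square)
    also have "((1/128::real) ^ j)\<^sup>2 = ((1/4) ^ 7) ^ j"
      by (simp add: power2_eq_square power_divide flip: power_mult_distrib)
    also have "s * ((1/4) ^ a * ((1/4) ^ 7) ^ j) = s * (1/4) ^ (a + 7 * j)"
      by (simp only: power_add power_mult)
    finally show ?thesis by (simp add: power_one_over)
  qed
  define F where "F a c x = (\<Sum>j. A a * q ^ j * u (a + 7 * j) c x)" for a c x
  define h where "h x i = (if i < m then F (i mod 7) (i div 7) x else 0)" for x i
  have diff: "F a c x - F a c y = (\<Sum>j. A a * q ^ j * (u (a + 7 * j) c x - u (a + 7 * j) c y))"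
    if "x \<in> mspace X" "y \<in> mspace X" for a c x y
  proof -
    have sm: "summable (\<lambda>j. A a * q ^ j * u (a + 7 * j) c z)" if "z \<in> mspace X" for z
      using u01[OF that] by (intro summable_geometric_bounded q A) simp
    show ?thesis
      unfolding F_def suminf_diff[OF sm[OF that(1)] sm[OF that(2)]]
      by (simp only: right_diff_distrib)
  qed
  have w1: "\<bar>u k c x - u k c y\<bar> \<le> 1" if "x \<in> mspace X" "y \<in> mspace X" for k c x y
    using u01[OF that(1), of k c] u01[OF that(2), of k c] by linarith
  have wd: "\<bar>u (a + 7 * j) c x - u (a + 7 * j) c y\<bar> \<le> mdist X x y / (A a * q ^ j)\<^sup>2"
    if "x \<in> mspace X" "y \<in> mspace X" for a j c x y
    unfolding A2 using ulip[OF that] .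
  have up: "\<bar>h x i - h y i\<bar> \<le> 4 * sqrt (mdist X x y)" if "x \<in> mspace X" "y \<in> mspace X" for x y i
  proof (cases "x = y \<or> \<not> i < m")
    case True
    then show ?thesis using that by (auto simp: h_def)
  next
    case False
    then have "0 < mdist X x y" using that by (simp add: order_less_le)
    then show ?thesis
      using False hoelder_series_upper[OF q(1,2) A[of "i mod 7"] _ w1[OF that] wd[OF that]] diff[OF that]
      by (simp add: h_def)
  qed
  have upper: "mdist (Rn m) (h x) (h y) \<le> 4 * m * sqrt (mdist X x y)"
    if "x \<in> mspace X" "y \<in> mspace X" for x y
  proof -
    have "mdist (Rn m) (h x) (h y) \<le> (\<Sum>c<m. \<bar>h x c - h y c\<bar>)" by (rule mdist_Rn_le_sum)
    also have "\<dots> \<le> (\<Sum>c<m. 4 * sqrt (mdist X x y))" using up[OF that] by (intro sum_mono)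
    finally show ?thesis by simp
  qed
  have lower: "sqrt (mdist X x y) / 16 \<le> mdist (Rn m) (h x) (h y)"
    if xy: "x \<in> mspace X" "y \<in> mspace X" for x y
  proof (cases "x = y")
    case True
    then show ?thesis using that by simp
  next
    case False
    then have d: "0 < mdist X x y" using that by (simp add: order_less_le)
    have dmax: "mdist X x y \<le> 16 * s"
    proof -
      have "mdist X x y \<le> mdist X x x0 + mdist X x0 y" using xy x0(1) by (rule_tac mdist_triangle)
      moreover have "mdist X x0 x \<le> \<Delta>" "mdist X x0 y \<le> \<Delta>"
        using xy subsetD[OF x0(2)] by simp_all
      ultimately show ?thesis using s by (simp add: mdist_commute)
    qed
    define k where "k = (LEAST k. 4 * (s / 4 ^ k) \<le> mdist X x y)"
    obtain n where "(1/4::real) ^ n < mdist X x y / (4 * s)"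
      using real_arch_pow_inv[of "mdist X x y / (4 * s)" "1/4"] s d by auto
    then have ex: "4 * (s / 4 ^ n) \<le> mdist X x y" using s by (simp add: field_simps power_divide)
    have k1: "4 * (s / 4 ^ k) \<le> mdist X x y" unfolding k_def by (rule LeastI[of _ n]) (fact ex)
    have k2: "mdist X x y \<le> 16 * (s / 4 ^ k)"
    proof (cases k)
      case 0
      then show ?thesis using dmax by simp
    next
      case (Suc l)
      then have "\<not> 4 * (s / 4 ^ l) \<le> mdist X x y" using not_less_Least[of l "\<lambda>k. 4 * (s / 4 ^ k) \<le> mdist X x y"] k_def by simp
      then show ?thesis using Suc by simp
    qed
    obtain c where c: "c \<le> M ^ 6" "1 / 2 \<le> \<bar>u k c x - u k c y\<bar>" using usep[OF xy k1 k2] by blast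
    define a j where "a = k mod 7" and "j = k div 7"
    have kaj: "k = a + 7 * j" by (simp add: a_def j_def)
    define i where "i = a + 7 * c"
    have i: "i < m" "i mod 7 = a" "i div 7 = c" using c by (auto simp: i_def m_def a_def)
    have "sqrt (mdist X x y) / 16 \<le> \<bar>F a c x - F a c y\<bar>"
      unfolding diff[OF xy]
    proof (rule hoelder_series_lower[where w = "\<lambda>j. u (a + 7 * j) c x - u (a + 7 * j) c y" and k = j,
          OF q(1,2) A d w1[OF xy] wd[OF xy]])
      show "mdist X x y \<le> 16 * (A a * q ^ j)\<^sup>2" using k2 by (simp add: A2 kaj)
      show "1 / 2 \<le> \<bar>u (a + 7 * j) c x - u (a + 7 * j) c y\<bar>" using c by (simp add: kaj)
    qed
    also have "\<dots> = \<bar>h x i - h y i\<bar>" using i by (simp add: h_def)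
    also have "\<dots> \<le> mdist (Rn m) (h x) (h y)" using i by (intro abs_le_mdist_Rn)
    finally show ?thesis .
  qed
  define L where "L = 4 * real m + 16"
  have "bi_lipschitz L (snowflake (1/2) X) (Rn m) h"
    unfolding bi_lipschitz_half_iff
  proof (intro conjI ballI)
    fix x y assume xy: "x \<in> mspace X" "y \<in> mspace X"
    have "sqrt (mdist X x y) / L \<le> sqrt (mdist X x y) / 16"
      by (intro divide_left_mono) (auto simp: L_def)
    then show "sqrt (mdist X x y) / L \<le> mdist (Rn m) (h x) (h y)" using lower[OF xy] by linarith
    have "4 * m * sqrt (mdist X x y) \<le> L * sqrt (mdist X x y)"
      by (intro mult_right_mono) (auto simp: L_def)
    then show "mdist (Rn m) (h x) (h y) \<le> L * sqrt (mdist X x y)" using upper[OF xy] by linarith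
  qed (auto simp: L_def h_def mspace_Rn)
  then show ?thesis by blast
qed

section \<open>Spaces with a snowflake embedded in Euclidean space\<close>

lemma limitin_mtopology_of_iff:
  "limitin (mtopology_of E) xs x sequentially \<longleftrightarrow>
     x \<in> mspace E \<and> (\<forall>\<^sub>F i in sequentially. xs i \<in> mspace E) \<and> (\<lambda>i. mdist E (xs i) x) \<longlonglongrightarrow> 0"
  by (simp add: mtopology_of_def Metric_space.limitin_metric_dist_null)

lemma closedin_mtopology_of_sequentially:
  "closedin (mtopology_of E) S \<longleftrightarrow> S \<subseteq> mspace E \<and>
     (\<forall>xs x. (\<forall>i. xs i \<in> S) \<and> x \<in> mspace E \<and> (\<lambda>i. mdist E (xs i) x) \<longlonglongrightarrow> 0 \<longrightarrow> x \<in> S)"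
proof -
  have "closedin (mtopology_of E) S \<longleftrightarrow> S \<subseteq> mspace E \<and>
    (\<forall>xs x. range xs \<subseteq> S \<and> limitin (mtopology_of E) xs x sequentially \<longrightarrow> x \<in> S)"
    unfolding mtopology_of_def
    by (rule Metric_space.metric_closedin_iff_sequentially_closed) simp
  moreover have "range xs \<subseteq> S \<and> limitin (mtopology_of E) xs x sequentially \<longleftrightarrow>
      (\<forall>i. xs i \<in> S) \<and> x \<in> mspace E \<and> (\<lambda>i. mdist E (xs i) x) \<longlonglongrightarrow> 0"
    if "S \<subseteq> mspace E" for xs x
    using that by (auto simp: limitin_mtopology_of_iff subset_iff)
  ultimately show ?thesis by (simp cong: conj_cong)
qed

lemma mdist_Rn_triangle: "mdist (Rn m) x z \<le> mdist (Rn m) x y + mdist (Rn m) y z"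
  using L2_set_triangle_ineq[of "\<lambda>i. x i - y i" "\<lambda>i. y i - z i" "{..<m}"] by (simp add: mdist_Rn)

lemma tendsto_mdist_Rn:
  assumes "(\<lambda>i. mdist (Rn m) (xs i) a) \<longlonglongrightarrow> 0" "(\<lambda>i. mdist (Rn m) (ys i) b) \<longlonglongrightarrow> 0"
  shows "(\<lambda>i. mdist (Rn m) (xs i) (ys i)) \<longlonglongrightarrow> mdist (Rn m) a b"
proof (rule LIM_zero_cancel, rule Lim_null_comparison)
  show "\<forall>\<^sub>F i in sequentially. norm (mdist (Rn m) (xs i) (ys i) - mdist (Rn m) a b)
      \<le> mdist (Rn m) (xs i) a + mdist (Rn m) (ys i) b"
  proof (intro always_eventually allI)
    fix i
    show "norm (mdist (Rn m) (xs i) (ys i) - mdist (Rn m) a b)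
      \<le> mdist (Rn m) (xs i) a + mdist (Rn m) (ys i) b"
      using mdist_Rn_triangle[of m "xs i" "ys i" a] mdist_Rn_triangle[of m a "ys i" b]
        mdist_Rn_triangle[of m a b "xs i"] mdist_Rn_triangle[of m "xs i" b "ys i"]
        mdist_commute[of "Rn m" a "xs i"] mdist_commute[of "Rn m" b "ys i"] by simp
  qed
  show "(\<lambda>i. mdist (Rn m) (xs i) a + mdist (Rn m) (ys i) b) \<longlonglongrightarrow> 0"
    using tendsto_add[OF assms] by simp
qed

lemma tendsto_Rn_coordinatewise:
  assumes "\<And>c. c < m \<Longrightarrow> (\<lambda>i. xs i c) \<longlonglongrightarrow> a c"
  shows "(\<lambda>i. mdist (Rn m) (xs i) a) \<longlonglongrightarrow> 0"
proof (rule Lim_null_comparison)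
  show "\<forall>\<^sub>F i in sequentially. norm (mdist (Rn m) (xs i) a) \<le> (\<Sum>c<m. \<bar>xs i c - a c\<bar>)"
    using mdist_Rn_le_sum by simp
  have "(\<lambda>i. \<bar>xs i c - a c\<bar>) \<longlonglongrightarrow> 0" if "c < m" for c
    using assms[OF that] tendsto_rabs_zero LIM_zero by blast
  then show "(\<lambda>i. \<Sum>c<m. \<bar>xs i c - a c\<bar>) \<longlonglongrightarrow> 0"
    by (intro tendsto_null_sum) auto
qed

lemma convergent_Rn_coordinatewise:
  assumes "\<And>c. c < m \<Longrightarrow> convergent (\<lambda>i. xs i c)"
  shows "\<exists>a\<in>mspace (Rn m). (\<lambda>i. mdist (Rn m) (xs i) a) \<longlonglongrightarrow> 0"
proof -
  have lim: "(\<lambda>i. xs i c) \<longlonglongrightarrow> lim (\<lambda>i. xs i c)" if "c < m" for c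
    using assms[OF that] by (simp add: convergent_LIMSEQ_iff)
  define a where "a c = (if c < m then lim (\<lambda>i. xs i c) else 0)" for c
  have "(\<lambda>i. mdist (Rn m) (xs i) a) \<longlonglongrightarrow> 0"
    by (rule tendsto_Rn_coordinatewise) (simp add: a_def lim)
  moreover have "a \<in> mspace (Rn m)" by (simp add: a_def mspace_Rn)
  ultimately show ?thesis by blast
qed

lemma mcomplete_Rn: "mcomplete_of (Rn m)"
  unfolding mcomplete_of_def Metric_space.mcomplete_def[OF Metric_space_mspace_mdist]
proof (intro allI impI)
  fix \<sigma> assume "Metric_space.MCauchy (mspace (Rn m)) (mdist (Rn m)) \<sigma>"
  then have \<sigma>: "range \<sigma> \<subseteq> mspace (Rn m)"
    "\<forall>\<epsilon>>0. \<exists>N. \<forall>n n'. N \<le> n \<longrightarrow> N \<le> n' \<longrightarrow> mdist (Rn m) (\<sigma> n) (\<sigma> n') < \<epsilon>"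
    by (simp_all add: Metric_space.MCauchy_def)
  have "Cauchy (\<lambda>i. \<sigma> i c)" if "c < m" for c
    unfolding Cauchy_def
  proof (intro allI impI)
    fix e :: real assume "0 < e"
    then obtain N where N: "\<forall>n n'. N \<le> n \<longrightarrow> N \<le> n' \<longrightarrow> mdist (Rn m) (\<sigma> n) (\<sigma> n') < e"
      using \<sigma>(2) by blast
    show "\<exists>M. \<forall>i\<ge>M. \<forall>n\<ge>M. dist (\<sigma> i c) (\<sigma> n c) < e"
    proof (intro exI[of _ N] allI impI)
      fix i n assume "N \<le> i" "N \<le> n"
      then have "mdist (Rn m) (\<sigma> i) (\<sigma> n) < e" using N by blast
      then show "dist (\<sigma> i c) (\<sigma> n c) < e"
        using abs_le_mdist_Rn[OF that, of "\<sigma> i" "\<sigma> n"] by (simp add: dist_real_def)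
    qed
  qed
  then have "\<exists>a\<in>mspace (Rn m). (\<lambda>i. mdist (Rn m) (\<sigma> i) a) \<longlonglongrightarrow> 0"
    by (intro convergent_Rn_coordinatewise real_Cauchy_convergent)
  then obtain a where "a \<in> mspace (Rn m)" "(\<lambda>i. mdist (Rn m) (\<sigma> i) a) \<longlonglongrightarrow> 0" by blast
  then have "limitin (mtopology_of (Rn m)) \<sigma> a sequentially"
    unfolding limitin_mtopology_of_iff using \<sigma>(1) by (auto intro!: always_eventually)
  then show "\<exists>a. limitin (Metric_space.mtopology (mspace (Rn m)) (mdist (Rn m))) \<sigma> a sequentially"
    unfolding mtopology_of_def by blast
qed

lemma bi_lipschitz_halfD:
  assumes "bi_lipschitz L (snowflake (1/2) X) (Rn m) h"
  shows "1 \<le> L" "x \<in> mspace X \<Longrightarrow> h x \<in> mspace (Rn m)"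
    "x \<in> mspace X \<Longrightarrow> y \<in> mspace X \<Longrightarrow> mdist (Rn m) (h x) (h y) \<le> L * sqrt (mdist X x y)"
    "x \<in> mspace X \<Longrightarrow> y \<in> mspace X \<Longrightarrow> sqrt (mdist X x y) \<le> L * mdist (Rn m) (h x) (h y)"
    "x \<in> mspace X \<Longrightarrow> y \<in> mspace X \<Longrightarrow> mdist X x y \<le> (L * mdist (Rn m) (h x) (h y))\<^sup>2"
    "inj_on h (mspace X)"
proof -
  note b = assms[unfolded bi_lipschitz_half_iff]
  show L: "1 \<le> L" using b by blast
  show "x \<in> mspace X \<Longrightarrow> h x \<in> mspace (Rn m)" for x using b by blast
  show "x \<in> mspace X \<Longrightarrow> y \<in> mspace X \<Longrightarrow> mdist (Rn m) (h x) (h y) \<le> L * sqrt (mdist X x y)" for x y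
    using b by blast
  show low: "sqrt (mdist X x y) \<le> L * mdist (Rn m) (h x) (h y)"
    if "x \<in> mspace X" "y \<in> mspace X" for x y
  proof -
    have "sqrt (mdist X x y) / L \<le> mdist (Rn m) (h x) (h y)" using b that by blast
    then show ?thesis using L by (simp add: divide_le_eq mult.commute)
  qed
  show sq: "mdist X x y \<le> (L * mdist (Rn m) (h x) (h y))\<^sup>2"
    if "x \<in> mspace X" "y \<in> mspace X" for x y
    using low[OF that] by (rule sqrt_le_D)
  show "inj_on h (mspace X)"
  proof (rule inj_onI)
    fix x y assume xy: "x \<in> mspace X" "y \<in> mspace X" "h x = h y"
    then have "mdist X x y \<le> 0" using sq[OF xy(1,2)] b by (auto simp: image_subset_iff)
    then have "mdist X x y = 0" using mdist_nonneg[of X x y] by linarith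
    then show "x = y" using xy by simp
  qed
qed

lemma tendsto_bi_lipschitz_half:
  assumes b: "\<And>i. bi_lipschitz L (snowflake (1/2) (X i)) (Rn m) (h i)"
    and "\<And>i. xs i \<in> mspace (X i)" "\<And>i. ys i \<in> mspace (X i)"
  shows "(\<lambda>i. mdist (Rn m) (h i (xs i)) (h i (ys i))) \<longlonglongrightarrow> 0 \<longleftrightarrow> (\<lambda>i. mdist (X i) (xs i) (ys i)) \<longlonglongrightarrow> 0"
proof
  assume "(\<lambda>i. mdist (Rn m) (h i (xs i)) (h i (ys i))) \<longlonglongrightarrow> 0"
  then have "(\<lambda>i. (L * mdist (Rn m) (h i (xs i)) (h i (ys i)))\<^sup>2) \<longlonglongrightarrow> (L * 0)\<^sup>2"
    by (intro tendsto_intros)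
  then have lim: "(\<lambda>i. (L * mdist (Rn m) (h i (xs i)) (h i (ys i)))\<^sup>2) \<longlonglongrightarrow> 0" by simp
  show "(\<lambda>i. mdist (X i) (xs i) (ys i)) \<longlonglongrightarrow> 0"
    by (rule Lim_null_comparison[OF _ lim])
       (use bi_lipschitz_halfD(5)[OF b assms(2,3)] in \<open>simp add: always_eventually\<close>)
next
  assume "(\<lambda>i. mdist (X i) (xs i) (ys i)) \<longlonglongrightarrow> 0"
  then have "(\<lambda>i. L * sqrt (mdist (X i) (xs i) (ys i))) \<longlonglongrightarrow> L * sqrt 0"
    by (intro tendsto_intros)
  then have lim: "(\<lambda>i. L * sqrt (mdist (X i) (xs i) (ys i))) \<longlonglongrightarrow> 0" by simp
  show "(\<lambda>i. mdist (Rn m) (h i (xs i)) (h i (ys i))) \<longlonglongrightarrow> 0"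
    by (rule Lim_null_comparison[OF _ lim])
       (use bi_lipschitz_halfD(3)[OF b assms(2,3)] in \<open>simp add: always_eventually\<close>)
qed

lemma MCauchy_modulus:
  assumes c: "Metric_space.MCauchy (mspace X) (mdist X) xs" and y: "\<And>i. ys i \<in> mspace Y"
    and le: "\<And>n n'. mdist Y (ys n) (ys n') \<le> \<phi> (mdist X (xs n) (xs n'))"
    and \<phi>: "\<And>\<epsilon>. 0 < \<epsilon> \<Longrightarrow> \<exists>\<delta>>0. \<forall>u. 0 \<le> u \<and> u < \<delta> \<longrightarrow> \<phi> u < \<epsilon>"
  shows "Metric_space.MCauchy (mspace Y) (mdist Y) ys"
  unfolding Metric_space.MCauchy_def[OF Metric_space_mspace_mdist]
proof (intro conjI allI impI)
  show "range ys \<subseteq> mspace Y" using y by blast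
  fix \<epsilon> :: real assume "0 < \<epsilon>"
  from \<phi>[OF this] obtain \<delta> where \<delta>: "0 < \<delta>" "\<And>u. 0 \<le> u \<Longrightarrow> u < \<delta> \<Longrightarrow> \<phi> u < \<epsilon>" by blast
  then obtain n0 where n0: "\<forall>n n'. n0 \<le> n \<longrightarrow> n0 \<le> n' \<longrightarrow> mdist X (xs n) (xs n') < \<delta>"
    using conjunct2[OF c[unfolded Metric_space.MCauchy_def[OF Metric_space_mspace_mdist]]] by blast
  have "mdist Y (ys n) (ys n') < \<epsilon>" if "n0 \<le> n" "n0 \<le> n'" for n n'
    using le_less_trans[OF le \<delta>(2)[OF mdist_nonneg]] n0 that by blast
  then show "\<exists>N. \<forall>n n'. N \<le> n \<longrightarrow> N \<le> n' \<longrightarrow> mdist Y (ys n) (ys n') < \<epsilon>" by blast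
qed

lemma MCauchy_bi_lipschitz_half:
  assumes b: "bi_lipschitz L (snowflake (1/2) X) (Rn m) h" and x: "\<And>i. xs i \<in> mspace X"
  shows "Metric_space.MCauchy (mspace (Rn m)) (mdist (Rn m)) (\<lambda>i. h (xs i)) \<longleftrightarrow>
    Metric_space.MCauchy (mspace X) (mdist X) xs" (is "?R \<longleftrightarrow> ?X")
proof
  have L: "0 < L" using bi_lipschitz_halfD(1)[OF b] by simp
  show ?X if ?R
  proof (rule MCauchy_modulus[where \<phi> = "\<lambda>u. (L * u)\<^sup>2", OF that x bi_lipschitz_halfD(5)[OF b x x]])
    fix \<epsilon> :: real assume e: "0 < \<epsilon>"
    have "(L * u)\<^sup>2 < \<epsilon>" if u: "0 \<le> u" "u < sqrt \<epsilon> / L" for u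
    proof -
      have "L * u < sqrt \<epsilon>" using u(2) L by (simp add: pos_less_divide_eq mult.commute)
      then have "(L * u)\<^sup>2 < (sqrt \<epsilon>)\<^sup>2" using u(1) L by (intro power_strict_mono) auto
      then show ?thesis using e by simp
    qed
    then show "\<exists>\<delta>>0. \<forall>u. 0 \<le> u \<and> u < \<delta> \<longrightarrow> (L * u)\<^sup>2 < \<epsilon>"
      using e L by (intro exI[of _ "sqrt \<epsilon> / L"]) simp
  qed
  show ?R if ?X
  proof (rule MCauchy_modulus[where \<phi> = "\<lambda>u. L * sqrt u",
        OF that bi_lipschitz_halfD(2)[OF b x] bi_lipschitz_halfD(3)[OF b x x]])
    fix \<epsilon> :: real assume e: "0 < \<epsilon>"
    have "L * sqrt u < \<epsilon>" if u: "0 \<le> u" "u < (\<epsilon> / L)\<^sup>2" for u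
    proof -
      have "sqrt u < \<epsilon> / L" using u e L by (intro real_less_lsqrt) auto
      then show ?thesis using L by (simp add: pos_less_divide_eq mult.commute)
    qed
    then show "\<exists>\<delta>>0. \<forall>u. 0 \<le> u \<and> u < \<delta> \<longrightarrow> L * sqrt u < \<epsilon>"
      using e L by (intro exI[of _ "(\<epsilon> / L)\<^sup>2"]) simp
  qed
qed

lemma mcomplete_of_iff_sequences:
  "mcomplete_of X \<longleftrightarrow> (\<forall>xs. Metric_space.MCauchy (mspace X) (mdist X) xs \<longrightarrow>
     (\<exists>x\<in>mspace X. (\<lambda>i. mdist X (xs i) x) \<longlonglongrightarrow> 0))"
proof -
  have "(\<exists>x. limitin (mtopology_of X) xs x sequentially) \<longleftrightarrow> (\<exists>x\<in>mspace X. (\<lambda>i. mdist X (xs i) x) \<longlonglongrightarrow> 0)"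
    if "Metric_space.MCauchy (mspace X) (mdist X) xs" for xs
  proof -
    have "xs i \<in> mspace X" for i using that by (auto simp: Metric_space.MCauchy_def)
    then show ?thesis by (auto simp: limitin_mtopology_of_iff)
  qed
  then show ?thesis
    unfolding mcomplete_of_def Metric_space.mcomplete_def[OF Metric_space_mspace_mdist] mtopology_of_def
    by simp
qed

lemma MCauchy_if_tendsto:
  assumes "\<And>i. xs i \<in> mspace X" "x \<in> mspace X" "(\<lambda>i. mdist X (xs i) x) \<longlonglongrightarrow> 0"
  shows "Metric_space.MCauchy (mspace X) (mdist X) xs"
proof (rule Metric_space.convergent_imp_MCauchy[OF Metric_space_mspace_mdist])
  show "range xs \<subseteq> mspace X" using assms(1) by blast
  have "limitin (mtopology_of X) xs x sequentially"
    using assms by (simp add: limitin_mtopology_of_iff)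
  then show "limitin (Metric_space.mtopology (mspace X) (mdist X)) xs x sequentially"
    by (simp add: mtopology_of_def)
qed

text \<open>A bi-Lipschitz map of a snowflake preserves and reflects convergence and Cauchy sequences, and the
  Euclidean space is complete.\<close>

lemma complete_iff_closed_image:
  assumes b: "bi_lipschitz L (snowflake (1/2) X) (Rn m) h"
  shows "mcomplete_of X \<longleftrightarrow> closedin (mtopology_of (Rn m)) (h ` mspace X)"
proof
  assume c: "mcomplete_of X"
  show "closedin (mtopology_of (Rn m)) (h ` mspace X)"
    unfolding closedin_mtopology_of_sequentially
  proof (intro conjI allI impI)
    show "h ` mspace X \<subseteq> mspace (Rn m)" using bi_lipschitz_halfD(2)[OF b] by blast
    fix ys y assume "(\<forall>i. ys i \<in> h ` mspace X) \<and> y \<in> mspace (Rn m) \<and> (\<lambda>i. mdist (Rn m) (ys i) y) \<longlonglongrightarrow> 0"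
    then have ys: "\<And>i. ys i \<in> h ` mspace X" and y: "y \<in> mspace (Rn m)"
      and lim: "(\<lambda>i. mdist (Rn m) (ys i) y) \<longlonglongrightarrow> 0" by auto
    define xs where "xs i = inv_into (mspace X) h (ys i)" for i
    have xs: "xs i \<in> mspace X" "h (xs i) = ys i" for i
      unfolding xs_def using ys[of i] by (rule inv_into_into, rule f_inv_into_f)
    have ysR: "ys i \<in> mspace (Rn m)" for i using bi_lipschitz_halfD(2)[OF b xs(1)[of i]] xs(2)[of i] by simp
    have "Metric_space.MCauchy (mspace (Rn m)) (mdist (Rn m)) ys"
      by (rule MCauchy_if_tendsto[OF ysR y lim])
    then have "Metric_space.MCauchy (mspace X) (mdist X) xs"
      using MCauchy_bi_lipschitz_half[OF b, of xs, OF xs(1)] xs(2) by simp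
    then obtain x where x: "x \<in> mspace X" "(\<lambda>i. mdist X (xs i) x) \<longlonglongrightarrow> 0"
      using c unfolding mcomplete_of_iff_sequences by blast
    have "(\<lambda>i. mdist (Rn m) (h (xs i)) (h x)) \<longlonglongrightarrow> 0"
      using tendsto_bi_lipschitz_half[of L "\<lambda>_. X" m "\<lambda>_. h" xs "\<lambda>_. x"] b xs(1) x by simp
    then have "(\<lambda>i. mdist (Rn m) (ys i) (ys i)) \<longlonglongrightarrow> mdist (Rn m) y (h x)"
      using lim by (intro tendsto_mdist_Rn) (simp_all add: xs(2))
    moreover have "mdist (Rn m) (ys i) (ys i) = 0" for i by (rule mdist_self[OF ysR])
    ultimately have "mdist (Rn m) y (h x) = 0" by (simp add: LIMSEQ_const_iff)
    then have "y = h x" using y bi_lipschitz_halfD(2)[OF b x(1)] by simp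
    then show "y \<in> h ` mspace X" using x(1) by blast
  qed
next
  assume cl: "closedin (mtopology_of (Rn m)) (h ` mspace X)"
  show "mcomplete_of X"
    unfolding mcomplete_of_iff_sequences
  proof (intro allI impI)
    fix xs assume c: "Metric_space.MCauchy (mspace X) (mdist X) xs"
    then have x: "xs i \<in> mspace X" for i by (auto simp: Metric_space.MCauchy_def)
    then have "Metric_space.MCauchy (mspace (Rn m)) (mdist (Rn m)) (\<lambda>i. h (xs i))"
      using MCauchy_bi_lipschitz_half[OF b] c by blast
    then obtain y where y: "y \<in> mspace (Rn m)" "(\<lambda>i. mdist (Rn m) (h (xs i)) y) \<longlonglongrightarrow> 0"
      using mcomplete_Rn[of m] unfolding mcomplete_of_iff_sequences by blast
    have "\<forall>i. h (xs i) \<in> h ` mspace X" using x by blast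
    then have "y \<in> h ` mspace X"
      using cl y unfolding closedin_mtopology_of_sequentially by metis
    then obtain z where z: "z \<in> mspace X" "y = h z" by blast
    then have "(\<lambda>i. mdist X (xs i) z) \<longlonglongrightarrow> 0"
      using tendsto_bi_lipschitz_half[of L "\<lambda>_. X" m "\<lambda>_. h" xs "\<lambda>_. z"] b x y by simp
    then show "\<exists>z\<in>mspace X. (\<lambda>i. mdist X (xs i) z) \<longlonglongrightarrow> 0" using z by blast
  qed
qed

definition cell :: "nat \<Rightarrow> real \<Rightarrow> (nat \<Rightarrow> real) \<Rightarrow> int list" where
  "cell m s x = map (\<lambda>c. \<lfloor>x c / s\<rfloor>) [0..<m]"

lemma same_cell_mdist_le:
  assumes "0 < s" "cell m s x = cell m s y"
  shows "mdist (Rn m) x y \<le> m * s"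
proof -
  have "\<bar>x c - y c\<bar> \<le> s" if "c < m" for c
  proof -
    have "\<lfloor>x c / s\<rfloor> = \<lfloor>y c / s\<rfloor>" using assms(2) that by (simp add: cell_def)
    then have "\<bar>x c / s - y c / s\<bar> < 1" by linarith
    then have "\<bar>(x c - y c) / s\<bar> < 1" by (simp add: diff_divide_distrib)
    then show ?thesis using assms(1) by (simp add: abs_divide)
  qed
  then have "(\<Sum>c<m. \<bar>x c - y c\<bar>) \<le> (\<Sum>c<m. s)" by (intro sum_mono) simp
  then show ?thesis using mdist_Rn_le_sum[of m x y] by simp
qed

text \<open>The labels that occur for points with coordinates of modulus at most \<open>K * s\<close>. The set depends on
  the ratio \<open>K\<close> only, which is what makes the doubling constant below independent of the radius.\<close>

definition cells :: "nat \<Rightarrow> nat \<Rightarrow> int list set" where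
  "cells m K = {v. set v \<subseteq> {- int K - 1..int K + 1} \<and> length v = m}"

lemma finite_cells: "finite (cells m K)"
  unfolding cells_def by (intro finite_lists_length_eq) simp

lemma cell_in_cells:
  assumes "0 < s" "\<And>c. c < m \<Longrightarrow> \<bar>x c\<bar> \<le> K * s"
  shows "cell m s x \<in> cells m K"
proof -
  have "\<lfloor>x c / s\<rfloor> \<in> {- int K - 1..int K + 1}" if "c < m" for c
  proof -
    have "\<bar>x c\<bar> / s \<le> K" using assms(1) assms(2)[OF that] by (simp add: field_simps)
    then have "\<bar>x c / s\<bar> \<le> K" using assms(1) by (simp add: abs_divide)
    then have "- real K \<le> x c / s" "x c / s \<le> real K" by linarith+
    then have "- int K \<le> \<lfloor>x c / s\<rfloor>" "\<lfloor>x c / s\<rfloor> \<le> int K" by (simp_all add: le_floor_iff floor_le_iff)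
    then show ?thesis by simp
  qed
  then show ?thesis by (auto simp: cells_def cell_def)
qed

text \<open>A ball of radius \<open>r\<close> has an image of size \<open>L * sqrt r\<close>. Cut this image into cubes of a side length
  proportional to \<open>sqrt r\<close>: the number of cubes does not depend on \<open>r\<close>, and points with images in the
  same cube are at distance at most \<open>r / 2\<close>.\<close>

lemma doubling_of_embedding:
  assumes b: "bi_lipschitz L (snowflake (1/2) X) (Rn m) h"
  shows "doubling X"
proof -
  note L = bi_lipschitz_halfD(1)[OF b]
  define \<kappa> where "\<kappa> = 1 / (2 * L * (real m + 1))"
  have \<kappa>: "0 < \<kappa>" using L by (simp add: \<kappa>_def)
  obtain K :: nat where K: "L / \<kappa> \<le> K" using real_arch_simple by blast
  have "doubling_with (card (cells m K)) X"
    unfolding doubling_with_def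
  proof (intro ballI allI impI)
    fix x and r :: real assume x: "x \<in> mspace X" and r: "0 < r"
    define s where "s = sqrt r * \<kappa>"
    have s: "0 < s" using r \<kappa> by (simp add: s_def)
    define v where "v y = cell m s (\<lambda>c. h y c - h x c)" for y
    have v: "v y \<in> cells m K" if "y \<in> mcball_of X x r" for y
      unfolding v_def
    proof (rule cell_in_cells[OF s])
      fix c assume c: "c < m"
      have "\<bar>h y c - h x c\<bar> \<le> mdist (Rn m) (h y) (h x)" by (rule abs_le_mdist_Rn[OF c])
      also have "\<dots> \<le> L * sqrt (mdist X y x)" using that by (intro bi_lipschitz_halfD(3)[OF b]) auto
      also have "\<dots> \<le> L * sqrt r"
        using that L by (intro mult_left_mono) (auto simp: mdist_commute)
      also have "\<dots> = (L / \<kappa>) * s" using \<kappa> by (simp add: s_def)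
      also have "\<dots> \<le> K * s" using K s by (intro mult_right_mono) auto
      finally show "\<bar>h y c - h x c\<bar> \<le> K * s" .
    qed
    define g where "g w = (SOME y. y \<in> mcball_of X x r \<and> v y = w)" for w
    define C where "C = g ` v ` mcball_of X x r"
    have g: "g (v y) \<in> mcball_of X x r \<and> v (g (v y)) = v y" if "y \<in> mcball_of X x r" for y
      unfolding g_def by (rule someI[of _ y]) (use that in simp)
    have sub: "v ` mcball_of X x r \<subseteq> cells m K" using v by blast
    then have fin: "finite (v ` mcball_of X x r)" using finite_cells finite_subset by blast
    have "card C \<le> card (v ` mcball_of X x r)" unfolding C_def by (rule card_image_le[OF fin])
    also have "\<dots> \<le> card (cells m K)" by (rule card_mono[OF finite_cells sub])
    finally have card: "card C \<le> card (cells m K)" .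
    have CX: "C \<subseteq> mspace X" using g by (auto simp: C_def)
    have "mcball_of X x r \<subseteq> (\<Union>c\<in>C. mcball_of X c (r / 2))"
    proof
      fix y assume y: "y \<in> mcball_of X x r"
      define z where "z = g (v y)"
      have z: "z \<in> C" "z \<in> mspace X" "v z = v y" using g[OF y] y by (auto simp: C_def z_def)
      have "mdist (Rn m) (h z) (h y) = mdist (Rn m) (\<lambda>c. h z c - h x c) (\<lambda>c. h y c - h x c)"
        by (simp add: mdist_Rn)
      also have "\<dots> \<le> m * s" using z(3) by (intro same_cell_mdist_le s) (simp add: v_def)
      finally have "L * mdist (Rn m) (h z) (h y) \<le> L * (m * s)" using L by (intro mult_left_mono) auto
      also have "\<dots> = sqrt r * (m / (real m + 1)) / 2"
      proof -
        have cancel: "l * (a * (b * (1 / (2 * l * t)))) = b * (a / t) / 2" if "l \<noteq> 0" "t \<noteq> 0" for a b l t :: real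
          using that by (simp add: field_simps)
        have "L \<noteq> 0" "real m + 1 \<noteq> 0" using L by linarith+
        then show ?thesis unfolding s_def \<kappa>_def by (rule cancel)
      qed
      also have "\<dots> \<le> sqrt r * 1 / 2"
        using r by (intro divide_right_mono mult_left_mono) auto
      finally have le: "L * mdist (Rn m) (h z) (h y) \<le> sqrt r / 2" by simp
      have "mdist X z y \<le> (L * mdist (Rn m) (h z) (h y))\<^sup>2"
        using z y by (intro bi_lipschitz_halfD(5)[OF b]) auto
      also have "\<dots> \<le> (sqrt r / 2)\<^sup>2" using le L by (intro power_mono) auto
      also have "\<dots> = r / 4" using r by (simp add: power_divide)
      finally have "mdist X z y \<le> r / 2" using r by simp
      then show "y \<in> (\<Union>c\<in>C. mcball_of X c (r / 2))" using z y by auto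
    qed
    then show "\<exists>C\<subseteq>mspace X. finite C \<and> card C \<le> card (cells m K) \<and>
        mcball_of X x r \<subseteq> (\<Union>c\<in>C. mcball_of X c (r / 2))"
      using CX card fin by (intro exI[of _ C]) (simp add: C_def)
  qed
  then show ?thesis unfolding doubling_def by blast
qed

lemma doubling_withD:
  assumes "doubling_with M X" "x \<in> mspace X" "0 < r"
  obtains C where "C \<subseteq> mspace X" "finite C" "card C \<le> M"
    "mcball_of X x r \<subseteq> (\<Union>c\<in>C. mcball_of X c (r / 2))"
  using assms(1)[unfolded doubling_with_def, rule_format, OF assms(2,3)] by (elim exE conjE)

lemma doubling_with_mono:
  assumes "doubling_with M X" "M \<le> M'"
  shows "doubling_with M' X"
  unfolding doubling_with_def
proof (intro ballI allI impI)
  fix x and r :: real assume x: "x \<in> mspace X" "0 < r"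
  obtain C where C: "C \<subseteq> mspace X" "finite C" "card C \<le> M"
    "mcball_of X x r \<subseteq> (\<Union>c\<in>C. mcball_of X c (r / 2))"
    by (rule doubling_withD[OF assms(1) x])
  show "\<exists>C\<subseteq>mspace X. finite C \<and> card C \<le> M' \<and> mcball_of X x r \<subseteq> (\<Union>c\<in>C. mcball_of X c (r / 2))"
    by (rule exI[of _ C], intro conjI, rule C(1), rule C(2), rule order_trans[OF C(3) assms(2)], rule C(4))
qed

lemma doubling_with_rescale:
  assumes "doubling_with M X" "0 < s"
  shows "doubling_with M (rescale s X)"
proof -
  have ball: "mcball_of (rescale s X) x r = mcball_of X x (r * s)" for x r
    by (rule set_eqI) (simp add: assms(2) mspace_rescale mdist_rescale pos_divide_le_eq)
  show ?thesis
    unfolding doubling_with_def ball mspace_rescale[OF assms(2)]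
  proof (intro ballI allI impI)
    fix x and r :: real assume x: "x \<in> mspace X" and "0 < r"
    then have "0 < r * s" using assms(2) by simp
    from doubling_withD[OF assms(1) x this] obtain C where C: "C \<subseteq> mspace X" "finite C" "card C \<le> M"
      "mcball_of X x (r * s) \<subseteq> (\<Union>c\<in>C. mcball_of X c (r * s / 2))"
      by metis
    show "\<exists>C\<subseteq>mspace X. finite C \<and> card C \<le> M \<and> mcball_of X x (r * s) \<subseteq> (\<Union>c\<in>C. mcball_of X c (r / 2 * s))"
      unfolding times_divide_eq_left using C by (intro exI[of _ C] conjI)
  qed
qed

section \<open>Limits of embedded metric spaces\<close>

lemma excess_tendsto_0I:
  fixes A B :: "nat \<Rightarrow> (nat \<Rightarrow> real) set"
  assumes close: "\<And>\<epsilon>. 0 < \<epsilon> \<Longrightarrow>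
    \<forall>\<^sub>F i in sequentially. \<forall>x\<in>A i. \<exists>y\<in>B i. mdist (Rn m) x y \<le> \<epsilon>"
  shows "(\<lambda>i. SUP x\<in>A i. INF y\<in>B i. ennreal (mdist (Rn m) x y)) \<longlonglongrightarrow> 0"
proof (rule order_tendstoI)
  fix a :: ennreal assume a: "0 < a"
  obtain \<epsilon> where e: "0 < \<epsilon>" "ennreal \<epsilon> < a"
  proof (cases a)
    case (real r)
    then show ?thesis using a that[of "r / 2"] by (simp add: ennreal_less_iff)
  next
    case top
    then show ?thesis using that[of 1] by simp
  qed
  show "\<forall>\<^sub>F i in sequentially. (SUP x\<in>A i. INF y\<in>B i. ennreal (mdist (Rn m) x y)) < a"
    using close[OF e(1)]
  proof (rule eventually_mono)
    fix i assume i: "\<forall>x\<in>A i. \<exists>y\<in>B i. mdist (Rn m) x y \<le> \<epsilon>"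
    have "(INF y\<in>B i. ennreal (mdist (Rn m) x y)) \<le> ennreal \<epsilon>" if x: "x \<in> A i" for x
    proof -
      obtain y where "y \<in> B i" "mdist (Rn m) x y \<le> \<epsilon>" using i x by blast
      then show ?thesis by (intro INF_lower2[of y] ennreal_leI)
    qed
    then have "(SUP x\<in>A i. INF y\<in>B i. ennreal (mdist (Rn m) x y)) \<le> ennreal \<epsilon>" by (rule SUP_least)
    then show "(SUP x\<in>A i. INF y\<in>B i. ennreal (mdist (Rn m) x y)) < a" using e(2) by simp
  qed
qed simp

text \<open>Pointed spaces whose \<open>1/2\<close>-snowflakes are embedded in one Euclidean space with a common constant.
  The points \<open>N i n\<close> form a net that is uniform in \<open>i\<close>: finitely many indices serve a ball of given
  radius in all spaces at once. The net points and their mutual distances are assumed to converge;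
  everything else converges as a consequence.\<close>

locale embedded_sequence =
  fixes E :: "nat \<Rightarrow> 'a metric" and p :: "nat \<Rightarrow> 'a" and k :: "nat \<Rightarrow> 'a \<Rightarrow> nat \<Rightarrow> real"
    and m :: nat and L :: real and N :: "nat \<Rightarrow> 'k \<Rightarrow> 'a"
  assumes emb: "\<And>i. bi_lipschitz L (snowflake (1/2) (E i)) (Rn m) (k i)"
    and base: "\<And>i. p i \<in> mspace (E i)" "\<And>i. k i (p i) = (\<lambda>_. 0)"
    and net_in: "\<And>i n. N i n \<in> mspace (E i)"
    and net: "\<And>R \<epsilon>. 0 < \<epsilon> \<Longrightarrow> \<exists>J. finite J \<and>
      (\<forall>i. \<forall>x\<in>mspace (E i). mdist (E i) (p i) x \<le> R \<longrightarrow> (\<exists>n\<in>J. mdist (E i) x (N i n) \<le> \<epsilon>))"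
    and net_limit: "\<And>n. \<exists>a\<in>mspace (Rn m). (\<lambda>i. mdist (Rn m) (k i (N i n)) a) \<longlonglongrightarrow> 0"
    and net_dist: "\<And>n n'. convergent (\<lambda>i. mdist (E i) (N i n) (N i n'))"
begin

text \<open>The points \<open>xs i\<close> live in different spaces; they converge if their images in the Euclidean space do.\<close>

definition conv :: "(nat \<Rightarrow> 'a) \<Rightarrow> (nat \<Rightarrow> real) \<Rightarrow> bool" where
  "conv xs a \<longleftrightarrow> (\<forall>i. xs i \<in> mspace (E i)) \<and> a \<in> mspace (Rn m) \<and>
     (\<lambda>i. mdist (Rn m) (k i (xs i)) a) \<longlonglongrightarrow> 0"

lemma convD: "conv xs a \<Longrightarrow> xs i \<in> mspace (E i)" "conv xs a \<Longrightarrow> a \<in> mspace (Rn m)"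
  "conv xs a \<Longrightarrow> (\<lambda>i. mdist (Rn m) (k i (xs i)) a) \<longlonglongrightarrow> 0"
  by (simp_all add: conv_def)

lemma L1: "1 \<le> L" by (rule bi_lipschitz_halfD(1)[OF emb])

lemma k_in: "x \<in> mspace (E i) \<Longrightarrow> k i x \<in> mspace (Rn m)" by (rule bi_lipschitz_halfD(2)[OF emb])

lemma conv_unique_dist:
  assumes "conv xs a" "conv ys b"
  shows "(\<lambda>i. mdist (Rn m) (k i (xs i)) (k i (ys i))) \<longlonglongrightarrow> mdist (Rn m) a b"
  by (rule tendsto_mdist_Rn[OF convD(3)[OF assms(1)] convD(3)[OF assms(2)]])

lemma conv_same_limit_iff:
  assumes "conv xs a" "conv ys b"
  shows "(\<lambda>i. mdist (E i) (xs i) (ys i)) \<longlonglongrightarrow> 0 \<longleftrightarrow> a = b"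
proof -
  have "(\<lambda>i. mdist (E i) (xs i) (ys i)) \<longlonglongrightarrow> 0 \<longleftrightarrow>
      (\<lambda>i. mdist (Rn m) (k i (xs i)) (k i (ys i))) \<longlonglongrightarrow> 0"
    by (rule tendsto_bi_lipschitz_half[of L E m k xs ys, OF emb convD(1)[OF assms(1)] convD(1)[OF assms(2)], symmetric])
  also have "\<dots> \<longleftrightarrow> mdist (Rn m) a b = 0"
    using conv_unique_dist[OF assms] LIMSEQ_unique by auto
  also have "\<dots> \<longleftrightarrow> a = b" by (rule mdist_zero) (use assms convD(2) in auto)
  finally show ?thesis .
qed

lemma conv_bounded:
  assumes "conv xs a"
  shows "\<exists>R. \<forall>i. mdist (E i) (p i) (xs i) \<le> R"
proof -
  have "(\<lambda>i. mdist (Rn m) (k i (p i)) (k i (xs i))) \<longlonglongrightarrow> mdist (Rn m) (\<lambda>_. 0) a"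
    using convD(3)[OF assms] by (intro tendsto_mdist_Rn) (auto simp: base mdist_Rn L2_set_def)
  then have "Bseq (\<lambda>i. mdist (Rn m) (k i (p i)) (k i (xs i)))"
    by (intro convergent_imp_Bseq) (auto simp: convergent_def)
  then obtain K where K: "\<And>i. mdist (Rn m) (k i (p i)) (k i (xs i)) \<le> K" by (auto simp: Bseq_def)
  have "mdist (E i) (p i) (xs i) \<le> (L * K)\<^sup>2" for i
  proof -
    have "mdist (E i) (p i) (xs i) \<le> (L * mdist (Rn m) (k i (p i)) (k i (xs i)))\<^sup>2"
      by (rule bi_lipschitz_halfD(5)[OF emb base(1) convD(1)[OF assms]])
    also have "\<dots> \<le> (L * K)\<^sup>2" using K L1 by (intro power_mono mult_left_mono) auto
    finally show ?thesis .
  qed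
  then show ?thesis by blast
qed

lemma conv_unique: "conv xs a \<Longrightarrow> conv xs b \<Longrightarrow> a = b"
  using conv_same_limit_iff conv_same_limit_iff[of xs a xs a] by blast

lemma conv_coordinate:
  assumes "conv xs a" "c < m"
  shows "(\<lambda>i. k i (xs i) c) \<longlonglongrightarrow> a c"
proof (rule LIM_zero_cancel, rule Lim_null_comparison[OF _ convD(3)[OF assms(1)]])
  show "\<forall>\<^sub>F i in sequentially. norm (k i (xs i) c - a c) \<le> mdist (Rn m) (k i (xs i)) a"
    using abs_le_mdist_Rn[OF assms(2)] by simp
qed

definition net_lim :: "'k \<Rightarrow> nat \<Rightarrow> real" where
  "net_lim n = (SOME a. conv (\<lambda>i. N i n) a)"

lemma conv_net: "conv (\<lambda>i. N i n) (net_lim n)"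
proof -
  have "\<exists>a. conv (\<lambda>i. N i n) a" using net_limit[of n] net_in by (auto simp: conv_def)
  then show ?thesis unfolding net_lim_def by (rule someI_ex)
qed

text \<open>For large \<open>i\<close>, each \<open>xs i\<close> is close to some \<open>N i n\<close> with \<open>n\<close> in a fixed finite set. By the pigeonhole
  principle the same \<open>n\<close> occurs infinitely often, and then the limits are close to each other.\<close>

lemma near_net_lim_uniform:
  assumes "0 < \<epsilon>"
  shows "\<exists>J. finite J \<and> (\<forall>xs a. conv xs a \<and> mdist (Rn m) (\<lambda>_. 0) a \<le> R \<longrightarrow> (\<exists>n\<in>J. mdist (Rn m) a (net_lim n) \<le> \<epsilon>))"
proof -
  have "0 < (\<epsilon> / L)\<^sup>2" using assms L1 by simp
  from net[OF this, of "(L * (R + 1))\<^sup>2"] obtain J where J: "finite J"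
    "\<And>i x. x \<in> mspace (E i) \<Longrightarrow> mdist (E i) (p i) x \<le> (L * (R + 1))\<^sup>2 \<Longrightarrow>
      \<exists>n\<in>J. mdist (E i) x (N i n) \<le> (\<epsilon> / L)\<^sup>2" by metis
  have "\<exists>n\<in>J. mdist (Rn m) a (net_lim n) \<le> \<epsilon>" if xs: "conv xs a" and R: "mdist (Rn m) (\<lambda>_. 0) a \<le> R" for xs a
  proof -
    have "(\<lambda>i. mdist (Rn m) (k i (p i)) (k i (xs i))) \<longlonglongrightarrow> mdist (Rn m) (\<lambda>_. 0) a"
      using convD(3)[OF xs] by (intro tendsto_mdist_Rn) (auto simp: base mdist_Rn L2_set_def)
    then have "\<forall>\<^sub>F i in sequentially. mdist (Rn m) (k i (p i)) (k i (xs i)) < R + 1"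
      by (rule order_tendstoD) (use R in simp)
    then have "\<forall>\<^sub>F i in sequentially. \<exists>n\<in>J. mdist (Rn m) (k i (xs i)) (k i (N i n)) \<le> \<epsilon>"
    proof (rule eventually_mono)
      fix i assume i: "mdist (Rn m) (k i (p i)) (k i (xs i)) < R + 1"
      have "mdist (E i) (p i) (xs i) \<le> (L * mdist (Rn m) (k i (p i)) (k i (xs i)))\<^sup>2"
        by (rule bi_lipschitz_halfD(5)[OF emb base(1) convD(1)[OF xs]])
      also have "\<dots> \<le> (L * (R + 1))\<^sup>2" using i L1 by (intro power_mono mult_left_mono) auto
      finally obtain n where n: "n \<in> J" "mdist (E i) (xs i) (N i n) \<le> (\<epsilon> / L)\<^sup>2"
        using J(2)[OF convD(1)[OF xs]] by blast
      have "mdist (Rn m) (k i (xs i)) (k i (N i n)) \<le> L * sqrt (mdist (E i) (xs i) (N i n))"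
        by (rule bi_lipschitz_halfD(3)[OF emb convD(1)[OF xs] net_in])
      also have "sqrt (mdist (E i) (xs i) (N i n)) \<le> \<epsilon> / L"
        using n(2) assms L1 by (intro real_le_lsqrt) auto
      then have "L * sqrt (mdist (E i) (xs i) (N i n)) \<le> \<epsilon>" using L1 by (simp add: field_simps)
      finally show "\<exists>n\<in>J. mdist (Rn m) (k i (xs i)) (k i (N i n)) \<le> \<epsilon>" using n(1) by blast
    qed
    then have "\<exists>\<^sub>F i in sequentially. \<exists>n\<in>J. mdist (Rn m) (k i (xs i)) (k i (N i n)) \<le> \<epsilon>"
      by (intro eventually_frequently) simp_all
    from frequently_bex_finite[OF J(1) this]
    obtain n where n: "n \<in> J" "\<exists>\<^sub>F i in sequentially. mdist (Rn m) (k i (xs i)) (k i (N i n)) \<le> \<epsilon>"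
      by blast
    have "mdist (Rn m) a (net_lim n) \<le> \<epsilon>"
    proof (rule ccontr)
      assume "\<not> ?thesis"
      then have "\<forall>\<^sub>F i in sequentially. \<epsilon> < mdist (Rn m) (k i (xs i)) (k i (N i n))"
        by (intro order_tendstoD(1)[OF conv_unique_dist[OF xs conv_net]]) simp
      then show False using n(2) by (simp add: frequently_def not_le)
    qed
    then show ?thesis using n(1) by blast
  qed
  then show ?thesis using J(1) by blast
qed

text \<open>Here the net point approximates the whole tail of the sequence, with a single index \<open>n\<close>.\<close>

lemma near_net:
  assumes "conv xs a" "0 < \<delta>"
  shows "\<exists>n. \<forall>\<^sub>F i in sequentially. mdist (E i) (xs i) (N i n) \<le> \<delta>"
proof -
  define \<epsilon> where "\<epsilon> = sqrt \<delta> / (2 * L)"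
  have e: "0 < \<epsilon>" using assms(2) L1 by (simp add: \<epsilon>_def)
  from near_net_lim_uniform[OF e, of "mdist (Rn m) (\<lambda>_. 0) a"] assms(1)
  obtain n where n: "mdist (Rn m) a (net_lim n) \<le> \<epsilon>" by blast
  have "\<forall>\<^sub>F i in sequentially. mdist (Rn m) (k i (xs i)) (k i (N i n)) < 2 * \<epsilon>"
    by (rule order_tendstoD(2)[OF conv_unique_dist[OF assms(1) conv_net]]) (use n e in simp)
  then have "\<forall>\<^sub>F i in sequentially. mdist (E i) (xs i) (N i n) \<le> \<delta>"
  proof (rule eventually_mono)
    fix i assume i: "mdist (Rn m) (k i (xs i)) (k i (N i n)) < 2 * \<epsilon>"
    have "sqrt (mdist (E i) (xs i) (N i n)) \<le> L * mdist (Rn m) (k i (xs i)) (k i (N i n))"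
      by (rule bi_lipschitz_halfD(4)[OF emb convD(1)[OF assms(1)] net_in])
    also have "\<dots> \<le> L * (2 * \<epsilon>)" using i L1 by (intro mult_left_mono) auto
    also have "\<dots> = sqrt \<delta>" using L1 by (simp add: \<epsilon>_def)
    finally show "mdist (E i) (xs i) (N i n) \<le> \<delta>" by simp
  qed
  then show ?thesis by blast
qed

definition equicontinuous :: "(nat \<Rightarrow> 'a \<Rightarrow> real) \<Rightarrow> bool" where
  "equicontinuous \<phi> \<longleftrightarrow> (\<forall>R. \<forall>\<epsilon>>0. \<exists>\<delta>>0. \<forall>i. \<forall>x\<in>mspace (E i). \<forall>y\<in>mspace (E i).
     mdist (E i) (p i) x \<le> R \<and> mdist (E i) (p i) y \<le> R \<and> mdist (E i) x y \<le> \<delta> \<longrightarrow>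
     \<bar>\<phi> i x - \<phi> i y\<bar> \<le> \<epsilon>)"

lemma transfer_same_limit:
  assumes "equicontinuous \<phi>" "conv xs a" "conv ys a"
  shows "(\<lambda>i. \<phi> i (xs i) - \<phi> i (ys i)) \<longlonglongrightarrow> 0"
proof (rule LIMSEQ_I)
  fix r :: real assume r: "0 < r"
  obtain R1 where R1: "\<And>i. mdist (E i) (p i) (xs i) \<le> R1" using conv_bounded[OF assms(2)] by blast
  obtain R2 where R2: "\<And>i. mdist (E i) (p i) (ys i) \<le> R2" using conv_bounded[OF assms(3)] by blast
  obtain \<delta> where \<delta>: "0 < \<delta>" "\<And>i x y. x \<in> mspace (E i) \<Longrightarrow> y \<in> mspace (E i) \<Longrightarrow>
      mdist (E i) (p i) x \<le> max R1 R2 \<Longrightarrow> mdist (E i) (p i) y \<le> max R1 R2 \<Longrightarrow>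
      mdist (E i) x y \<le> \<delta> \<Longrightarrow> \<bar>\<phi> i x - \<phi> i y\<bar> \<le> r / 2"
    using assms(1)[unfolded equicontinuous_def, rule_format, of "r / 2" "max R1 R2"] r by auto
  have "(\<lambda>i. mdist (E i) (xs i) (ys i)) \<longlonglongrightarrow> 0"
    using conv_same_limit_iff[OF assms(2,3)] by simp
  then have "\<forall>\<^sub>F i in sequentially. mdist (E i) (xs i) (ys i) < \<delta>"
    by (rule order_tendstoD) (rule \<delta>(1))
  then obtain n0 where "\<And>i. n0 \<le> i \<Longrightarrow> mdist (E i) (xs i) (ys i) < \<delta>"
    by (auto simp: eventually_sequentially)
  then have "\<bar>\<phi> i (xs i) - \<phi> i (ys i)\<bar> \<le> r / 2" if "n0 \<le> i" for i
    using that R1[of i] R2[of i]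
    by (intro \<delta>(2) convD(1)[OF assms(2)] convD(1)[OF assms(3)]) (auto simp: less_imp_le le_max_iff_disj)
  then show "\<exists>no. \<forall>n\<ge>no. norm (\<phi> n (xs n) - \<phi> n (ys n) - 0) < r"
    using r by (intro exI[of _ n0]) fastforce
qed

text \<open>An equicontinuous family that converges along every net point converges along every convergent
  sequence, by the usual Cauchy argument. It is applied to distances to a moving point and, for
  mappings, to the coordinates of the images.\<close>

lemma transfer_convergent:
  assumes "equicontinuous \<phi>" "\<And>n. convergent (\<lambda>i. \<phi> i (N i n))" "conv xs a"
  shows "convergent (\<lambda>i. \<phi> i (xs i))"
proof -
  have "Cauchy (\<lambda>i. \<phi> i (xs i))"
    unfolding Cauchy_def
  proof (intro allI impI)
    fix e :: real assume e: "0 < e"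
    obtain R where R: "\<And>i. mdist (E i) (p i) (xs i) \<le> R" using conv_bounded[OF assms(3)] by blast
    obtain \<delta> where \<delta>: "0 < \<delta>" "\<And>i x y. x \<in> mspace (E i) \<Longrightarrow> y \<in> mspace (E i) \<Longrightarrow>
        mdist (E i) (p i) x \<le> R + 1 \<Longrightarrow> mdist (E i) (p i) y \<le> R + 1 \<Longrightarrow>
        mdist (E i) x y \<le> \<delta> \<Longrightarrow> \<bar>\<phi> i x - \<phi> i y\<bar> \<le> e / 4"
      using assms(1)[unfolded equicontinuous_def, rule_format, of "e / 4" "R + 1"] e by auto
    obtain n where "\<forall>\<^sub>F i in sequentially. mdist (E i) (xs i) (N i n) \<le> min \<delta> 1"
      using near_net[OF assms(3), of "min \<delta> 1"] \<delta>(1) by auto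
    then obtain n1 where n1: "\<And>i. n1 \<le> i \<Longrightarrow> mdist (E i) (xs i) (N i n) \<le> min \<delta> 1"
      by (auto simp: eventually_sequentially)
    have near: "\<bar>\<phi> i (xs i) - \<phi> i (N i n)\<bar> \<le> e / 4" if "n1 \<le> i" for i
    proof (rule \<delta>(2)[OF convD(1)[OF assms(3)] net_in])
      show "mdist (E i) (p i) (xs i) \<le> R + 1" using R[of i] by simp
      have "mdist (E i) (p i) (N i n) \<le> mdist (E i) (p i) (xs i) + mdist (E i) (xs i) (N i n)"
        by (rule mdist_triangle[OF base(1) convD(1)[OF assms(3)] net_in])
      then show "mdist (E i) (p i) (N i n) \<le> R + 1" using R[of i] n1[OF that] by linarith
      show "mdist (E i) (xs i) (N i n) \<le> \<delta>" using n1[OF that] by simp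
    qed
    have "Cauchy (\<lambda>i. \<phi> i (N i n))" using assms(2) by (rule convergent_Cauchy)
    then obtain n2 where n2: "\<And>i j. n2 \<le> i \<Longrightarrow> n2 \<le> j \<Longrightarrow> dist (\<phi> i (N i n)) (\<phi> j (N j n)) < e / 4"
      unfolding Cauchy_def using e by (metis zero_less_divide_iff zero_less_numeral)
    have "dist (\<phi> i (xs i)) (\<phi> j (xs j)) < e" if "max n1 n2 \<le> i" "max n1 n2 \<le> j" for i j
    proof -
      have "n1 \<le> i" "n2 \<le> i" "n1 \<le> j" "n2 \<le> j" using that by auto
      from near[OF this(1)] near[OF this(3)] n2[OF this(2,4)] show ?thesis
        using e unfolding dist_real_def by linarith
    qed
    then show "\<exists>M. \<forall>i\<ge>M. \<forall>j\<ge>M. dist (\<phi> i (xs i)) (\<phi> j (xs j)) < e" by blast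
  qed
  then show ?thesis by (rule Cauchy_convergent)
qed

lemma equicontinuous_dist:
  assumes "\<And>i. ys i \<in> mspace (E i)"
  shows "equicontinuous (\<lambda>i x. mdist (E i) x (ys i))"
  unfolding equicontinuous_def
proof (intro allI impI)
  fix R \<epsilon> :: real assume e: "0 < \<epsilon>"
  have "\<bar>mdist (E i) x (ys i) - mdist (E i) y (ys i)\<bar> \<le> mdist (E i) x y"
    if "x \<in> mspace (E i)" "y \<in> mspace (E i)" for i x y
    using mdist_triangle[OF that(1,2) assms] mdist_triangle[OF that(2,1) assms] mdist_commute[of "E i" x y]
    by linarith
  then show "\<exists>\<delta>>0. \<forall>i. \<forall>x\<in>mspace (E i). \<forall>y\<in>mspace (E i).
       mdist (E i) (p i) x \<le> R \<and> mdist (E i) (p i) y \<le> R \<and> mdist (E i) x y \<le> \<delta> \<longrightarrow>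
       \<bar>mdist (E i) x (ys i) - mdist (E i) y (ys i)\<bar> \<le> \<epsilon>"
    using e by (intro exI[of _ \<epsilon>]) force
qed

text \<open>The transfer principle is applied to one variable at a time: first with a net point in the other
  variable, then with an arbitrary convergent sequence.\<close>

lemma convergent_dist:
  assumes "conv xs a" "conv ys b"
  shows "convergent (\<lambda>i. mdist (E i) (xs i) (ys i))"
proof -
  have "convergent (\<lambda>i. mdist (E i) (xs i) (N i n))" for n
    by (rule transfer_convergent[OF equicontinuous_dist net_dist assms(1)]) (rule net_in)
  then have "convergent (\<lambda>i. mdist (E i) (ys i) (xs i))"
    by (intro transfer_convergent[OF equicontinuous_dist _ assms(2)])
       (auto simp: convD(1)[OF assms(1)] mdist_commute[of _ "N _ _"])
  then show ?thesis by (simp add: mdist_commute)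
qed

text \<open>The lower Kuratowski limit of the images; since these converge, it is the Hausdorff limit on bounded
  sets.\<close>

definition limit_set :: "(nat \<Rightarrow> real) set" where
  "limit_set = {a \<in> mspace (Rn m). \<forall>\<epsilon>>0. \<forall>\<^sub>F i in sequentially. \<exists>x\<in>mspace (E i). mdist (Rn m) (k i x) a < \<epsilon>}"

lemma conv_limit_set: "conv xs a \<Longrightarrow> a \<in> limit_set"
proof -
  assume c: "conv xs a"
  have "\<forall>\<^sub>F i in sequentially. \<exists>x\<in>mspace (E i). mdist (Rn m) (k i x) a < \<epsilon>" if "0 < \<epsilon>" for \<epsilon>
  proof -
    have "\<forall>\<^sub>F i in sequentially. mdist (Rn m) (k i (xs i)) a < \<epsilon>"
      by (rule order_tendstoD(2)[OF convD(3)[OF c] that])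
    then show ?thesis by (rule eventually_mono) (use convD(1)[OF c] in blast)
  qed
  then show ?thesis using convD(2)[OF c] by (simp add: limit_set_def)
qed

text \<open>Choose \<open>xs i\<close> so that the image is nearly as close to \<open>a\<close> as possible; this avoids any diagonal
  argument over \<open>\<epsilon>\<close>.\<close>

lemma limit_set_conv:
  assumes "a \<in> limit_set"
  shows "\<exists>xs. conv xs a"
proof -
  \<comment> \<open>Infima need not be attained, hence the additional summand \<open>1 / (i + 1)\<close>.\<close>
  define I where "I i = (INF x\<in>mspace (E i). mdist (Rn m) (k i x) a)" for i
  have bdd: "bdd_below ((\<lambda>x. mdist (Rn m) (k i x) a) ` mspace (E i))" for i
    by (rule bdd_belowI[of _ 0]) auto
  have "\<exists>x. x \<in> mspace (E i) \<and> mdist (Rn m) (k i x) a < I i + 1 / (real i + 1)" for i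
  proof -
    have "I i < I i + 1 / (real i + 1)" by simp
    then have "\<exists>x\<in>mspace (E i). mdist (Rn m) (k i x) a < I i + 1 / (real i + 1)"
      unfolding I_def[of i] using base(1)[of i] by (subst (asm) cINF_less_iff[OF _ bdd]) auto
    then show ?thesis by blast
  qed
  then obtain xs where xs: "\<And>i. xs i \<in> mspace (E i)"
    "\<And>i. mdist (Rn m) (k i (xs i)) a < I i + 1 / (real i + 1)" by metis
  have I0: "0 \<le> I i" for i
  proof -
    have "mspace (E i) \<noteq> {}" using base(1)[of i] by blast
    then show ?thesis unfolding I_def by (rule cINF_greatest) simp
  qed
  have "I \<longlonglongrightarrow> 0"
  proof (rule order_tendstoI)
    fix e :: real assume "e < 0"
    then have "e < I i" for i using I0[of i] by linarith
    then show "\<forall>\<^sub>F i in sequentially. e < I i" by simp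
  next
    fix e :: real assume "0 < e"
    then have "\<forall>\<^sub>F i in sequentially. \<exists>x\<in>mspace (E i). mdist (Rn m) (k i x) a < e"
      using assms by (simp add: limit_set_def)
    then show "\<forall>\<^sub>F i in sequentially. I i < e"
    proof (rule eventually_mono)
      fix i assume "\<exists>x\<in>mspace (E i). mdist (Rn m) (k i x) a < e"
      then obtain x where x: "x \<in> mspace (E i)" "mdist (Rn m) (k i x) a < e" by blast
      have "I i \<le> mdist (Rn m) (k i x) a" unfolding I_def by (rule cINF_lower[OF bdd x(1)])
      then show "I i < e" using x(2) by linarith
    qed
  qed
  then have "(\<lambda>i. I i + 1 / (real i + 1)) \<longlonglongrightarrow> 0 + 0"
    using LIMSEQ_inverse_real_of_nat by (intro tendsto_add) (simp_all add: inverse_eq_divide add.commute)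
  then have lim: "(\<lambda>i. I i + 1 / (real i + 1)) \<longlonglongrightarrow> 0" by simp
  have "(\<lambda>i. mdist (Rn m) (k i (xs i)) a) \<longlonglongrightarrow> 0"
    by (rule Lim_null_comparison[OF _ lim]) (use less_imp_le[OF xs(2)] in simp)
  then have "conv xs a" using xs(1) assms by (simp add: conv_def limit_set_def)
  then show ?thesis by blast
qed

lemma closed_limit_set: "closedin (mtopology_of (Rn m)) limit_set"
  unfolding closedin_mtopology_of_sequentially
proof (intro conjI allI impI)
  show "limit_set \<subseteq> mspace (Rn m)" by (auto simp: limit_set_def)
  fix as a assume "(\<forall>i. as i \<in> limit_set) \<and> a \<in> mspace (Rn m) \<and> (\<lambda>i. mdist (Rn m) (as i) a) \<longlonglongrightarrow> 0"
  then have as: "\<And>i. as i \<in> limit_set" and a: "a \<in> mspace (Rn m)"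
    and lim: "(\<lambda>i. mdist (Rn m) (as i) a) \<longlonglongrightarrow> 0" by auto
  have "\<forall>\<^sub>F i in sequentially. \<exists>x\<in>mspace (E i). mdist (Rn m) (k i x) a < \<epsilon>" if e: "0 < \<epsilon>" for \<epsilon>
  proof -
    have "\<forall>\<^sub>F j in sequentially. mdist (Rn m) (as j) a < \<epsilon> / 2"
      by (rule order_tendstoD(2)[OF lim]) (use e in simp)
    then obtain j where j: "mdist (Rn m) (as j) a < \<epsilon> / 2" by (auto simp: eventually_sequentially)
    have "\<forall>\<^sub>F i in sequentially. \<exists>x\<in>mspace (E i). mdist (Rn m) (k i x) (as j) < \<epsilon> / 2"
      using as[of j] half_gt_zero[OF e] unfolding limit_set_def by blast
    then show ?thesis
    proof (rule eventually_mono)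
      fix i assume "\<exists>x\<in>mspace (E i). mdist (Rn m) (k i x) (as j) < \<epsilon> / 2"
      then obtain x where x: "x \<in> mspace (E i)" "mdist (Rn m) (k i x) (as j) < \<epsilon> / 2" by blast
      have "mdist (Rn m) (k i x) a < \<epsilon>" using mdist_Rn_triangle[of m "k i x" a "as j"] x(2) j by linarith
      then show "\<exists>x\<in>mspace (E i). mdist (Rn m) (k i x) a < \<epsilon>" using x(1) by blast
    qed
  qed
  then show "a \<in> limit_set" using a by (simp add: limit_set_def)
qed

definition rep :: "(nat \<Rightarrow> real) \<Rightarrow> nat \<Rightarrow> 'a" where "rep a = (SOME xs. conv xs a)"

lemma conv_rep: "a \<in> limit_set \<Longrightarrow> conv (rep a) a"
  unfolding rep_def by (rule someI_ex[OF limit_set_conv])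

text \<open>The default value \<open>0\<close> outside the limit set makes the function symmetric and nonnegative everywhere,
  as the notion of a metric space demands.\<close>

definition limit_dist :: "(nat \<Rightarrow> real) \<Rightarrow> (nat \<Rightarrow> real) \<Rightarrow> real" where
  "limit_dist a b = (if a \<in> limit_set \<and> b \<in> limit_set then lim (\<lambda>i. mdist (E i) (rep a i) (rep b i)) else 0)"

lemma tendsto_limit_dist:
  assumes "conv xs a" "conv ys b"
  shows "(\<lambda>i. mdist (E i) (xs i) (ys i)) \<longlonglongrightarrow> limit_dist a b"
proof -
  note ra = conv_rep[OF conv_limit_set[OF assms(1)]] and rb = conv_rep[OF conv_limit_set[OF assms(2)]]
  have 1: "(\<lambda>i. mdist (E i) (rep a i) (rep b i)) \<longlonglongrightarrow> limit_dist a b"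
    using convergent_dist[OF ra rb] conv_limit_set[OF assms(1)] conv_limit_set[OF assms(2)]
    by (simp add: limit_dist_def convergent_LIMSEQ_iff)
  have 2: "(\<lambda>i. mdist (E i) (xs i) (rep b i) - mdist (E i) (rep a i) (rep b i)) \<longlonglongrightarrow> 0"
    by (rule transfer_same_limit[OF equicontinuous_dist assms(1) ra]) (rule convD(1)[OF rb])
  have "(\<lambda>i. mdist (E i) (ys i) (xs i) - mdist (E i) (rep b i) (xs i)) \<longlonglongrightarrow> 0"
    by (rule transfer_same_limit[OF equicontinuous_dist assms(2) rb]) (rule convD(1)[OF assms(1)])
  from tendsto_add[OF tendsto_add[OF this 2] 1] show ?thesis
    by (simp add: mdist_commute[of _ "xs _"])
qed

lemma limit_dist_embed:
  assumes "a \<in> limit_set" "b \<in> limit_set"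
  shows "sqrt (limit_dist a b) \<le> L * mdist (Rn m) a b" "mdist (Rn m) a b \<le> L * sqrt (limit_dist a b)"
proof -
  note ra = conv_rep[OF assms(1)] and rb = conv_rep[OF assms(2)]
  have d: "(\<lambda>i. sqrt (mdist (E i) (rep a i) (rep b i))) \<longlonglongrightarrow> sqrt (limit_dist a b)"
    by (intro tendsto_real_sqrt tendsto_limit_dist ra rb)
  note e = conv_unique_dist[OF ra rb]
  show "sqrt (limit_dist a b) \<le> L * mdist (Rn m) a b"
    by (rule LIMSEQ_le[OF d tendsto_mult_left[OF e]])
       (use bi_lipschitz_halfD(4)[OF emb convD(1)[OF ra] convD(1)[OF rb]] in blast)
  show "mdist (Rn m) a b \<le> L * sqrt (limit_dist a b)"
    by (rule LIMSEQ_le[OF e tendsto_mult_left[OF d]])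
       (use bi_lipschitz_halfD(3)[OF emb convD(1)[OF ra] convD(1)[OF rb]] in blast)
qed

lemma Metric_space_limit: "Metric_space limit_set limit_dist"
proof
  fix a b
  show "0 \<le> limit_dist a b"
  proof (cases "a \<in> limit_set \<and> b \<in> limit_set")
    case True
    then have "(\<lambda>i. mdist (E i) (rep a i) (rep b i)) \<longlonglongrightarrow> limit_dist a b"
      by (intro tendsto_limit_dist conv_rep) auto
    then show ?thesis by (rule LIMSEQ_le_const) simp
  qed (auto simp: limit_dist_def)
  show "limit_dist a b = limit_dist b a"
    by (simp add: limit_dist_def mdist_commute[of _ "rep a _"])
next
  fix a b assume ab: "a \<in> limit_set" "b \<in> limit_set"
  have "(\<lambda>i. mdist (E i) (rep a i) (rep b i)) \<longlonglongrightarrow> limit_dist a b"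
    using ab by (intro tendsto_limit_dist conv_rep)
  then have "limit_dist a b = 0 \<longleftrightarrow> (\<lambda>i. mdist (E i) (rep a i) (rep b i)) \<longlonglongrightarrow> 0"
    using LIMSEQ_unique by auto
  then show "limit_dist a b = 0 \<longleftrightarrow> a = b"
    using conv_same_limit_iff[OF conv_rep[OF ab(1)] conv_rep[OF ab(2)]] by simp
  fix c assume c: "c \<in> limit_set"
  note ra = conv_rep[OF ab(1)] and rb = conv_rep[OF ab(2)] and rc = conv_rep[OF c]
  show "limit_dist a c \<le> limit_dist a b + limit_dist b c"
    by (rule LIMSEQ_le[OF tendsto_limit_dist[OF ra rc]
          tendsto_add[OF tendsto_limit_dist[OF ra rb] tendsto_limit_dist[OF rb rc]]])
       (use mdist_triangle[OF convD(1)[OF ra] convD(1)[OF rb] convD(1)[OF rc]] in blast)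
qed

definition limit_metric :: "(nat \<Rightarrow> real) metric" where
  "limit_metric = metric (limit_set, limit_dist)"

lemma mspace_limit: "mspace limit_metric = limit_set"
  and mdist_limit: "mdist limit_metric = limit_dist"
  by (simp_all add: limit_metric_def Metric_space.mspace_metric[OF Metric_space_limit]
      Metric_space.mdist_metric[OF Metric_space_limit])

lemma limit_embed: "bi_lipschitz L (snowflake (1/2) limit_metric) (Rn m) (\<lambda>x. x)"
  unfolding bi_lipschitz_half_iff mspace_limit mdist_limit
proof (intro conjI ballI)
  show "1 \<le> L" by (rule L1)
  show "(\<lambda>x. x) ` limit_set \<subseteq> mspace (Rn m)" by (auto simp: limit_set_def)
  fix x y assume xy: "x \<in> limit_set" "y \<in> limit_set"
  show "sqrt (limit_dist x y) / L \<le> mdist (Rn m) x y"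
    using limit_dist_embed(1)[OF xy] L1 by (simp add: divide_le_eq mult.commute)
  show "mdist (Rn m) x y \<le> L * sqrt (limit_dist x y)" by (rule limit_dist_embed(2)[OF xy])
qed

lemma complete_limit: "mcomplete_of limit_metric"
  unfolding complete_iff_closed_image[OF limit_embed] using closed_limit_set by (simp add: mspace_limit)

lemma conv_base: "conv p (\<lambda>_. 0)"
  using base by (simp add: conv_def mspace_Rn mdist_Rn L2_set_def)

text \<open>Both halves reduce to finitely many net points: every point of the bounded part of an image or of the
  limit set is close to a net point (or the limit of one) with index in a finite set \<open>J\<close>, and the
  convergence of the net points is uniform over \<open>J\<close>.\<close>

lemma sets_converge_limit:
  assumes "\<And>i. mcomplete_of (E i)"
  shows "sets_converge m (\<lambda>i. k i ` mspace (E i)) limit_set"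
  unfolding sets_converge_def
proof (intro conjI allI impI)
  show "k i ` mspace (E i) \<noteq> {}" for i using base(1) by blast
  show "closedin (mtopology_of (Rn m)) (k i ` mspace (E i))" for i
    using complete_iff_closed_image[OF emb] assms by blast
  show "limit_set \<noteq> {}" using conv_limit_set[OF conv_base] by blast
  show "closedin (mtopology_of (Rn m)) limit_set" by (rule closed_limit_set)
  fix R :: real assume "0 < R"
  have net_close: "\<forall>\<^sub>F i in sequentially. \<forall>n\<in>J. mdist (Rn m) (k i (N i n)) (net_lim n) < \<epsilon> / 2"
    if "finite J" "0 < \<epsilon>" for J \<epsilon>
    using that by (intro eventually_ball_finite ballI order_tendstoD(2)[OF convD(3)[OF conv_net]]) auto
  show "(\<lambda>i. SUP x\<in>k i ` mspace (E i) \<inter> mcball_of (Rn m) (\<lambda>_. 0) R.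
      INF y\<in>limit_set. ennreal (mdist (Rn m) x y)) \<longlonglongrightarrow> 0"
  proof (rule excess_tendsto_0I)
    fix \<epsilon> :: real assume e: "0 < \<epsilon>"
    have "0 < (\<epsilon> / (2 * L))\<^sup>2" using e L1 by simp
    from net[OF this, of "(L * R)\<^sup>2"] obtain J where J: "finite J"
      "\<And>i x. x \<in> mspace (E i) \<Longrightarrow> mdist (E i) (p i) x \<le> (L * R)\<^sup>2 \<Longrightarrow>
        \<exists>n\<in>J. mdist (E i) x (N i n) \<le> (\<epsilon> / (2 * L))\<^sup>2" by metis
    show "\<forall>\<^sub>F i in sequentially. \<forall>z\<in>k i ` mspace (E i) \<inter> mcball_of (Rn m) (\<lambda>_. 0) R.
        \<exists>y\<in>limit_set. mdist (Rn m) z y \<le> \<epsilon>"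
      using net_close[OF J(1) e]
    proof (rule eventually_mono, intro ballI)
      fix i z assume i: "\<forall>n\<in>J. mdist (Rn m) (k i (N i n)) (net_lim n) < \<epsilon> / 2"
        and "z \<in> k i ` mspace (E i) \<inter> mcball_of (Rn m) (\<lambda>_. 0) R"
      then obtain x where x: "x \<in> mspace (E i)" "z = k i x" "mdist (Rn m) (\<lambda>_. 0) z \<le> R" by auto
      have "mdist (E i) (p i) x \<le> (L * mdist (Rn m) (k i (p i)) (k i x))\<^sup>2"
        by (rule bi_lipschitz_halfD(5)[OF emb base(1) x(1)])
      also have "\<dots> \<le> (L * R)\<^sup>2" using x L1 by (intro power_mono mult_left_mono) (auto simp: base)
      finally obtain n where n: "n \<in> J" "mdist (E i) x (N i n) \<le> (\<epsilon> / (2 * L))\<^sup>2"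
        using J(2)[OF x(1)] by blast
      have "mdist (Rn m) z (k i (N i n)) \<le> L * sqrt (mdist (E i) x (N i n))"
        unfolding x(2) by (rule bi_lipschitz_halfD(3)[OF emb x(1) net_in])
      also have "\<dots> \<le> L * (\<epsilon> / (2 * L))"
        using n(2) e L1 by (intro mult_left_mono real_le_lsqrt) auto
      also have "L * (\<epsilon> / (2 * L)) = \<epsilon> / 2" using L1 by simp
      finally have "mdist (Rn m) z (net_lim n) \<le> \<epsilon>"
        using mdist_Rn_triangle[of m z "net_lim n" "k i (N i n)"] bspec[OF i n(1)] by linarith
      then show "\<exists>y\<in>limit_set. mdist (Rn m) z y \<le> \<epsilon>"
        using conv_limit_set[OF conv_net[of n]] by blast
    qed
  qed
  show "(\<lambda>i. SUP y\<in>limit_set \<inter> mcball_of (Rn m) (\<lambda>_. 0) R.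
      INF x\<in>k i ` mspace (E i). ennreal (mdist (Rn m) y x)) \<longlonglongrightarrow> 0"
  proof (rule excess_tendsto_0I)
    fix \<epsilon> :: real assume e: "0 < \<epsilon>"
    from near_net_lim_uniform[OF half_gt_zero[OF e], of R] obtain J where J: "finite J"
      "\<And>xs a. conv xs a \<Longrightarrow> mdist (Rn m) (\<lambda>_. 0) a \<le> R \<Longrightarrow> \<exists>n\<in>J. mdist (Rn m) a (net_lim n) \<le> \<epsilon> / 2"
      by metis
    show "\<forall>\<^sub>F i in sequentially. \<forall>y\<in>limit_set \<inter> mcball_of (Rn m) (\<lambda>_. 0) R.
        \<exists>x\<in>k i ` mspace (E i). mdist (Rn m) y x \<le> \<epsilon>"
      using net_close[OF J(1) e]
    proof (rule eventually_mono, intro ballI)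
      fix i y assume i: "\<forall>n\<in>J. mdist (Rn m) (k i (N i n)) (net_lim n) < \<epsilon> / 2"
        and "y \<in> limit_set \<inter> mcball_of (Rn m) (\<lambda>_. 0) R"
      then have y: "y \<in> limit_set" "mdist (Rn m) (\<lambda>_. 0) y \<le> R" by auto
      obtain n where n: "n \<in> J" "mdist (Rn m) y (net_lim n) \<le> \<epsilon> / 2"
        using J(2)[OF conv_rep[OF y(1)] y(2)] by blast
      have "mdist (Rn m) y (k i (N i n)) \<le> \<epsilon>"
        using mdist_Rn_triangle[of m y "k i (N i n)" "net_lim n"] bspec[OF i n(1)] n(2)
          mdist_commute[of "Rn m" "k i (N i n)" "net_lim n"] by linarith
      then show "\<exists>x\<in>k i ` mspace (E i). mdist (Rn m) y x \<le> \<epsilon>" using net_in by blast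
    qed
  qed
qed

lemma conv_of_image_sequence:
  assumes "\<And>i. ys i \<in> k i ` mspace (E i)" "a \<in> limit_set" "(\<lambda>i. mdist (Rn m) (ys i) a) \<longlonglongrightarrow> 0"
  shows "conv (\<lambda>i. inv_into (mspace (E i)) (k i) (ys i)) a"
proof -
  have "inv_into (mspace (E i)) (k i) (ys i) \<in> mspace (E i)" for i by (rule inv_into_into[OF assms(1)])
  moreover have "k i (inv_into (mspace (E i)) (k i) (ys i)) = ys i" for i by (rule f_inv_into_f[OF assms(1)])
  ultimately show ?thesis using assms(2,3) by (simp add: conv_def limit_set_def)
qed

lemma distances_converge:
  "maps_converge (prod_metric (Rn m) (Rn m)) euclidean_metric
     (\<lambda>i. k i ` mspace (E i) \<times> k i ` mspace (E i)) (\<lambda>i. pulled_dist (E i) (k i))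
     (limit_set \<times> limit_set) (pulled_dist limit_metric (\<lambda>x. x))"
  unfolding maps_converge_def
proof (intro allI impI)
  fix zs z
  assume H: "(\<forall>i. zs i \<in> k i ` mspace (E i) \<times> k i ` mspace (E i)) \<and> z \<in> limit_set \<times> limit_set \<and>
     limitin (mtopology_of (prod_metric (Rn m) (Rn m))) zs z sequentially"
  then have zs: "\<And>i. fst (zs i) \<in> k i ` mspace (E i)" "\<And>i. snd (zs i) \<in> k i ` mspace (E i)"
    and z: "fst z \<in> limit_set" "snd z \<in> limit_set" by (auto simp: mem_Times_iff)
  have lim: "(\<lambda>i. mdist (prod_metric (Rn m) (Rn m)) (zs i) z) \<longlonglongrightarrow> 0"
    using H unfolding limitin_mtopology_of_iff by blast
  have "mdist (Rn m) (fst (zs i)) (fst z) \<le> mdist (prod_metric (Rn m) (Rn m)) (zs i) z"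
    "mdist (Rn m) (snd (zs i)) (snd z) \<le> mdist (prod_metric (Rn m) (Rn m)) (zs i) z" for i
    by (simp_all add: prod_dist_def case_prod_unfold)
  then have "(\<lambda>i. mdist (Rn m) (fst (zs i)) (fst z)) \<longlonglongrightarrow> 0" "(\<lambda>i. mdist (Rn m) (snd (zs i)) (snd z)) \<longlonglongrightarrow> 0"
    by (auto intro!: Lim_null_comparison[OF _ lim] always_eventually)
  from conv_of_image_sequence[OF zs(1) z(1) this(1)] conv_of_image_sequence[OF zs(2) z(2) this(2)]
  have "(\<lambda>i. pulled_dist (E i) (k i) (zs i)) \<longlonglongrightarrow> limit_dist (fst z) (snd z)"
    unfolding pulled_dist_def case_prod_unfold by (rule tendsto_limit_dist)
  moreover have "pulled_dist limit_metric (\<lambda>x. x) z = limit_dist (fst z) (snd z)"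
    unfolding pulled_dist_def case_prod_unfold mspace_limit mdist_limit
    using inv_into_f_f[of "\<lambda>x. x" limit_set "fst z"] inv_into_f_f[of "\<lambda>x. x" limit_set "snd z"] z by simp
  ultimately show "limitin (mtopology_of euclidean_metric) (\<lambda>i. pulled_dist (E i) (k i) (zs i))
      (pulled_dist limit_metric (\<lambda>x. x) z) sequentially"
    by simp
qed

text \<open>The identity embeds the snowflake of the limit metric with the same constant \<open>L\<close>. That gives both
  completeness, because the limit set is closed, and a doubling constant.\<close>

theorem pointed_converge_limit:
  assumes "\<And>i. mcomplete_of (E i)" "\<And>i. doubling_with M (E i)"
  shows "pointed_converge_via (1/2) m k (\<lambda>x. x) (\<lambda>i. (E i, p i)) (limit_metric, \<lambda>_. 0)"
proof -
  obtain M' where M': "doubling_with M' limit_metric"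
    using doubling_of_embedding[OF limit_embed] by (auto simp: doubling_def)
  have "doubling_with (max M M') limit_metric" "doubling_with (max M M') (E i)" for i
    by (rule doubling_with_mono[OF M'], simp) (rule doubling_with_mono[OF assms(2)], simp)
  then have dbl: "\<exists>M. (\<forall>i. doubling_with M (fst (E i, p i))) \<and> doubling_with M (fst (limit_metric, (\<lambda>_. 0) :: nat \<Rightarrow> real))"
    by auto
  have emb': "\<exists>L. (\<forall>i. bi_lipschitz L (snowflake (1/2) (E i)) (Rn m) (k i)) \<and>
      bi_lipschitz L (snowflake (1/2) limit_metric) (Rn m) (\<lambda>x. x)"
    using emb limit_embed by blast
  have doubling: "doubling (E i)" "doubling limit_metric" for i
    using assms(2) M' by (auto simp: doubling_def)
  show ?thesis
    unfolding pointed_converge_via_def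
    using dbl emb' doubling sets_converge_limit[OF assms(1)] distances_converge conv_limit_set[OF conv_base] base
    by (simp add: pointed_metric_space_def assms(1) complete_limit mspace_limit)
qed

end

section \<open>Distortion by quasisymmetric maps\<close>

lemma far_point:
  assumes "a \<in> mspace X" "b \<in> mspace X" "p \<in> mspace X"
  shows "\<exists>z\<in>{a, b}. mdist X a b / 2 \<le> mdist X p z"
proof -
  have "mdist X a b \<le> mdist X p a + mdist X p b"
    using mdist_triangle[OF assms(1,3,2)] by (simp add: mdist_commute)
  then show ?thesis by (rule_tac ccontr) (simp add: not_le)
qed

text \<open>A homeomorphism of the half-line is strictly monotone. If it took the value \<open>0\<close> at some \<open>a > 0\<close>, the
  value on one side of \<open>a\<close> would be negative.\<close>

lemma half_line_homeomorphism:
  assumes "homeomorphic_map (top_of_set {0..}) (top_of_set {0..}) (\<eta> :: real \<Rightarrow> real)"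
  shows "continuous_on {0..} \<eta>" "\<And>u. 0 \<le> u \<Longrightarrow> 0 \<le> \<eta> u" "\<eta> 0 = 0"
proof -
  have c: "continuous_map (top_of_set {0..}) (top_of_set {0..}) \<eta>"
    and im: "\<eta> ` {0..} = {0..}" and inj: "inj_on \<eta> {0..}"
    using assms unfolding homeomorphic_eq_everything_map by auto
  show cont: "continuous_on {0..} \<eta>"
    using c by (simp add: continuous_map_in_subtopology continuous_map_iff_continuous)
  show nonneg: "0 \<le> \<eta> u" if "0 \<le> u" for u using im that by force
  have "0 \<in> \<eta> ` {0..}" using im by simp
  then obtain a where a: "0 \<le> a" "\<eta> a = 0" by force
  have "a = 0"
  proof (rule ccontr)
    assume "a \<noteq> 0"
    then have a0: "0 < a" using a by simp
    have "\<eta> 0 < \<eta> a \<and> \<eta> a < \<eta> (a + 1) \<or> \<eta> (a + 1) < \<eta> a \<and> \<eta> a < \<eta> 0"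
    proof (rule continuous_inj_imp_mono[of 0 a "a + 1" \<eta>])
      show "continuous_on {0..a + 1} \<eta>" by (rule continuous_on_subset[OF cont]) auto
      show "inj_on \<eta> {0..a + 1}" by (rule inj_on_subset[OF inj]) auto
    qed (use a0 in auto)
    then show False using nonneg[of 0] nonneg[of "a + 1"] a by auto
  qed
  then show "\<eta> 0 = 0" using a by simp
qed

text \<open>The properties of a control function from which the distortion estimates are derived.\<close>

locale gauge =
  fixes \<eta> :: "real \<Rightarrow> real"
  assumes gauge_cont: "continuous_on {0..} \<eta>" and gauge_nonneg: "\<And>u. 0 \<le> u \<Longrightarrow> 0 \<le> \<eta> u"
    and gauge_0: "\<eta> 0 = 0"
begin

lemma gauge_bounded: "\<exists>S>0. \<forall>u\<in>{0..R}. \<eta> u \<le> S"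
proof -
  have "compact (\<eta> ` {0..R})"
    by (intro compact_continuous_image continuous_on_subset[OF gauge_cont]) auto
  then obtain S where "\<forall>y\<in>\<eta> ` {0..R}. norm y \<le> S"
    using compact_imp_bounded bounded_iff by metis
  then have "\<forall>u\<in>{0..R}. \<eta> u \<le> max S 1" by force
  then show ?thesis by (intro exI[of _ "max S 1"]) simp
qed

lemma gauge_small:
  assumes "0 < \<epsilon>"
  shows "\<exists>\<delta>>0. \<forall>u\<in>{0..\<delta>}. \<eta> u \<le> \<epsilon>"
proof -
  have "\<exists>d>0. \<forall>x'\<in>{0..}. dist x' 0 < d \<longrightarrow> dist (\<eta> x') (\<eta> 0) < \<epsilon>"
    using gauge_cont assms unfolding continuous_on_iff by force
  then obtain d where d: "0 < d" "\<forall>x'\<in>{0..}. dist x' 0 < d \<longrightarrow> dist (\<eta> x') (\<eta> 0) < \<epsilon>" by blast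
  have "\<eta> u \<le> \<epsilon>" if "u \<in> {0..d / 2}" for u
  proof -
    have "dist (\<eta> u) (\<eta> 0) < \<epsilon>" using d that by (auto simp: dist_real_def)
    then show ?thesis by (simp add: gauge_0 dist_real_def)
  qed
  then show ?thesis using d(1) by (intro exI[of _ "d / 2"]) auto
qed

text \<open>The multiplicative form of the quasisymmetry condition. In contrast to the quotient form it is
  preserved under limits without any knowledge about injectivity of the limit.\<close>

definition distorts :: "'a metric \<Rightarrow> 'b metric \<Rightarrow> ('a \<Rightarrow> 'b) \<Rightarrow> bool" where
  "distorts X Y f \<longleftrightarrow> f ` mspace X \<subseteq> mspace Y \<and>
     (\<forall>x\<in>mspace X. \<forall>y\<in>mspace X. \<forall>z\<in>mspace X. x \<noteq> z \<longrightarrow>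
        mdist Y (f x) (f y) \<le> \<eta> (mdist X x y / mdist X x z) * mdist Y (f x) (f z))"

lemma distortsD:
  assumes "distorts X Y f" "x \<in> mspace X" "y \<in> mspace X" "z \<in> mspace X" "0 < mdist X x z"
    and "\<eta> (mdist X x y / mdist X x z) \<le> S" "mdist Y (f x) (f z) \<le> T"
  shows "mdist Y (f x) (f y) \<le> S * T"
proof -
  have "x \<noteq> z" using assms(2,5) by auto
  then have "mdist Y (f x) (f y) \<le> \<eta> (mdist X x y / mdist X x z) * mdist Y (f x) (f z)"
    using assms unfolding distorts_def by blast
  also have "\<dots> \<le> S * T"
    using assms(6,7) gauge_nonneg[of "mdist X x y / mdist X x z"] by (intro mult_mono) auto
  finally show ?thesis .
qed

lemma distorts_of_quasisymmetric:
  assumes "quasisymmetric \<eta> X Y f"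
  shows "distorts X Y f" "f ` mspace X = mspace Y" "inj_on f (mspace X)"
proof -
  have h: "homeomorphic_map (mtopology_of X) (mtopology_of Y) f"
    and q: "\<forall>x\<in>mspace X. \<forall>y\<in>mspace X. \<forall>z\<in>mspace X. x \<noteq> z \<longrightarrow>
        mdist Y (f x) (f y) / mdist Y (f x) (f z) \<le> \<eta> (mdist X x y / mdist X x z)"
    using assms unfolding quasisymmetric_def by blast+
  show im: "f ` mspace X = mspace Y" using homeomorphic_imp_surjective_map[OF h] by simp
  show inj: "inj_on f (mspace X)" using homeomorphic_imp_injective_map[OF h] by simp
  have "mdist Y (f x) (f y) \<le> \<eta> (mdist X x y / mdist X x z) * mdist Y (f x) (f z)"
    if "x \<in> mspace X" "y \<in> mspace X" "z \<in> mspace X" "x \<noteq> z" for x y z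
  proof -
    have "f x \<in> mspace Y" "f z \<in> mspace Y" "f x \<noteq> f z"
      using that im inj by (auto dest: inj_onD)
    then have "0 < mdist Y (f x) (f z)" by (simp add: order_less_le)
    moreover have "mdist Y (f x) (f y) / mdist Y (f x) (f z) \<le> \<eta> (mdist X x y / mdist X x z)"
      using q that by blast
    ultimately show ?thesis by (simp add: pos_divide_le_eq)
  qed
  then show "distorts X Y f" using im unfolding distorts_def by blast
qed

text \<open>As soon as two points have different images the multiplicative condition implies that \<open>f\<close> is a
  homeomorphism. If \<open>f x = f z\<close> with \<open>x \<noteq> z\<close>, the condition with \<open>z\<close> in the denominator makes \<open>f\<close>
  constant. Continuity of \<open>f\<close> at \<open>x\<close> follows from a fixed comparison point \<open>z\<close> in the denominator and
  the behaviour of \<open>\<eta>\<close> at \<open>0\<close>, continuity of the inverse from \<open>z\<close> in the numerator and the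
  boundedness of \<open>\<eta>\<close> on compact intervals.\<close>

lemma quasisymmetric_of_distorts:
  assumes eta: "homeomorphic_map (top_of_set {0..}) (top_of_set {0..}) \<eta>"
    and d: "distorts X Y f" and im: "f ` mspace X = mspace Y"
    and pw: "p \<in> mspace X" "w \<in> mspace X" "f p \<noteq> f w"
  shows "quasisymmetric \<eta> X Y f"
proof -
  have pos: "0 < mdist X x z" if "x \<in> mspace X" "z \<in> mspace X" "x \<noteq> z" for x z
    using that by (simp add: order_less_le)
  have fin: "f x \<in> mspace Y" if "x \<in> mspace X" for x using that im by blast
  have inj: "x = z" if xz: "x \<in> mspace X" "z \<in> mspace X" "f x = f z" for x z
  proof (rule ccontr)
    assume "x \<noteq> z"
    have "f x = f y" if "y \<in> mspace X" for y
    proof -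
      have "mdist Y (f x) (f y) \<le> \<eta> (mdist X x y / mdist X x z) * 0"
        by (rule distortsD[OF d xz(1) that xz(2) pos[OF xz(1,2) \<open>x \<noteq> z\<close>]]) (use xz fin in auto)
      then have "mdist Y (f x) (f y) = 0" using mdist_nonneg[of Y "f x" "f y"] by simp
      then show ?thesis using fin xz(1) that by simp
    qed
    from this[OF pw(1)] this[OF pw(2)] show False using pw(3) by simp
  qed
  have other: "\<exists>z\<in>mspace X. z \<noteq> x" for x using pw by metis
  have c1: "\<exists>\<delta>>0. \<forall>y. y \<in> mspace X \<and> mdist X x y < \<delta> \<longrightarrow> mdist Y (f x) (f y) < \<epsilon>"
    if x: "x \<in> mspace X" and e: "0 < \<epsilon>" for x \<epsilon>
  proof -
    obtain z where z: "z \<in> mspace X" "z \<noteq> x" using other by blast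
    have D: "0 < mdist X x z" using pos x z by blast
    define T where "T = mdist Y (f x) (f z)"
    have T: "0 \<le> T" by (simp add: T_def)
    obtain \<delta> where \<delta>: "0 < \<delta>" "\<And>u. u \<in> {0..\<delta>} \<Longrightarrow> \<eta> u \<le> \<epsilon> / (2 * (T + 1))"
      using gauge_small[of "\<epsilon> / (2 * (T + 1))"] e T by auto
    have "mdist Y (f x) (f y) < \<epsilon>" if y: "y \<in> mspace X" "mdist X x y < \<delta> * mdist X x z" for y
    proof -
      have "mdist X x y / mdist X x z \<in> {0..\<delta>}" using y D by (simp add: pos_divide_le_eq)
      then have "mdist Y (f x) (f y) \<le> \<epsilon> / (2 * (T + 1)) * T"
        by (intro distortsD[OF d x y(1) z(1) D] \<delta>(2)) (simp_all add: T_def)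
      also have "\<dots> \<le> \<epsilon> / (2 * (T + 1)) * (T + 1)" using e T by (intro mult_left_mono) auto
      also have "\<dots> = \<epsilon> / 2"
      proof -
        have cancel: "\<epsilon> / (2 * t) * t = \<epsilon> / 2" if "0 < t" for t using that by simp
        show ?thesis by (rule cancel) (use T in simp)
      qed
      finally show ?thesis using e by simp
    qed
    then show ?thesis using \<delta>(1) D by (intro exI[of _ "\<delta> * mdist X x z"]) simp
  qed
  have c2: "\<exists>\<delta>>0. \<forall>y. y \<in> mspace X \<and> mdist Y (f x) (f y) < \<delta> \<longrightarrow> mdist X x y < \<epsilon>"
    if x: "x \<in> mspace X" and e: "0 < \<epsilon>" for x \<epsilon>
  proof -
    obtain z where z: "z \<in> mspace X" "z \<noteq> x" using other by blast
    have D: "0 < mdist X x z" using pos x z by blast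
    obtain S where S: "0 < S" "\<And>u. u \<in> {0..mdist X x z / \<epsilon>} \<Longrightarrow> \<eta> u \<le> S"
      using gauge_bounded by blast
    have "f x \<noteq> f z" using inj x z by blast
    then have T: "0 < mdist Y (f x) (f z)" using fin x z by (simp add: order_less_le)
    have "mdist X x y < \<epsilon>" if y: "y \<in> mspace X" "mdist Y (f x) (f y) < mdist Y (f x) (f z) / S" for y
    proof (rule ccontr)
      assume "\<not> mdist X x y < \<epsilon>"
      then have ge: "\<epsilon> \<le> mdist X x y" by simp
      then have "0 < mdist X x y" using e by linarith
      moreover have "mdist X x z / mdist X x y \<in> {0..mdist X x z / \<epsilon>}"
        using e ge D by (auto intro!: divide_left_mono mult_pos_pos)
      ultimately have "mdist Y (f x) (f z) \<le> S * mdist Y (f x) (f y)"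
        by (intro distortsD[OF d x z(1) y(1)] S(2)) auto
      then show False using y(2) S(1) by (simp add: pos_less_divide_eq mult.commute)
    qed
    then show ?thesis using T S(1) by (intro exI[of _ "mdist Y (f x) (f z) / S"]) simp
  qed
  define g where "g = inv_into (mspace X) f"
  have g: "g (f x) = x" if "x \<in> mspace X" for x
    unfolding g_def by (rule inv_into_f_f[OF _ that]) (use inj in \<open>auto intro: inj_onI\<close>)
  have gin: "g y \<in> mspace X \<and> f (g y) = y" if "y \<in> mspace Y" for y
    using that im g by force
  have "continuous_map (mtopology_of X) (mtopology_of Y) f"
    unfolding mtopology_of_def Metric_space.metric_continuous_map[OF Metric_space_mspace_mdist Metric_space_mspace_mdist]
    using c1 fin by blast
  moreover have "continuous_map (mtopology_of Y) (mtopology_of X) g"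
    unfolding mtopology_of_def Metric_space.metric_continuous_map[OF Metric_space_mspace_mdist Metric_space_mspace_mdist]
  proof (intro conjI ballI allI impI)
    show "g ` mspace Y \<subseteq> mspace X" using gin by blast
    fix b and \<epsilon> :: real assume b: "b \<in> mspace Y" "0 < \<epsilon>"
    obtain \<delta> where "0 < \<delta>" "\<forall>y. y \<in> mspace X \<and> mdist Y (f (g b)) (f y) < \<delta> \<longrightarrow> mdist X (g b) y < \<epsilon>"
      using c2[of "g b" \<epsilon>] gin[OF b(1)] b(2) by blast
    then show "\<exists>\<delta>>0. \<forall>x. x \<in> mspace Y \<and> mdist Y b x < \<delta> \<longrightarrow> mdist X (g b) (g x) < \<epsilon>"
      using gin b(1) by (intro exI[of _ \<delta>]) force
  qed
  ultimately have "homeomorphic_maps (mtopology_of X) (mtopology_of Y) f g"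
    unfolding homeomorphic_maps_def using g gin by simp
  then have h: "homeomorphic_map (mtopology_of X) (mtopology_of Y) f"
    by (auto simp: homeomorphic_map_maps)
  have "mdist Y (f x) (f y) / mdist Y (f x) (f z) \<le> \<eta> (mdist X x y / mdist X x z)"
    if "x \<in> mspace X" "y \<in> mspace X" "z \<in> mspace X" "x \<noteq> z" for x y z
  proof -
    have "f x \<noteq> f z" using inj that by blast
    then have "0 < mdist Y (f x) (f z)" using fin that by (simp add: order_less_le)
    then show ?thesis
      using distortsD[OF d that(1-3) pos[OF that(1,3,4)] order_refl order_refl] by (simp add: pos_divide_le_eq)
  qed
  then show ?thesis using eta h unfolding quasisymmetric_def by blast
qed

end

text \<open>A pair of points at distance \<open>1\<close> with images at distance \<open>1\<close> excludes that maps with the same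
  \<open>\<eta>\<close> degenerate: the bounds below are uniform in \<open>i\<close>.\<close>

locale normalised_family = gauge \<eta> for \<eta> +
  fixes E :: "nat \<Rightarrow> 'a metric" and G :: "nat \<Rightarrow> 'b metric" and f :: "'a \<Rightarrow> 'b" and p w :: "nat \<Rightarrow> 'a"
  assumes dis: "\<And>i. distorts (E i) (G i) f"
    and pw: "\<And>i. p i \<in> mspace (E i)" "\<And>i. w i \<in> mspace (E i)"
    and unit: "\<And>i. mdist (E i) (p i) (w i) = 1" "\<And>i. mdist (G i) (f (p i)) (f (w i)) = 1"
begin

lemma f_in: "x \<in> mspace (E i) \<Longrightarrow> f x \<in> mspace (G i)"
  using dis[of i] unfolding distorts_def by blast

lemma image_bounded:
  "\<exists>S\<ge>0. \<forall>i. \<forall>x\<in>mspace (E i). mdist (E i) (p i) x \<le> R \<longrightarrow> mdist (G i) (f (p i)) (f x) \<le> S"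
proof -
  obtain S where S: "0 < S" "\<And>u. u \<in> {0..R} \<Longrightarrow> \<eta> u \<le> S" using gauge_bounded by blast
  have "mdist (G i) (f (p i)) (f x) \<le> S" if x: "x \<in> mspace (E i)" "mdist (E i) (p i) x \<le> R" for i x
  proof -
    have "mdist (G i) (f (p i)) (f x) \<le> S * 1"
      by (rule distortsD[OF dis pw(1) x(1) pw(2)]) (use unit x S in auto)
    then show ?thesis by simp
  qed
  then show ?thesis using S(1) by (intro exI[of _ S]) auto
qed

text \<open>If \<open>x\<close> is far from \<open>p i\<close>, then \<open>w i\<close> is relatively close to \<open>p i\<close>, so the distance \<open>1\<close> of
  their images is a small multiple of the distance from \<open>f (p i)\<close> to \<open>f x\<close>.\<close>

lemma preimage_bounded:
  "\<exists>S. \<forall>i. \<forall>x\<in>mspace (E i). mdist (G i) (f (p i)) (f x) \<le> R \<longrightarrow> mdist (E i) (p i) x \<le> S"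
proof -
  define T where "T = max R 1"
  obtain \<delta> where \<delta>: "0 < \<delta>" "\<And>u. u \<in> {0..\<delta>} \<Longrightarrow> \<eta> u \<le> 1 / (2 * T)"
    using gauge_small[of "1 / (2 * T)"] by (auto simp: T_def)
  have "mdist (E i) (p i) x \<le> 1 / \<delta>"
    if x: "x \<in> mspace (E i)" "mdist (G i) (f (p i)) (f x) \<le> R" for i x
  proof (rule ccontr)
    assume "\<not> ?thesis"
    then have gt: "1 / \<delta> < mdist (E i) (p i) x" by simp
    moreover have "0 < 1 / \<delta>" using \<delta>(1) by simp
    ultimately have pos: "0 < mdist (E i) (p i) x" by linarith
    have small: "1 / mdist (E i) (p i) x \<in> {0..\<delta>}" using gt \<delta>(1) pos by (simp add: field_simps)
    have "mdist (G i) (f (p i)) (f (w i)) \<le> 1 / (2 * T) * T"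
      by (rule distortsD[OF dis pw x(1) pos]) (use unit x(2) \<delta>(2)[OF small] in \<open>auto simp: T_def\<close>)
    then show False using unit by (simp add: T_def)
  qed
  then show ?thesis by blast
qed

text \<open>One of \<open>p i\<close> and \<open>w i\<close> is at distance at least \<open>1 / 2\<close> from \<open>x\<close> and serves as comparison point.\<close>

lemma equicontinuity:
  assumes "0 < \<epsilon>"
  shows "\<exists>\<delta>>0. \<forall>i. \<forall>x\<in>mspace (E i). \<forall>y\<in>mspace (E i).
    mdist (E i) (p i) x \<le> R \<and> mdist (E i) x y \<le> \<delta> \<longrightarrow> mdist (G i) (f x) (f y) \<le> \<epsilon>"
proof -
  obtain S where S: "0 \<le> S" "\<And>i x. x \<in> mspace (E i) \<Longrightarrow> mdist (E i) (p i) x \<le> R \<Longrightarrow>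
    mdist (G i) (f (p i)) (f x) \<le> S" using image_bounded[of R] by blast
  have S1: "0 < S + 1" using S(1) by simp
  obtain \<delta> where \<delta>: "0 < \<delta>" "\<And>u. u \<in> {0..\<delta>} \<Longrightarrow> \<eta> u \<le> \<epsilon> / (S + 1)"
    using gauge_small[of "\<epsilon> / (S + 1)"] assms S1 by auto
  have "mdist (G i) (f x) (f y) \<le> \<epsilon>"
    if x: "x \<in> mspace (E i)" and y: "y \<in> mspace (E i)"
      and xy: "mdist (E i) (p i) x \<le> R \<and> mdist (E i) x y \<le> \<delta> / 2" for i x y
  proof -
    obtain z where z: "z \<in> {p i, w i}" "1 / 2 \<le> mdist (E i) x z"
      using far_point[OF pw x] unit(1)[of i] by auto
    have zE: "z \<in> mspace (E i)" using z(1) pw[of i] by auto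
    have "mdist (G i) (f (p i)) (f z) \<le> 1" using z(1) unit(2) f_in[OF pw(1)[of i]] by auto
    moreover have "mdist (G i) (f x) (f z) \<le> mdist (G i) (f (p i)) (f x) + mdist (G i) (f (p i)) (f z)"
      using mdist_triangle[OF f_in[OF x] f_in[OF pw(1)] f_in[OF zE]] by (simp add: mdist_commute)
    ultimately have fz: "mdist (G i) (f x) (f z) \<le> S + 1" using S(2)[OF x] xy by fastforce
    have zpos: "0 < mdist (E i) x z" using z(2) by linarith
    have "mdist (E i) x y / mdist (E i) x z \<le> (\<delta> / 2) / (1 / 2)"
      using xy z(2) \<delta>(1) by (intro frac_le) auto
    then have "mdist (E i) x y / mdist (E i) x z \<in> {0..\<delta>}" by simp
    then have "mdist (G i) (f x) (f y) \<le> \<epsilon> / (S + 1) * (S + 1)"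
      by (intro distortsD[OF dis x y zE zpos _ fz] \<delta>(2))
    then show ?thesis using S1 by simp
  qed
  then show ?thesis using \<delta>(1) by (intro exI[of _ "\<delta> / 2"]) simp
qed

text \<open>If \<open>f x\<close> and \<open>f y\<close> were very close while \<open>x\<close> and \<open>y\<close> are not, then \<open>f (p i)\<close> and \<open>f (w i)\<close> would
  both be close to \<open>f x\<close> and hence at a distance less than \<open>1\<close>.\<close>

lemma inverse_equicontinuity:
  assumes "0 < \<epsilon>"
  shows "\<exists>\<delta>>0. \<forall>i. \<forall>x\<in>mspace (E i). \<forall>y\<in>mspace (E i).
    mdist (E i) (p i) x \<le> R \<and> mdist (G i) (f x) (f y) \<le> \<delta> \<longrightarrow> mdist (E i) x y \<le> \<epsilon>"
proof -
  obtain S where S: "0 < S" "\<And>u. u \<in> {0..(R + 1) / \<epsilon>} \<Longrightarrow> \<eta> u \<le> S" using gauge_bounded by blast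
  have "mdist (E i) x y \<le> \<epsilon>"
    if x: "x \<in> mspace (E i)" and y: "y \<in> mspace (E i)"
      and xy: "mdist (E i) (p i) x \<le> R \<and> mdist (G i) (f x) (f y) \<le> 1 / (4 * S)" for i x y
  proof (rule ccontr)
    assume "\<not> ?thesis"
    then have gt: "\<epsilon> < mdist (E i) x y" by simp
    then have pos: "0 < mdist (E i) x y" using assms by linarith
    have quarter: "mdist (G i) (f x) (f z) \<le> 1 / 4" if z: "z \<in> mspace (E i)" "mdist (E i) x z \<le> R + 1" for z
    proof -
      have "mdist (E i) x z / mdist (E i) x y \<le> (R + 1) / \<epsilon>"
        using z(2) gt assms mdist_nonneg[of "E i" x z] by (intro frac_le) linarith+
      then have "mdist (G i) (f x) (f z) \<le> S * (1 / (4 * S))"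
        by (intro distortsD[OF dis x z(1) y pos _ conjunct2[OF xy]] S(2)) simp
      then show ?thesis using S(1) by simp
    qed
    have "mdist (E i) x (w i) \<le> mdist (E i) (p i) x + mdist (E i) (p i) (w i)"
      using mdist_triangle[OF x pw] by (simp add: mdist_commute)
    then have "mdist (G i) (f x) (f (w i)) \<le> 1 / 4" using xy unit(1)[of i] by (intro quarter pw(2)) simp
    moreover have "mdist (G i) (f x) (f (p i)) \<le> 1 / 4" using xy by (intro quarter pw(1)) (simp add: mdist_commute)
    moreover have "mdist (G i) (f (p i)) (f (w i)) \<le> mdist (G i) (f x) (f (p i)) + mdist (G i) (f x) (f (w i))"
      using mdist_triangle[OF f_in[OF pw(1)] f_in[OF x] f_in[OF pw(2)]] by (simp add: mdist_commute)
    ultimately show False using unit(2)[of i] by linarith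
  qed
  then show ?thesis using S(1) by (intro exI[of _ "1 / (4 * S)"]) simp
qed

end

section \<open>Limits of quasisymmetric maps\<close>

lemma coordinate_bound:
  assumes "c < m" "bi_lipschitz L (snowflake (1/2) X) (Rn m) h" "x \<in> mspace X" "y \<in> mspace X"
    and "mdist X x y \<le> (\<epsilon> / L)\<^sup>2" "0 \<le> \<epsilon>"
  shows "\<bar>h x c - h y c\<bar> \<le> \<epsilon>"
proof -
  note L = bi_lipschitz_halfD(1)[OF assms(2)]
  have "\<bar>h x c - h y c\<bar> \<le> mdist (Rn m) (h x) (h y)" by (rule abs_le_mdist_Rn[OF assms(1)])
  also have "\<dots> \<le> L * sqrt (mdist X x y)" by (rule bi_lipschitz_halfD(3)[OF assms(2-4)])
  also have "\<dots> \<le> L * (\<epsilon> / L)" using assms(5,6) L by (intro mult_left_mono real_le_lsqrt) auto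
  finally show ?thesis using L by simp
qed

text \<open>The net in the codomain is the image of the net in the domain, so that the net points can be
  followed under \<open>f\<close> and its inverse.\<close>

locale embedded_package =
  dom: embedded_sequence E p h m L N + cod: embedded_sequence G q g m' L' N' +
  normalised_family \<eta> E G f p w
  for E :: "nat \<Rightarrow> 'a metric" and p h m L and N :: "nat \<Rightarrow> 'k \<Rightarrow> 'a"
    and G :: "nat \<Rightarrow> 'b metric" and q g m' L' and N' :: "nat \<Rightarrow> 'k \<Rightarrow> 'b" and \<eta> f w +
  assumes f_onto: "\<And>i. f ` mspace (E i) = mspace (G i)"
    and q_def: "\<And>i. q i = f (p i)" and N'_def: "\<And>i n. N' i n = f (N i n)"
begin

lemma equicontinuous_map:
  assumes "c < m'"
  shows "dom.equicontinuous (\<lambda>i x. g i (f x) c)"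
  unfolding dom.equicontinuous_def
proof (intro allI impI)
  fix R \<epsilon> :: real assume e: "0 < \<epsilon>"
  then have "0 < (\<epsilon> / L')\<^sup>2" using cod.L1 by simp
  from equicontinuity[OF this, of R] obtain \<delta> where \<delta>: "0 < \<delta>"
    "\<And>i x y. x \<in> mspace (E i) \<Longrightarrow> y \<in> mspace (E i) \<Longrightarrow>
      mdist (E i) (p i) x \<le> R \<and> mdist (E i) x y \<le> \<delta> \<Longrightarrow> mdist (G i) (f x) (f y) \<le> (\<epsilon> / L')\<^sup>2"
    by blast
  show "\<exists>\<delta>>0. \<forall>i. \<forall>x\<in>mspace (E i). \<forall>y\<in>mspace (E i).
       mdist (E i) (p i) x \<le> R \<and> mdist (E i) (p i) y \<le> R \<and> mdist (E i) x y \<le> \<delta> \<longrightarrow>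
       \<bar>g i (f x) c - g i (f y) c\<bar> \<le> \<epsilon>"
  proof (intro exI[of _ \<delta>] conjI allI ballI impI \<delta>(1))
    fix i x y assume x: "x \<in> mspace (E i)" and y: "y \<in> mspace (E i)"
      and *: "mdist (E i) (p i) x \<le> R \<and> mdist (E i) (p i) y \<le> R \<and> mdist (E i) x y \<le> \<delta>"
    have "mdist (G i) (f x) (f y) \<le> (\<epsilon> / L')\<^sup>2"
      using * by (intro \<delta>(2)[OF x y]) simp
    then show "\<bar>g i (f x) c - g i (f y) c\<bar> \<le> \<epsilon>"
      using e by (intro coordinate_bound[OF assms cod.emb f_in[OF x] f_in[OF y]]) auto
  qed
qed

lemma conv_map_exists:
  assumes "dom.conv xs a"
  shows "\<exists>b. cod.conv (\<lambda>i. f (xs i)) b"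
proof -
  have "convergent (\<lambda>i. g i (f (xs i)) c)" if c: "c < m'" for c
  proof (rule dom.transfer_convergent[OF equicontinuous_map[OF c] _ assms])
    fix n
    show "convergent (\<lambda>i. g i (f (N i n)) c)"
      using cod.conv_coordinate[OF cod.conv_net[of n] c] unfolding N'_def convergent_def by blast
  qed
  then have "\<exists>b\<in>mspace (Rn m'). (\<lambda>i. mdist (Rn m') (g i (f (xs i))) b) \<longlonglongrightarrow> 0"
    by (rule convergent_Rn_coordinatewise)
  then show ?thesis
    using f_in[OF dom.convD(1)[OF assms]] unfolding cod.conv_def by blast
qed

lemma conv_map_unique:
  assumes "dom.conv xs a" "dom.conv ys a" "cod.conv (\<lambda>i. f (xs i)) b" "cod.conv (\<lambda>i. f (ys i)) b'"
  shows "b = b'"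
proof
  fix c
  show "b c = b' c"
  proof (cases "c < m'")
    case True
    have "(\<lambda>i. g i (f (xs i)) c - g i (f (ys i)) c) \<longlonglongrightarrow> b c - b' c"
      by (intro tendsto_diff cod.conv_coordinate[OF assms(3) True] cod.conv_coordinate[OF assms(4) True])
    moreover have "(\<lambda>i. g i (f (xs i)) c - g i (f (ys i)) c) \<longlonglongrightarrow> 0"
      by (rule dom.transfer_same_limit[OF equicontinuous_map[OF True] assms(1,2)])
    ultimately have "b c - b' c = 0" by (rule LIMSEQ_unique)
    then show ?thesis by simp
  next
    case False
    then show ?thesis using cod.convD(2)[OF assms(3)] cod.convD(2)[OF assms(4)] by (simp add: mspace_Rn)
  qed
qed

definition limit_map :: "(nat \<Rightarrow> real) \<Rightarrow> (nat \<Rightarrow> real)" where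
  "limit_map a = (SOME b. cod.conv (\<lambda>i. f (dom.rep a i)) b)"

lemma conv_map:
  assumes "dom.conv xs a"
  shows "cod.conv (\<lambda>i. f (xs i)) (limit_map a)"
proof -
  note r = dom.conv_rep[OF dom.conv_limit_set[OF assms]]
  have lm: "cod.conv (\<lambda>i. f (dom.rep a i)) (limit_map a)"
    unfolding limit_map_def by (rule someI_ex[OF conv_map_exists[OF r]])
  obtain b where b: "cod.conv (\<lambda>i. f (xs i)) b" using conv_map_exists[OF assms] by blast
  show ?thesis using b conv_map_unique[OF assms r b lm] by simp
qed

text \<open>The inverse maps are equicontinuous as well: bounded sets have bounded preimages, on which
  the inverse equicontinuity estimate applies.\<close>

lemma equicontinuous_inverse:
  assumes "c < m"
  shows "cod.equicontinuous (\<lambda>i y. h i (inv_into (mspace (E i)) f y) c)"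
  unfolding cod.equicontinuous_def
proof (intro allI impI)
  fix R \<epsilon> :: real assume e: "0 < \<epsilon>"
  obtain S where S: "\<And>i x. x \<in> mspace (E i) \<Longrightarrow> mdist (G i) (f (p i)) (f x) \<le> R \<Longrightarrow>
    mdist (E i) (p i) x \<le> S" using preimage_bounded[of R] by blast
  have "0 < (\<epsilon> / L)\<^sup>2" using e dom.L1 by simp
  from inverse_equicontinuity[OF this, of S] obtain \<delta> where \<delta>: "0 < \<delta>"
    "\<And>i x y. x \<in> mspace (E i) \<Longrightarrow> y \<in> mspace (E i) \<Longrightarrow>
      mdist (E i) (p i) x \<le> S \<and> mdist (G i) (f x) (f y) \<le> \<delta> \<Longrightarrow> mdist (E i) x y \<le> (\<epsilon> / L)\<^sup>2"
    by blast
  show "\<exists>\<delta>>0. \<forall>i. \<forall>x\<in>mspace (G i). \<forall>y\<in>mspace (G i).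
       mdist (G i) (q i) x \<le> R \<and> mdist (G i) (q i) y \<le> R \<and> mdist (G i) x y \<le> \<delta> \<longrightarrow>
       \<bar>h i (inv_into (mspace (E i)) f x) c - h i (inv_into (mspace (E i)) f y) c\<bar> \<le> \<epsilon>"
  proof (intro exI[of _ \<delta>] conjI allI ballI impI \<delta>(1))
    fix i x y assume x: "x \<in> mspace (G i)" and y: "y \<in> mspace (G i)"
      and *: "mdist (G i) (q i) x \<le> R \<and> mdist (G i) (q i) y \<le> R \<and> mdist (G i) x y \<le> \<delta>"
    define u where "u = inv_into (mspace (E i)) f x"
    define v where "v = inv_into (mspace (E i)) f y"
    have u: "u \<in> mspace (E i)" "f u = x"
      unfolding u_def using x f_onto[of i] by (auto intro: inv_into_into f_inv_into_f)
    have v: "v \<in> mspace (E i)" "f v = y"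
      unfolding v_def using y f_onto[of i] by (auto intro: inv_into_into f_inv_into_f)
    have "mdist (E i) (p i) u \<le> S" using * u(2) by (intro S[OF u(1)]) (simp add: q_def)
    then have "mdist (E i) u v \<le> (\<epsilon> / L)\<^sup>2" using * u(2) v(2) by (intro \<delta>(2)[OF u(1) v(1)]) simp
    then have "\<bar>h i u c - h i v c\<bar> \<le> \<epsilon>"
      using e by (intro coordinate_bound[OF assms dom.emb u(1) v(1)]) auto
    then show "\<bar>h i (inv_into (mspace (E i)) f x) c - h i (inv_into (mspace (E i)) f y) c\<bar> \<le> \<epsilon>"
      by (simp add: u_def v_def)
  qed
qed

lemma f_inj: "inj_on f (mspace (E i))"
proof (rule inj_onI)
  fix x y assume xy: "x \<in> mspace (E i)" "y \<in> mspace (E i)" "f x = f y"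
  have "mdist (E i) x y \<le> \<epsilon>" if e: "0 < \<epsilon>" for \<epsilon>
    using inverse_equicontinuity[OF e, of "mdist (E i) (p i) x"] xy f_in[OF xy(2)] by fastforce
  then have "mdist (E i) x y \<le> 0" by (rule dense_ge)
  then have "mdist (E i) x y = 0" using mdist_nonneg[of "E i" x y] by linarith
  then show "x = y" using xy by simp
qed

text \<open>The transfer principle in the codomain, for the coordinates of the inverse maps. It makes the limit
  map surjective.\<close>

lemma conv_preimage:
  assumes "cod.conv ys b"
  obtains xs a where "dom.conv xs a" "\<And>i. f (xs i) = ys i"
proof -
  define xs where "xs i = inv_into (mspace (E i)) f (ys i)" for i
  have xs: "xs i \<in> mspace (E i)" "f (xs i) = ys i" for i
    unfolding xs_def using cod.convD(1)[OF assms, of i] f_onto[of i] by (auto intro: inv_into_into f_inv_into_f)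
  have "convergent (\<lambda>i. h i (xs i) c)" if c: "c < m" for c
    unfolding xs_def
  proof (rule cod.transfer_convergent[OF equicontinuous_inverse[OF c] _ assms])
    fix n
    have "inv_into (mspace (E i)) f (N' i n) = N i n" for i
      unfolding N'_def by (rule inv_into_f_f[OF f_inj dom.net_in])
    then show "convergent (\<lambda>i. h i (inv_into (mspace (E i)) f (N' i n)) c)"
      using dom.conv_coordinate[OF dom.conv_net[of n] c] unfolding convergent_def by auto
  qed
  then have "\<exists>a\<in>mspace (Rn m). (\<lambda>i. mdist (Rn m) (h i (xs i)) a) \<longlonglongrightarrow> 0"
    by (rule convergent_Rn_coordinatewise)
  then obtain a where "a \<in> mspace (Rn m)" "(\<lambda>i. mdist (Rn m) (h i (xs i)) a) \<longlonglongrightarrow> 0" by blast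
  then have "dom.conv xs a" using xs(1) unfolding dom.conv_def by blast
  then show ?thesis using that xs(2) by blast
qed

lemma limit_map_onto: "limit_map ` dom.limit_set = cod.limit_set"
proof (intro equalityI subsetI)
  fix b assume "b \<in> limit_map ` dom.limit_set"
  then obtain a where "a \<in> dom.limit_set" "b = limit_map a" by blast
  then show "b \<in> cod.limit_set" using cod.conv_limit_set[OF conv_map[OF dom.conv_rep]] by blast
next
  fix b assume "b \<in> cod.limit_set"
  from conv_preimage[OF cod.conv_rep[OF this]] obtain xs a
    where xs: "dom.conv xs a" "\<And>i. f (xs i) = cod.rep b i" by metis
  have "cod.conv (cod.rep b) (limit_map a)" using conv_map[OF xs(1)] xs(2) by simp
  then have "limit_map a = b" by (rule cod.conv_unique[OF _ cod.conv_rep[OF \<open>b \<in> cod.limit_set\<close>]])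
  then show "b \<in> limit_map ` dom.limit_set" using dom.conv_limit_set[OF xs(1)] by blast
qed

lemma limit_map_distorts: "distorts dom.limit_metric cod.limit_metric limit_map"
  unfolding distorts_def dom.mspace_limit cod.mspace_limit dom.mdist_limit cod.mdist_limit
proof (intro conjI ballI impI)
  show "limit_map ` dom.limit_set \<subseteq> cod.limit_set" using limit_map_onto by blast
  fix a b c assume abc: "a \<in> dom.limit_set" "b \<in> dom.limit_set" "c \<in> dom.limit_set" "a \<noteq> c"
  note ra = dom.conv_rep[OF abc(1)] and rb = dom.conv_rep[OF abc(2)] and rc = dom.conv_rep[OF abc(3)]
  have "0 \<le> dom.limit_dist a c" "dom.limit_dist a c \<noteq> 0"
    using dom.Metric_space_limit abc unfolding Metric_space_def by auto
  then have pos: "0 < dom.limit_dist a c" by simp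
  note lab = dom.tendsto_limit_dist[OF ra rb] and lac = dom.tendsto_limit_dist[OF ra rc]
  have nn: "0 \<le> dom.limit_dist a b" using dom.Metric_space_limit unfolding Metric_space_def by auto
  have quot: "(\<lambda>i. mdist (E i) (dom.rep a i) (dom.rep b i) / mdist (E i) (dom.rep a i) (dom.rep c i))
      \<longlonglongrightarrow> dom.limit_dist a b / dom.limit_dist a c"
    using pos by (intro tendsto_divide lab lac) simp
  have eta: "(\<lambda>i. \<eta> (mdist (E i) (dom.rep a i) (dom.rep b i) / mdist (E i) (dom.rep a i) (dom.rep c i)))
      \<longlonglongrightarrow> \<eta> (dom.limit_dist a b / dom.limit_dist a c)"
    by (rule continuous_on_tendsto_compose[OF gauge_cont quot]) (use nn pos in auto)
  have "\<forall>\<^sub>F i in sequentially. 0 < mdist (E i) (dom.rep a i) (dom.rep c i)"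
    by (rule order_tendstoD(1)[OF lac pos])
  then have ev: "\<forall>\<^sub>F i in sequentially. mdist (G i) (f (dom.rep a i)) (f (dom.rep b i)) \<le>
      \<eta> (mdist (E i) (dom.rep a i) (dom.rep b i) / mdist (E i) (dom.rep a i) (dom.rep c i)) *
      mdist (G i) (f (dom.rep a i)) (f (dom.rep c i))"
    by (rule eventually_mono)
       (rule distortsD[OF dis dom.convD(1)[OF ra] dom.convD(1)[OF rb] dom.convD(1)[OF rc]
          _ order_refl order_refl])
  show "cod.limit_dist (limit_map a) (limit_map b) \<le>
      \<eta> (dom.limit_dist a b / dom.limit_dist a c) * cod.limit_dist (limit_map a) (limit_map c)"
    by (rule tendsto_le[OF _ tendsto_mult[OF eta cod.tendsto_limit_dist[OF conv_map[OF ra] conv_map[OF rc]]]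
          cod.tendsto_limit_dist[OF conv_map[OF ra] conv_map[OF rb]] ev]) simp
qed

lemma maps_converge_limit:
  "maps_converge (Rn m) (Rn m') (\<lambda>i. h i ` mspace (E i))
     (\<lambda>i. g i \<circ> f \<circ> inv_into (mspace (E i)) (h i)) dom.limit_set limit_map"
  unfolding maps_converge_def
proof (intro allI impI)
  fix zs z assume H: "(\<forall>i. zs i \<in> h i ` mspace (E i)) \<and> z \<in> dom.limit_set \<and>
    limitin (mtopology_of (Rn m)) zs z sequentially"
  then have "(\<lambda>i. mdist (Rn m) (zs i) z) \<longlonglongrightarrow> 0" unfolding limitin_mtopology_of_iff by blast
  then have "dom.conv (\<lambda>i. inv_into (mspace (E i)) (h i) (zs i)) z"
    using H by (intro dom.conv_of_image_sequence) auto
  from conv_map[OF this] have c: "cod.conv (\<lambda>i. f (inv_into (mspace (E i)) (h i) (zs i))) (limit_map z)" .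
  show "limitin (mtopology_of (Rn m')) (\<lambda>i. (g i \<circ> f \<circ> inv_into (mspace (E i)) (h i)) (zs i)) (limit_map z) sequentially"
    unfolding limitin_mtopology_of_iff o_def
    using cod.convD(2,3)[OF c] cod.k_in[OF cod.convD(1)[OF c]] by simp
qed

lemma limit_map_base: "limit_map (\<lambda>_. 0) = (\<lambda>_. 0)"
proof -
  have "(\<lambda>i. f (p i)) = q" using q_def by auto
  then have "cod.conv q (limit_map (\<lambda>_. 0))" using conv_map[OF dom.conv_base] by simp
  then show ?thesis by (rule cod.conv_unique[OF _ cod.conv_base])
qed

lemma package_converge_limit:
  assumes "\<And>i. mcomplete_of (E i)" "\<And>i. doubling_with M (E i)"
    and "\<And>i. mcomplete_of (G i)" "\<And>i. doubling_with M' (G i)"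
  shows "package_converge (\<lambda>i. ((E i, p i), (G i, f (p i)), f))
      ((dom.limit_metric, \<lambda>_. 0), (cod.limit_metric, \<lambda>_. 0), limit_map)"
proof -
  have q: "q = (\<lambda>i. f (p i))" using q_def by auto
  note X = dom.pointed_converge_limit[OF assms(1,2)]
  note Y = cod.pointed_converge_limit[OF assms(3,4), unfolded q]
  have mp: "mapping_package ((E i, p i), (G i, f (p i)), f)" for i
    using X Y f_onto[of i] unfolding mapping_package_def pointed_converge_via_def by simp
  have mp': "mapping_package ((dom.limit_metric, \<lambda>_. 0), (cod.limit_metric, \<lambda>_. 0), limit_map)"
    using X Y limit_map_onto limit_map_base
    unfolding mapping_package_def pointed_converge_via_def by (simp add: dom.mspace_limit cod.mspace_limit)
  have inv: "inv_into dom.limit_set (\<lambda>x. x) z = z" if "z \<in> dom.limit_set" for z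
    using inv_into_f_f[of "\<lambda>x. x" dom.limit_set z] that by simp
  have "maps_converge (Rn m) (Rn m') (\<lambda>i. h i ` mspace (E i))
     (\<lambda>i. g i \<circ> f \<circ> inv_into (mspace (E i)) (h i)) dom.limit_set
     ((\<lambda>x. x) \<circ> limit_map \<circ> inv_into dom.limit_set (\<lambda>x. x))"
    using maps_converge_limit unfolding maps_converge_def by (simp add: inv)
  then show ?thesis
    unfolding package_converge_def using mp mp' X Y
    by (intro conjI allI exI[of _ "1/2"] exI[of _ m] exI[of _ m'] exI[of _ h] exI[of _ g] exI[of _ "\<lambda>x. x"])
       (simp_all add: pulled_map_def dom.mspace_limit)
qed

end

section \<open>Compactness for rescaled spaces\<close>

text \<open>Tychonoff's theorem: a product of countably many compact intervals is sequentially compact.\<close>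

lemma common_convergent_subsequence:
  fixes a :: "'k :: countable \<Rightarrow> nat \<Rightarrow> real"
  assumes "\<And>n. \<exists>B. \<forall>i. \<bar>a n i\<bar> \<le> B"
  obtains \<sigma> :: "nat \<Rightarrow> nat" where "strict_mono \<sigma>" "\<And>n. convergent (\<lambda>i. a n (\<sigma> i))"
proof -
  obtain B where B: "\<And>n i. \<bar>a n i\<bar> \<le> B n" using assms by metis
  define S where "S = PiE UNIV (\<lambda>n. {- B n..B n})"
  have "compactin (product_topology (\<lambda>_. euclideanreal) UNIV) S"
    unfolding S_def compactin_PiE by simp
  then have "compact S" by (simp add: euclidean_product_topology)
  then have "seq_compact S" by (rule compact_imp_seq_compact)
  moreover have "(\<lambda>n. a n i) \<in> S" for i
    using B by (auto simp: S_def PiE_def abs_le_iff minus_le_iff)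
  ultimately obtain l \<sigma> where \<sigma>: "strict_mono (\<sigma> :: nat \<Rightarrow> nat)" "((\<lambda>i n. a n i) \<circ> \<sigma>) \<longlonglongrightarrow> l"
    unfolding seq_compact_def by metis
  have "(\<lambda>i. a n (\<sigma> i)) \<longlonglongrightarrow> l n" for n
  proof -
    have "continuous_on UNIV (\<lambda>x :: 'k \<Rightarrow> real. x n)" by (rule continuous_on_product_coordinates)
    from continuous_on_tendsto_compose[OF this \<sigma>(2)] show ?thesis by (simp add: o_def)
  qed
  then show ?thesis using that[OF \<sigma>(1)] by (auto simp: convergent_def)
qed

text \<open>Dividing distances by \<open>r\<close> divides the snowflake distances by \<open>sqrt r\<close>, hence the constant \<open>L\<close> is
  preserved under all rescalings.\<close>

lemma rescaled_embedding:
  assumes b: "bi_lipschitz L (snowflake (1/2) X) (Rn m) h" and r: "0 < r" and p: "p \<in> mspace X"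
  shows "bi_lipschitz L (snowflake (1/2) (rescale r X)) (Rn m) (\<lambda>x c. (h x c - h p c) / sqrt r)"
proof -
  have dist: "mdist (Rn m) (\<lambda>c. (h x c - h p c) / sqrt r) (\<lambda>c. (h y c - h p c) / sqrt r) =
      mdist (Rn m) (h x) (h y) / sqrt r" for x y
  proof -
    have "mdist (Rn m) (\<lambda>c. (h x c - h p c) / sqrt r) (\<lambda>c. (h y c - h p c) / sqrt r) =
        L2_set (\<lambda>c. (h x c - h y c) * (1 / sqrt r)) {..<m}"
      unfolding mdist_Rn by (rule L2_set_cong) (auto simp: diff_divide_distrib)
    also have "\<dots> = L2_set (\<lambda>c. h x c - h y c) {..<m} * (1 / sqrt r)"
      using r by (intro L2_set_left_distrib[symmetric]) simp
    finally show ?thesis by (simp add: mdist_Rn)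
  qed
  show ?thesis
    unfolding bi_lipschitz_half_iff mspace_rescale[OF r] dist
  proof (intro conjI ballI)
    show "1 \<le> L" by (rule bi_lipschitz_halfD(1)[OF b])
    show "(\<lambda>x c. (h x c - h p c) / sqrt r) ` mspace X \<subseteq> mspace (Rn m)"
      using bi_lipschitz_halfD(2)[OF b] p by (auto simp: mspace_Rn)
    fix x y assume xy: "x \<in> mspace X" "y \<in> mspace X"
    have sq: "sqrt (mdist (rescale r X) x y) = sqrt (mdist X x y) / sqrt r"
      by (simp add: mdist_rescale[OF r] real_sqrt_divide)
    have "sqrt (mdist X x y) / L \<le> mdist (Rn m) (h x) (h y)"
      using b xy unfolding bi_lipschitz_half_iff by blast
    then have "sqrt (mdist X x y) / L / sqrt r \<le> mdist (Rn m) (h x) (h y) / sqrt r"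
      using r by (intro divide_right_mono) auto
    then show "sqrt (mdist (rescale r X) x y) / L \<le> mdist (Rn m) (h x) (h y) / sqrt r"
      by (simp add: sq mult.commute)
    have "mdist (Rn m) (h x) (h y) / sqrt r \<le> L * sqrt (mdist X x y) / sqrt r"
      using r bi_lipschitz_halfD(3)[OF b xy] by (intro divide_right_mono) auto
    then show "mdist (Rn m) (h x) (h y) / sqrt r \<le> L * sqrt (mdist (rescale r X) x y)"
      by (simp add: sq)
  qed
qed

text \<open>The net point with index \<open>(j, v)\<close> is some point whose image lies in the cube with label \<open>v\<close> of the grid
  of mesh \<open>2\<close> to the power \<open>- j\<close>, and the base point if there is none. The indices are thus independent
  of \<open>i\<close>, and the finitely many cubes that meet a ball of the Euclidean space provide \<open>J\<close>.\<close>

lemma grid_net: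
  fixes E :: "nat \<Rightarrow> 'a metric"
  assumes emb: "\<And>i. bi_lipschitz L (snowflake (1/2) (E i)) (Rn m) (k i)"
    and base: "\<And>i. p i \<in> mspace (E i)" "\<And>i. k i (p i) = (\<lambda>_. 0)"
  shows "\<exists>N :: nat \<Rightarrow> nat \<times> int list \<Rightarrow> 'a. (\<forall>i n. N i n \<in> mspace (E i)) \<and>
    (\<forall>n. \<exists>B. \<forall>i. mdist (E i) (p i) (N i n) \<le> B) \<and>
    (\<forall>R \<epsilon>. 0 < \<epsilon> \<longrightarrow> (\<exists>J. finite J \<and>
      (\<forall>i. \<forall>x\<in>mspace (E i). mdist (E i) (p i) x \<le> R \<longrightarrow> (\<exists>n\<in>J. mdist (E i) x (N i n) \<le> \<epsilon>))))"
proof -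
  define s :: "nat \<Rightarrow> real" where "s j = (1/2) ^ j" for j
  have s: "0 < s j" for j by (simp add: s_def)
  define hit where "hit i n x \<longleftrightarrow> x \<in> mspace (E i) \<and> cell m (s (fst n)) (k i x) = snd n" for i n x
  define N where "N i n = (if \<exists>x. hit i n x then SOME x. hit i n x else p i)" for i n
  have L: "1 \<le> L" by (rule bi_lipschitz_halfD(1)[OF emb])
  have N_hit: "hit i n (N i n)" if "hit i n x" for i n x
    using that someI[of "hit i n" x] unfolding N_def by auto
  have N_in: "N i n \<in> mspace (E i)" for i n
  proof (cases "\<exists>x. hit i n x")
    case True
    then show ?thesis using N_hit unfolding hit_def by blast
  qed (simp add: N_def base)
  have 2: "\<exists>B. \<forall>i. mdist (E i) (p i) (N i n) \<le> B" for n
  proof (cases "\<exists>i x. hit i n x")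
    case True
    then obtain i0 x0 where i0: "hit i0 n x0" by blast
    define T where "T = mdist (Rn m) (\<lambda>_. 0) (k i0 x0) + m * s (fst n)"
    have T: "0 \<le> T" using s[of "fst n"] by (simp add: T_def)
    have "mdist (E i) (p i) (N i n) \<le> (L * T)\<^sup>2" for i
    proof (cases "\<exists>x. hit i n x")
      case True
      then have hit: "hit i n (N i n)" using N_hit by blast
      have "mdist (Rn m) (k i0 x0) (k i (N i n)) \<le> m * s (fst n)"
        by (rule same_cell_mdist_le[OF s]) (use hit i0 in \<open>simp add: hit_def\<close>)
      then have "mdist (Rn m) (k i (p i)) (k i (N i n)) \<le> T"
        using mdist_Rn_triangle[of m "\<lambda>_. 0" "k i (N i n)" "k i0 x0"] unfolding base T_def by linarith
      then have "(L * mdist (Rn m) (k i (p i)) (k i (N i n)))\<^sup>2 \<le> (L * T)\<^sup>2"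
        using L by (intro power_mono mult_left_mono) auto
      then show ?thesis using bi_lipschitz_halfD(5)[OF emb base(1) N_in] order_trans by blast
    next
      case False
      then show ?thesis using base(1)[of i] by (simp add: N_def)
    qed
    then show ?thesis by blast
  next
    case False
    then have "mdist (E i) (p i) (N i n) \<le> 0" for i using base(1)[of i] by (simp add: N_def)
    then show ?thesis by blast
  qed
  have 3: "\<exists>J. finite J \<and>
      (\<forall>i. \<forall>x\<in>mspace (E i). mdist (E i) (p i) x \<le> R \<longrightarrow> (\<exists>n\<in>J. mdist (E i) x (N i n) \<le> \<epsilon>))"
    if e: "0 < \<epsilon>" for R \<epsilon>
  proof -
    define t where "t = sqrt \<epsilon> / (L * (real m + 1))"
    have Lm: "0 < L * (real m + 1)" using L by simp
    have "0 < t" unfolding t_def using e Lm by (intro divide_pos_pos) auto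
    then obtain j where "(1/2) ^ j < t" using real_arch_pow_inv[of t "1/2"] by auto
    then have j: "s j \<le> t" by (simp add: s_def)
    obtain K :: nat where K: "L * sqrt R / s j \<le> K" using real_arch_simple by blast
    have "\<exists>n\<in>{j} \<times> cells m K. mdist (E i) x (N i n) \<le> \<epsilon>"
      if x: "x \<in> mspace (E i)" "mdist (E i) (p i) x \<le> R" for i x
    proof -
      define v where "v = cell m (s j) (k i x)"
      have "\<bar>k i x c\<bar> \<le> K * s j" if c: "c < m" for c
      proof -
        have "\<bar>k i x c - k i (p i) c\<bar> \<le> mdist (Rn m) (k i x) (k i (p i))" by (rule abs_le_mdist_Rn[OF c])
        also have "\<dots> \<le> L * sqrt (mdist (E i) x (p i))" by (rule bi_lipschitz_halfD(3)[OF emb x(1) base(1)])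
        also have "\<dots> \<le> L * sqrt R" using x(2) L by (intro mult_left_mono) (auto simp: mdist_commute)
        also have "\<dots> \<le> K * s j" using K s[of j] by (simp add: pos_divide_le_eq)
        finally show ?thesis by (simp add: base)
      qed
      then have v: "v \<in> cells m K" unfolding v_def by (rule cell_in_cells[OF s])
      have "hit i (j, v) x" using x(1) by (simp add: hit_def v_def)
      then have hN: "hit i (j, v) (N i (j, v))" by (rule N_hit)
      have "mdist (Rn m) (k i x) (k i (N i (j, v))) \<le> m * s j"
        by (rule same_cell_mdist_le[OF s]) (use hN in \<open>simp add: hit_def v_def\<close>)
      also have "\<dots> \<le> (real m + 1) * t" using j s[of j] by (intro mult_mono) auto
      finally have "L * mdist (Rn m) (k i x) (k i (N i (j, v))) \<le> L * ((real m + 1) * t)"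
        using L by (intro mult_left_mono) auto
      also have "\<dots> = L * (real m + 1) * t" by (simp only: mult.assoc)
      also have "\<dots> = sqrt \<epsilon>" unfolding t_def times_divide_eq_right by (rule nonzero_mult_div_cancel_left, rule notI) (use Lm in linarith)
      finally have "sqrt (mdist (E i) x (N i (j, v))) \<le> sqrt \<epsilon>"
        using bi_lipschitz_halfD(4)[OF emb x(1) N_in[of i "(j, v)"]] by linarith
      then have "mdist (E i) x (N i (j, v)) \<le> \<epsilon>" by simp
      then show ?thesis using v by blast
    qed
    then show ?thesis using finite_cells[of m K] by (intro exI[of _ "{j} \<times> cells m K"]) auto
  qed
  show ?thesis by (intro exI[of _ N] conjI allI impI N_in 2 3)
qed

lemma embedded_coordinate_bounded:
  fixes E :: "nat \<Rightarrow> 'a metric"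
  assumes emb: "\<And>i. bi_lipschitz L (snowflake (1/2) (E i)) (Rn m) (k i)"
    and base: "\<And>i. p i \<in> mspace (E i)" "\<And>i. k i (p i) = (\<lambda>_. 0)" and K: "\<And>i. K i \<in> mspace (E i)"
    and bdd: "\<exists>B. \<forall>i. mdist (E i) (p i) (K i) \<le> B"
  shows "\<exists>B. \<forall>i. \<bar>k i (K i) c\<bar> \<le> B"
proof -
  obtain B where B: "\<And>i. mdist (E i) (p i) (K i) \<le> B" using bdd by blast
  have L: "1 \<le> L" by (rule bi_lipschitz_halfD(1)[OF emb])
  have B0: "0 \<le> B" using B[of 0] mdist_nonneg[of "E 0" "p 0" "K 0"] by linarith
  have "\<bar>k i (K i) c\<bar> \<le> L * sqrt B" for i
  proof (cases "c < m")
    case True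
    have "\<bar>k i (p i) c - k i (K i) c\<bar> \<le> mdist (Rn m) (k i (p i)) (k i (K i))"
      by (rule abs_le_mdist_Rn[OF True])
    also have "\<dots> \<le> L * sqrt (mdist (E i) (p i) (K i))" by (rule bi_lipschitz_halfD(3)[OF emb base(1) K])
    also have "\<dots> \<le> L * sqrt B" using B L by (intro mult_left_mono) auto
    finally show ?thesis by (simp add: base)
  next
    case False
    then have "k i (K i) c = 0" using bi_lipschitz_halfD(2)[OF emb K] by (simp add: mspace_Rn)
    then show ?thesis using L B0 by simp
  qed
  then show ?thesis by blast
qed

lemma mutual_distance_bounded:
  fixes E :: "nat \<Rightarrow> 'a metric"
  assumes p: "\<And>i. p i \<in> mspace (E i)" and K: "\<And>i. K i \<in> mspace (E i)" "\<And>i. K' i \<in> mspace (E i)"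
    and bdd: "\<exists>B. \<forall>i. mdist (E i) (p i) (K i) \<le> B" "\<exists>B. \<forall>i. mdist (E i) (p i) (K' i) \<le> B"
  shows "\<exists>B. \<forall>i. \<bar>mdist (E i) (K i) (K' i)\<bar> \<le> B"
proof -
  obtain B B' where B: "\<And>i. mdist (E i) (p i) (K i) \<le> B" "\<And>i. mdist (E i) (p i) (K' i) \<le> B'"
    using bdd by blast
  have "\<bar>mdist (E i) (K i) (K' i)\<bar> \<le> B + B'" for i
    using mdist_triangle[OF K(1)[of i] p[of i] K(2)[of i]] B(1)[of i] B(2)[of i]
    by (simp add: mdist_commute[of "E i" "K i" "p i"])
  then show ?thesis by blast
qed

lemma mcomplete_rescale:
  assumes "mcomplete_of X" "0 < r"
  shows "mcomplete_of (rescale r X)"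
  unfolding mcomplete_of_iff_sequences
proof (intro allI impI)
  fix xs assume c: "Metric_space.MCauchy (mspace (rescale r X)) (mdist (rescale r X)) xs"
  have "range xs \<subseteq> mspace X"
    using conjunct1[OF c[unfolded Metric_space.MCauchy_def[OF Metric_space_mspace_mdist]]]
    unfolding mspace_rescale[OF assms(2)] .
  then have xs: "xs i \<in> mspace X" for i by blast
  have "Metric_space.MCauchy (mspace X) (mdist X) xs"
  proof (rule MCauchy_modulus[OF c xs, where \<phi> = "\<lambda>u. r * u"])
    show "mdist X (xs n) (xs n') \<le> r * mdist (rescale r X) (xs n) (xs n')" for n n'
      using assms(2) by (simp add: mdist_rescale)
    show "\<exists>\<delta>>0. \<forall>u. 0 \<le> u \<and> u < \<delta> \<longrightarrow> r * u < \<epsilon>" if "0 < \<epsilon>" for \<epsilon>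
      using that assms(2) by (intro exI[of _ "\<epsilon> / r"]) (simp add: pos_less_divide_eq mult.commute)
  qed
  then obtain x where x: "x \<in> mspace X" "(\<lambda>i. mdist X (xs i) x) \<longlonglongrightarrow> 0"
    using assms(1) unfolding mcomplete_of_iff_sequences by blast
  have "(\<lambda>i. mdist X (xs i) x / r) \<longlonglongrightarrow> 0 / r" using assms(2) by (intro tendsto_divide x(2)) auto
  then show "\<exists>x\<in>mspace (rescale r X). (\<lambda>i. mdist (rescale r X) (xs i) x) \<longlonglongrightarrow> 0"
    using x(1) assms(2) by (auto simp: mspace_rescale mdist_rescale)
qed

lemma (in gauge) distorts_rescale:
  assumes "distorts X Y f" "0 < r" "0 < t"
  shows "distorts (rescale r X) (rescale t Y) f"
  unfolding distorts_def mspace_rescale[OF assms(2)] mspace_rescale[OF assms(3)]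
    mdist_rescale[OF assms(2)] mdist_rescale[OF assms(3)]
proof (intro conjI ballI impI)
  show "f ` mspace X \<subseteq> mspace Y" using assms(1) unfolding distorts_def by blast
  fix x y z assume xyz: "x \<in> mspace X" "y \<in> mspace X" "z \<in> mspace X" "x \<noteq> z"
  have "mdist Y (f x) (f y) / t \<le> \<eta> (mdist X x y / mdist X x z) * mdist Y (f x) (f z) / t"
    using assms(1,3) xyz unfolding distorts_def by (intro divide_right_mono) auto
  then show "mdist Y (f x) (f y) / t \<le> \<eta> (mdist X x y / r / (mdist X x z / r)) * (mdist Y (f x) (f z) / t)"
    using assms(2) by simp
qed

section \<open>Existence of tangent mappings\<close>

lemma compact_space_complete:
  "compact_space (mtopology_of X) \<Longrightarrow> mcomplete_of X"
  unfolding mtopology_of_def mcomplete_of_def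
  by (rule Metric_space.compact_space_imp_mcomplete[OF Metric_space_mspace_mdist])

lemma compact_space_bounded:
  assumes "compact_space (mtopology_of X)"
  shows "\<exists>\<Delta>>0. \<forall>x\<in>mspace X. \<forall>y\<in>mspace X. mdist X x y \<le> \<Delta>"
proof -
  have "compactin (Metric_space.mtopology (mspace X) (mdist X)) (mspace X)"
    using assms unfolding compact_space_def mtopology_of_def
    by (simp add: Metric_space.topspace_mtopology[OF Metric_space_mspace_mdist])
  then have "Metric_space.mbounded (mspace X) (mdist X) (mspace X)"
    by (rule Metric_space.compactin_imp_mbounded[OF Metric_space_mspace_mdist])
  then obtain B where "\<forall>x\<in>mspace X. \<forall>y\<in>mspace X. mdist X x y \<le> B"
    unfolding Metric_space.mbounded_alt[OF Metric_space_mspace_mdist] by blast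
  then show ?thesis by (intro exI[of _ "max B 1"]) force
qed

lemma bounded_doubling_embedding:
  assumes "doubling X" "\<forall>x\<in>mspace X. \<forall>y\<in>mspace X. mdist X x y \<le> \<Delta>" "x0 \<in> mspace X"
  obtains m L h where "bi_lipschitz L (snowflake (1/2) X) (Rn m) h"
proof -
  obtain M where M: "doubling_with M X" using assms(1) by (auto simp: doubling_def)
  have "mspace X \<subseteq> mcball_of X x0 \<Delta>" using assms(2,3) by auto
  from assouad_embedding[OF M assms(3) this] show ?thesis using that by blast
qed

context gauge
begin

text \<open>A quantitative form of uniform continuity: of two fixed points \<open>a\<close> and \<open>b\<close>, one is far from \<open>p\<close> and
  serves as comparison point.\<close>

lemma distorts_small_images:
  assumes d: "distorts X Y f" and bnd: "\<forall>x\<in>mspace Y. \<forall>y\<in>mspace Y. mdist Y x y \<le> \<Delta>"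
    and ab: "a \<in> mspace X" "b \<in> mspace X" "a \<noteq> b" and e: "0 < \<epsilon>"
  shows "\<exists>\<delta>>0. \<forall>p\<in>mspace X. \<forall>w\<in>mspace X. mdist X p w \<le> \<delta> \<longrightarrow> mdist Y (f p) (f w) \<le> \<epsilon>"
proof -
  define T where "T = max \<Delta> 1"
  have s: "0 < mdist X a b" using ab by (simp add: order_less_le)
  obtain \<delta> where \<delta>: "0 < \<delta>" "\<And>u. u \<in> {0..\<delta>} \<Longrightarrow> \<eta> u \<le> \<epsilon> / T"
    using gauge_small[of "\<epsilon> / T"] e by (auto simp: T_def)
  have fY: "f x \<in> mspace Y" if "x \<in> mspace X" for x using d that unfolding distorts_def by blast
  have "mdist Y (f p) (f w) \<le> \<epsilon>"
    if p: "p \<in> mspace X" and w: "w \<in> mspace X" and pw: "mdist X p w \<le> \<delta> * (mdist X a b / 2)" for p w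
  proof -
    obtain z where z: "z \<in> {a, b}" "mdist X a b / 2 \<le> mdist X p z" using far_point[OF ab(1,2) p] by blast
    have zX: "z \<in> mspace X" using z(1) ab by auto
    have zpos: "0 < mdist X p z" using z(2) s by linarith
    have "mdist X p w / mdist X p z \<le> \<delta>"
    proof -
      have "\<delta> * (mdist X a b / 2) \<le> \<delta> * mdist X p z" using z(2) \<delta>(1) by (intro mult_left_mono) auto
      then show ?thesis using pw zpos by (simp add: pos_divide_le_eq)
    qed
    then have "mdist Y (f p) (f w) \<le> \<epsilon> / T * T"
      using bnd fY[OF p] fY[OF zX]
      by (intro distortsD[OF d p w zX zpos] \<delta>(2)) (auto simp: T_def le_max_iff_disj)
    then show ?thesis by (simp add: T_def)
  qed
  then show ?thesis using \<delta>(1) s by (intro exI[of _ "\<delta> * (mdist X a b / 2)"]) auto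
qed

text \<open>The same with the roles exchanged: one of \<open>f a\<close> and \<open>f b\<close> is far from \<open>f p\<close>.\<close>

lemma distorts_large_images:
  assumes d: "distorts X Y f" and bnd: "\<forall>x\<in>mspace X. \<forall>y\<in>mspace X. mdist X x y \<le> \<Delta>"
    and ab: "a \<in> mspace X" "b \<in> mspace X" "f a \<noteq> f b" and e: "0 < s"
  shows "\<exists>c>0. \<forall>p\<in>mspace X. \<forall>x\<in>mspace X. s \<le> mdist X p x \<longrightarrow> c \<le> mdist Y (f p) (f x)"
proof -
  obtain S where S: "0 < S" "\<And>u. u \<in> {0..\<Delta> / s} \<Longrightarrow> \<eta> u \<le> S" using gauge_bounded by blast
  have fY: "f x \<in> mspace Y" if "x \<in> mspace X" for x using d that unfolding distorts_def by blast
  have ab': "0 < mdist Y (f a) (f b)" using fY ab by (simp add: order_less_le)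
  have "mdist Y (f a) (f b) / 2 / S \<le> mdist Y (f p) (f x)"
    if p: "p \<in> mspace X" and x: "x \<in> mspace X" and px: "s \<le> mdist X p x" for p x
  proof -
    obtain z where z: "z \<in> {a, b}" "mdist Y (f a) (f b) / 2 \<le> mdist Y (f p) (f z)"
      using far_point[OF fY[OF ab(1)] fY[OF ab(2)] fY[OF p]] by blast
    have zX: "z \<in> mspace X" using z(1) ab by auto
    have "0 \<le> mdist X p z" "mdist X p z \<le> \<Delta>" using bnd p zX by auto
    then have "mdist X p z / mdist X p x \<le> \<Delta> / s"
      using px e by (intro frac_le) linarith+
    then have "mdist X p z / mdist X p x \<in> {0..\<Delta> / s}" by simp
    then have "mdist Y (f p) (f z) \<le> S * mdist Y (f p) (f x)"
      using px e by (intro distortsD[OF d p zX x] S(2)) auto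
    then have "mdist Y (f a) (f b) / 2 \<le> mdist Y (f p) (f x) * S" using z(2) by (simp add: mult.commute)
    then show ?thesis using S(1) by (simp add: pos_divide_le_eq)
  qed
  then show ?thesis using S(1) ab' by (intro exI[of _ "mdist Y (f a) (f b) / 2 / S"]) auto
qed

end

lemma pointed_converge_imp_weak_tangent:
  assumes "mcomplete_of X" "doubling X" "\<And>i. ps i \<in> mspace X" "\<And>i. 0 < r i" "r \<longlonglongrightarrow> 0"
    and "pointed_converge_via \<alpha> m hs h (\<lambda>i. (rescale (r i) X, ps i)) Xp"
  shows "weak_tangent X Xp"
  unfolding weak_tangent_def pointed_converge_def using assms by blast

text \<open>The space \<open>X\<close> is blown up around \<open>ps i\<close> at the scale of \<open>ws i\<close>; the points \<open>xs i\<close> are at most as far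
  away and therefore remain visible in the limit.\<close>

locale tangent_data = gauge \<eta> for \<eta> +
  fixes X :: "'a metric" and Y :: "'b metric" and f :: "'a \<Rightarrow> 'b"
    and ps ws xs :: "nat \<Rightarrow> 'a"
  assumes compact: "compact_space (mtopology_of X)" "compact_space (mtopology_of Y)"
    and dbl: "doubling X" "doubling Y" and qs: "quasisymmetric \<eta> X Y f"
    and pts: "\<And>i. ps i \<in> mspace X" "\<And>i. ws i \<in> mspace X" "\<And>i. xs i \<in> mspace X"
    and distinct: "\<And>i. ps i \<noteq> ws i"
    and close: "(\<lambda>i. mdist X (ps i) (ws i)) \<longlonglongrightarrow> 0"
    and between: "\<And>i. mdist X (ps i) (xs i) \<le> mdist X (ps i) (ws i)"
begin

definition r where "r i = mdist X (ps i) (ws i)"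
definition t where "t i = mdist Y (f (ps i)) (f (ws i))"

lemma f_props: "distorts X Y f" "f ` mspace X = mspace Y" "inj_on f (mspace X)" "x \<in> mspace X \<Longrightarrow> f x \<in> mspace Y"
  using distorts_of_quasisymmetric[OF qs] by auto

lemma r_pos: "0 < r i" using pts distinct by (simp add: r_def order_less_le)

lemma t_pos: "0 < t i"
proof -
  have "f (ps i) \<noteq> f (ws i)" using f_props(3) pts distinct by (auto dest: inj_onD)
  then show ?thesis using pts f_props(4) by (simp add: t_def order_less_le)
qed

lemma r_lim: "r \<longlonglongrightarrow> 0" unfolding r_def by (rule close)

lemma t_lim: "t \<longlonglongrightarrow> 0"
proof (rule LIMSEQ_I)
  fix e :: real assume e: "0 < e"
  obtain \<Delta> where \<Delta>: "\<forall>x\<in>mspace Y. \<forall>y\<in>mspace Y. mdist Y x y \<le> \<Delta>"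
    using compact_space_bounded[OF compact(2)] by blast
  obtain \<delta> where \<delta>: "0 < \<delta>"
    "\<forall>p\<in>mspace X. \<forall>w\<in>mspace X. mdist X p w \<le> \<delta> \<longrightarrow> mdist Y (f p) (f w) \<le> e / 2"
    using distorts_small_images[OF f_props(1) \<Delta> pts(1)[of 0] pts(2)[of 0] distinct half_gt_zero[OF e]] by blast
  obtain n0 where n0: "\<And>n. n0 \<le> n \<Longrightarrow> r n < \<delta>"
    using order_tendstoD(2)[OF r_lim \<delta>(1)] by (auto simp: eventually_sequentially)
  have "norm (t n - 0) < e" if "n0 \<le> n" for n
  proof -
    have "mdist X (ps n) (ws n) \<le> \<delta>" using n0[OF that] by (simp add: r_def)
    then have "t n \<le> e / 2" unfolding t_def using \<delta>(2) pts by blast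
    then show ?thesis using t_pos[of n] e by simp
  qed
  then show "\<exists>n0. \<forall>n\<ge>n0. norm (t n - 0) < e" by blast
qed

text \<open>The points \<open>ws i\<close> and \<open>xs i\<close> are added to the grid net, so that they converge along the common
  subsequence. Their limits are the witnesses \<open>wh\<close> and \<open>xh\<close>.\<close>

lemma tangent_exists:
  obtains \<sigma> and Xh Yh :: "tangent_point metric" and fh o' wh xh where
    "weak_tangent_map X Y f (Xh, o') (Yh, fh o') fh" "quasisymmetric \<eta> Xh Yh fh"
    "o' \<in> mspace Xh" "wh \<in> mspace Xh" "xh \<in> mspace Xh"
    "mdist Xh o' wh = 1" "mdist Yh (fh o') (fh wh) = 1"
    "strict_mono (\<sigma> :: nat \<Rightarrow> nat)"
    "(\<lambda>i. mdist X (ps (\<sigma> i)) (xs (\<sigma> i)) / r (\<sigma> i)) \<longlonglongrightarrow> mdist Xh o' xh"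
    "(\<lambda>i. mdist Y (f (ps (\<sigma> i))) (f (xs (\<sigma> i))) / t (\<sigma> i)) \<longlonglongrightarrow> mdist Yh (fh o') (fh xh)"
proof -
  obtain \<Delta>X where \<Delta>X: "\<forall>x\<in>mspace X. \<forall>y\<in>mspace X. mdist X x y \<le> \<Delta>X"
    using compact_space_bounded[OF compact(1)] by blast
  obtain \<Delta>Y where \<Delta>Y: "\<forall>x\<in>mspace Y. \<forall>y\<in>mspace Y. mdist Y x y \<le> \<Delta>Y"
    using compact_space_bounded[OF compact(2)] by blast
  obtain m L h0 where h0: "bi_lipschitz L (snowflake (1/2) X) (Rn m) h0"
    by (rule bounded_doubling_embedding[OF dbl(1) \<Delta>X pts(1)[of 0]])
  obtain m' L' g0 where g0: "bi_lipschitz L' (snowflake (1/2) Y) (Rn m') g0"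
    by (rule bounded_doubling_embedding[OF dbl(2) \<Delta>Y f_props(4)[OF pts(1)[of 0]]])
  define E where "E i = rescale (r i) X" for i
  define G where "G i = rescale (t i) Y" for i
  define q where "q i = f (ps i)" for i
  define h where "h i x = (\<lambda>c. (h0 x c - h0 (ps i) c) / sqrt (r i))" for i x
  define g where "g i y = (\<lambda>c. (g0 y c - g0 (q i) c) / sqrt (t i))" for i y
  have E: "mspace (E i) = mspace X" "mdist (E i) x y = mdist X x y / r i" for i x y
    using r_pos by (simp_all add: E_def mspace_rescale mdist_rescale)
  have G: "mspace (G i) = mspace Y" "mdist (G i) u v = mdist Y u v / t i" for i u v
    using t_pos by (simp_all add: G_def mspace_rescale mdist_rescale)
  have embh: "bi_lipschitz L (snowflake (1/2) (E i)) (Rn m) (h i)" for i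
    unfolding E_def h_def by (rule rescaled_embedding[OF h0 r_pos pts(1)])
  have embg: "bi_lipschitz L' (snowflake (1/2) (G i)) (Rn m') (g i)" for i
    unfolding G_def g_def q_def by (rule rescaled_embedding[OF g0 t_pos f_props(4)[OF pts(1)]])
  have baseh: "ps i \<in> mspace (E i)" "h i (ps i) = (\<lambda>_. 0)" for i
    using pts by (simp_all add: E h_def)
  have baseg: "q i \<in> mspace (G i)" "g i (q i) = (\<lambda>_. 0)" for i
    using pts f_props(4) by (simp_all add: G g_def q_def)
  interpret F: normalised_family \<eta> E G f ps ws
  proof unfold_locales
    fix i
    show "distorts (E i) (G i) f" unfolding E_def G_def by (rule distorts_rescale[OF f_props(1) r_pos t_pos])
    show "mdist (E i) (ps i) (ws i) = 1" using r_pos[of i] by (simp add: E r_def)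
    show "mdist (G i) (f (ps i)) (f (ws i)) = 1" using t_pos[of i] by (simp add: G t_def)
  qed (simp_all add: E pts)
  have onto: "f ` mspace (E i) = mspace (G i)" for i by (simp add: E G f_props(2))
  from grid_net[where E = E and p = ps and k = h, OF embh baseh]
  obtain N0 :: "nat \<Rightarrow> nat \<times> int list \<Rightarrow> 'a" where N0: "\<forall>i n. N0 i n \<in> mspace (E i)"
    "\<forall>n. \<exists>B. \<forall>i. mdist (E i) (ps i) (N0 i n) \<le> B"
    "\<forall>R \<epsilon>. 0 < \<epsilon> \<longrightarrow> (\<exists>J. finite J \<and>
      (\<forall>i. \<forall>x\<in>mspace (E i). mdist (E i) (ps i) x \<le> R \<longrightarrow> (\<exists>n\<in>J. mdist (E i) x (N0 i n) \<le> \<epsilon>)))"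
    by (elim exE conjE)
  note N0_in = N0(1)[rule_format] and N0_bdd = N0(2)[rule_format] and N0_net = N0(3)[rule_format]
  define N :: "nat \<Rightarrow> (nat \<times> int list) + bool \<Rightarrow> 'a" where
    "N i n = (case n of Inl a \<Rightarrow> N0 i a | Inr b \<Rightarrow> if b then ws i else xs i)" for i n
  have N_in: "N i n \<in> mspace (E i)" for i n
    using N0_in pts by (auto simp: N_def E split: sum.split)
  have N_bdd: "\<exists>B. \<forall>i. mdist (E i) (ps i) (N i n) \<le> B" for n
  proof (cases n)
    case (Inl a)
    then show ?thesis using N0_bdd[of a] by (simp add: N_def)
  next
    case (Inr b)
    have "mdist (E i) (ps i) (N i n) \<le> 1" for i
      using between[of i] r_pos[of i] Inr by (simp add: N_def E r_def pos_divide_le_eq)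
    then show ?thesis by blast
  qed
  have N_net: "\<exists>J. finite J \<and>
      (\<forall>i. \<forall>x\<in>mspace (E i). mdist (E i) (ps i) x \<le> R \<longrightarrow> (\<exists>n\<in>J. mdist (E i) x (N i n) \<le> \<epsilon>))"
    if e: "0 < \<epsilon>" for R \<epsilon>
  proof -
    from N0_net[OF e, of R] obtain J where J: "finite J"
      "\<forall>i. \<forall>x\<in>mspace (E i). mdist (E i) (ps i) x \<le> R \<longrightarrow> (\<exists>n\<in>J. mdist (E i) x (N0 i n) \<le> \<epsilon>)"
      by (elim exE conjE)
    show ?thesis
    proof (intro exI[of _ "Inl ` J"] conjI allI ballI impI)
      show "finite (Inl ` J)" using J(1) by simp
      fix i x assume "x \<in> mspace (E i)" "mdist (E i) (ps i) x \<le> R"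
      then obtain n where "n \<in> J" "mdist (E i) x (N0 i n) \<le> \<epsilon>" using J(2) by blast
      then show "\<exists>n\<in>Inl ` J. mdist (E i) x (N i n) \<le> \<epsilon>" by (intro bexI[of _ "Inl n"]) (simp_all add: N_def)
    qed
  qed
  define N' where "N' i n = f (N i n)" for i n
  have N'_in: "N' i n \<in> mspace (G i)" for i n
    unfolding N'_def using onto[of i] N_in[of i n] by blast
  have N'_bdd: "\<exists>B. \<forall>i. mdist (G i) (q i) (N' i n) \<le> B" for n
  proof -
    obtain R where R: "\<And>i. mdist (E i) (ps i) (N i n) \<le> R" using N_bdd[of n] by blast
    obtain S where S: "\<And>i x. x \<in> mspace (E i) \<Longrightarrow> mdist (E i) (ps i) x \<le> R \<Longrightarrow>
      mdist (G i) (f (ps i)) (f x) \<le> S" using F.image_bounded[of R] by blast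
    have "mdist (G i) (q i) (N' i n) \<le> S" for i unfolding q_def N'_def by (rule S[OF N_in R])
    then show ?thesis by blast
  qed
  have N'_net: "\<exists>J. finite J \<and>
      (\<forall>i. \<forall>y\<in>mspace (G i). mdist (G i) (q i) y \<le> R \<longrightarrow> (\<exists>n\<in>J. mdist (G i) y (N' i n) \<le> \<epsilon>))"
    if e: "0 < \<epsilon>" for R \<epsilon>
  proof -
    obtain S where S: "\<And>i x. x \<in> mspace (E i) \<Longrightarrow> mdist (G i) (f (ps i)) (f x) \<le> R \<Longrightarrow>
      mdist (E i) (ps i) x \<le> S" using F.preimage_bounded[of R] by blast
    from F.equicontinuity[OF e, of S] obtain \<delta> where \<delta>: "0 < \<delta>"
      "\<And>i x y. x \<in> mspace (E i) \<Longrightarrow> y \<in> mspace (E i) \<Longrightarrow>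
        mdist (E i) (ps i) x \<le> S \<and> mdist (E i) x y \<le> \<delta> \<Longrightarrow> mdist (G i) (f x) (f y) \<le> \<epsilon>" by blast
    from N_net[OF \<delta>(1), of S] obtain J where J: "finite J"
      "\<forall>i. \<forall>x\<in>mspace (E i). mdist (E i) (ps i) x \<le> S \<longrightarrow> (\<exists>n\<in>J. mdist (E i) x (N i n) \<le> \<delta>)"
      by (elim exE conjE)
    show ?thesis
    proof (intro exI[of _ J] conjI allI ballI impI J(1))
      fix i y assume y: "y \<in> mspace (G i)" "mdist (G i) (q i) y \<le> R"
      then obtain x where x: "x \<in> mspace (E i)" "y = f x" using onto[of i] by blast
      have "mdist (E i) (ps i) x \<le> S" using y(2) x(2) by (intro S[OF x(1)]) (simp add: q_def)
      moreover from this obtain n where n: "n \<in> J" "mdist (E i) x (N i n) \<le> \<delta>" using J(2) x(1) by blast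
      ultimately have "mdist (G i) y (N' i n) \<le> \<epsilon>"
        unfolding x(2) N'_def by (intro \<delta>(2)[OF x(1) N_in] conjI)
      then show "\<exists>n\<in>J. mdist (G i) y (N' i n) \<le> \<epsilon>" using n(1) by blast
    qed
  qed
  \<comment> \<open>All coordinates and mutual distances of net points form one countable family, so that a
     single subsequence makes all of them converge.\<close>
  define a where "a s i = (case s of
      Inl (Inl (n, c)) \<Rightarrow> h i (N i n) c
    | Inl (Inr (n, c)) \<Rightarrow> g i (N' i n) c
    | Inr (Inl (n, n')) \<Rightarrow> mdist (E i) (N i n) (N i n')
    | Inr (Inr (n, n')) \<Rightarrow> mdist (G i) (N' i n) (N' i n'))" for s i
  have "\<exists>B. \<forall>i. \<bar>a s i\<bar> \<le> B" for s
  proof -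
    consider n c where "s = Inl (Inl (n, c))" | n c where "s = Inl (Inr (n, c))"
      | n n' where "s = Inr (Inl (n, n'))" | n n' where "s = Inr (Inr (n, n'))"
      by (metis obj_sumE surj_pair)
    then show ?thesis
    proof cases
      case (1 n c)
      then show ?thesis using embedded_coordinate_bounded[OF embh baseh N_in N_bdd[of n], of c] by (simp add: a_def)
    next
      case (2 n c)
      then show ?thesis using embedded_coordinate_bounded[OF embg baseg N'_in N'_bdd[of n], of c] by (simp add: a_def)
    next
      case (3 n n')
      then show ?thesis using mutual_distance_bounded[OF baseh(1) N_in N_in N_bdd[of n] N_bdd[of n']] by (simp add: a_def)
    next
      case (4 n n')
      then show ?thesis using mutual_distance_bounded[OF baseg(1) N'_in N'_in N'_bdd[of n] N'_bdd[of n']] by (simp add: a_def)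
    qed
  qed
  then obtain \<sigma> where \<sigma>: "strict_mono (\<sigma> :: nat \<Rightarrow> nat)" "\<And>s. convergent (\<lambda>i. a s (\<sigma> i))"
    using common_convergent_subsequence[of a] by blast
  have conv1: "convergent (\<lambda>i. h (\<sigma> i) (N (\<sigma> i) n) c)" for n c
    using \<sigma>(2)[of "Inl (Inl (n, c))"] by (simp add: a_def)
  have conv2: "convergent (\<lambda>i. g (\<sigma> i) (N' (\<sigma> i) n) c)" for n c
    using \<sigma>(2)[of "Inl (Inr (n, c))"] by (simp add: a_def)
  have conv3: "convergent (\<lambda>i. mdist (E (\<sigma> i)) (N (\<sigma> i) n) (N (\<sigma> i) n'))" for n n'
    using \<sigma>(2)[of "Inr (Inl (n, n'))"] by (simp add: a_def)
  have conv4: "convergent (\<lambda>i. mdist (G (\<sigma> i)) (N' (\<sigma> i) n) (N' (\<sigma> i) n'))" for n n'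
    using \<sigma>(2)[of "Inr (Inr (n, n'))"] by (simp add: a_def)
  interpret P: embedded_package "\<lambda>i. E (\<sigma> i)" "\<lambda>i. ps (\<sigma> i)" "\<lambda>i. h (\<sigma> i)" m L "\<lambda>i. N (\<sigma> i)"
    "\<lambda>i. G (\<sigma> i)" "\<lambda>i. q (\<sigma> i)" "\<lambda>i. g (\<sigma> i)" m' L' "\<lambda>i. N' (\<sigma> i)" \<eta> f "\<lambda>i. ws (\<sigma> i)"
  proof unfold_locales
    fix R \<epsilon> :: real assume e: "0 < \<epsilon>"
    show "\<exists>J. finite J \<and> (\<forall>i. \<forall>x\<in>mspace (E (\<sigma> i)). mdist (E (\<sigma> i)) (ps (\<sigma> i)) x \<le> R \<longrightarrow>
        (\<exists>n\<in>J. mdist (E (\<sigma> i)) x (N (\<sigma> i) n) \<le> \<epsilon>))"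
      using N_net[OF e, of R] by blast
    show "\<exists>J. finite J \<and> (\<forall>i. \<forall>x\<in>mspace (G (\<sigma> i)). mdist (G (\<sigma> i)) (q (\<sigma> i)) x \<le> R \<longrightarrow>
        (\<exists>n\<in>J. mdist (G (\<sigma> i)) x (N' (\<sigma> i) n) \<le> \<epsilon>))"
      using N'_net[OF e, of R] by blast
  qed (fact embh baseh N_in conv3 embg baseg N'_in conv4 F.dis F.pw F.unit onto q_def N'_def
        convergent_Rn_coordinatewise[OF conv1] convergent_Rn_coordinatewise[OF conv2])+
  define Xh where "Xh = P.dom.limit_metric"
  define Yh where "Yh = P.cod.limit_metric"
  obtain M where M: "doubling_with M X" using dbl(1) by (auto simp: doubling_def)
  obtain M' where M': "doubling_with M' Y" using dbl(2) by (auto simp: doubling_def)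
  have cplX: "mcomplete_of X" and cplY: "mcomplete_of Y"
    using compact by (simp_all add: compact_space_complete)
  have cE: "mcomplete_of (E (\<sigma> i))" and dE: "doubling_with M (E (\<sigma> i))" for i
    unfolding E_def by (rule mcomplete_rescale[OF cplX r_pos], rule doubling_with_rescale[OF M r_pos])
  have cG: "mcomplete_of (G (\<sigma> i))" and dG: "doubling_with M' (G (\<sigma> i))" for i
    unfolding G_def by (rule mcomplete_rescale[OF cplY t_pos], rule doubling_with_rescale[OF M' t_pos])
  define fh where "fh = P.limit_map"
  have pkg: "package_converge (\<lambda>i. ((E (\<sigma> i), ps (\<sigma> i)), (G (\<sigma> i), f (ps (\<sigma> i))), f))
      ((Xh, \<lambda>_. 0), (Yh, \<lambda>_. 0), fh)"
    unfolding Xh_def Yh_def fh_def by (rule P.package_converge_limit[OF cE dE cG dG])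
  have r_sub: "(\<lambda>i. r (\<sigma> i)) \<longlonglongrightarrow> 0" using LIMSEQ_subseq_LIMSEQ[OF r_lim \<sigma>(1)] by (simp add: o_def)
  have t_sub: "(\<lambda>i. t (\<sigma> i)) \<longlonglongrightarrow> 0" using LIMSEQ_subseq_LIMSEQ[OF t_lim \<sigma>(1)] by (simp add: o_def)
  have pcX: "pointed_converge_via (1/2) m (\<lambda>i. h (\<sigma> i)) (\<lambda>x. x)
      (\<lambda>i. (rescale (r (\<sigma> i)) X, ps (\<sigma> i))) (Xh, \<lambda>_. 0)"
    using P.dom.pointed_converge_limit[OF cE dE] by (simp only: Xh_def E_def)
  have wtX: "weak_tangent X (Xh, \<lambda>_. 0)"
    by (rule pointed_converge_imp_weak_tangent[OF cplX dbl(1) _ _ r_sub pcX]) (simp_all add: pts r_pos)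
  have pcY: "pointed_converge_via (1/2) m' (\<lambda>i. g (\<sigma> i)) (\<lambda>x. x)
      (\<lambda>i. (rescale (t (\<sigma> i)) Y, q (\<sigma> i))) (Yh, \<lambda>_. 0)"
    using P.cod.pointed_converge_limit[OF cG dG] by (simp only: Yh_def G_def)
  have wtY: "weak_tangent Y (Yh, \<lambda>_. 0)"
    by (rule pointed_converge_imp_weak_tangent[OF cplY dbl(2) _ _ t_sub pcY])
       (simp_all add: pts t_pos q_def f_props(4))
  have wtm: "weak_tangent_map X Y f (Xh, \<lambda>_. 0) (Yh, \<lambda>_. 0) fh"
    unfolding weak_tangent_map_def
  proof (intro conjI wtX wtY)
    show "f ` mspace X \<subseteq> mspace Y" using f_props(2) by simp
    show "\<exists>ps r t. (\<forall>i. ps i \<in> mspace X) \<and> (\<forall>i. 0 < r i) \<and> r \<longlonglongrightarrow> 0 \<and> (\<forall>i. 0 < t i) \<and> t \<longlonglongrightarrow> 0 \<and>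
        package_converge (\<lambda>i. ((rescale (r i) X, ps i), (rescale (t i) Y, f (ps i)), f))
          ((Xh, \<lambda>_. 0), (Yh, \<lambda>_. 0), fh)"
      by (rule exI[of _ "\<lambda>i. ps (\<sigma> i)"], rule exI[of _ "\<lambda>i. r (\<sigma> i)"], rule exI[of _ "\<lambda>i. t (\<sigma> i)"])
         (use pkg in \<open>simp add: pts r_pos t_pos r_sub t_sub E_def G_def\<close>)
  qed
  define wh where "wh = P.dom.net_lim (Inr True)"
  define xh where "xh = P.dom.net_lim (Inr False)"
  have cw: "P.dom.conv (\<lambda>i. ws (\<sigma> i)) wh" and cx: "P.dom.conv (\<lambda>i. xs (\<sigma> i)) xh"
    using P.dom.conv_net[of "Inr True"] P.dom.conv_net[of "Inr False"] by (simp_all add: wh_def xh_def N_def)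
  note c0 = P.dom.conv_base
  have dw: "mdist Xh (\<lambda>_. 0) wh = 1"
  proof -
    have "(\<lambda>i. mdist (E (\<sigma> i)) (ps (\<sigma> i)) (ws (\<sigma> i))) \<longlonglongrightarrow> mdist Xh (\<lambda>_. 0) wh"
      unfolding Xh_def P.dom.mdist_limit by (rule P.dom.tendsto_limit_dist[OF c0 cw])
    moreover have "mdist (E (\<sigma> i)) (ps (\<sigma> i)) (ws (\<sigma> i)) = 1" for i by (rule F.unit(1))
    ultimately show ?thesis by (simp add: LIMSEQ_const_iff)
  qed
  have fdw: "mdist Yh (P.limit_map (\<lambda>_. 0)) (P.limit_map wh) = 1"
  proof -
    have "(\<lambda>i. mdist (G (\<sigma> i)) (f (ps (\<sigma> i))) (f (ws (\<sigma> i)))) \<longlonglongrightarrow> mdist Yh (P.limit_map (\<lambda>_. 0)) (P.limit_map wh)"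
      unfolding Yh_def P.cod.mdist_limit by (rule P.cod.tendsto_limit_dist[OF P.conv_map[OF c0] P.conv_map[OF cw]])
    moreover have "mdist (G (\<sigma> i)) (f (ps (\<sigma> i))) (f (ws (\<sigma> i))) = 1" for i by (rule F.unit(2))
    ultimately show ?thesis by (simp add: LIMSEQ_const_iff)
  qed
  have inX: "(\<lambda>_. 0) \<in> mspace Xh" "wh \<in> mspace Xh" "xh \<in> mspace Xh"
    unfolding Xh_def P.dom.mspace_limit
    using P.dom.conv_limit_set[OF c0] P.dom.conv_limit_set[OF cw] P.dom.conv_limit_set[OF cx] .
  have ontoh: "P.limit_map ` mspace Xh = mspace Yh"
    unfolding Xh_def Yh_def P.dom.mspace_limit P.cod.mspace_limit by (rule P.limit_map_onto)
  have fne: "P.limit_map (\<lambda>_. 0) \<noteq> P.limit_map wh"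
  proof
    assume eq: "P.limit_map (\<lambda>_. 0) = P.limit_map wh"
    have "P.limit_map wh \<in> mspace Yh" using ontoh inX(2) by blast
    then show False using fdw eq by simp
  qed
  have eta: "homeomorphic_map (top_of_set {0..}) (top_of_set {0..}) \<eta>"
    using qs unfolding quasisymmetric_def by blast
  have qsh: "quasisymmetric \<eta> Xh Yh P.limit_map"
  proof (rule quasisymmetric_of_distorts[OF eta])
    show "distorts Xh Yh P.limit_map" unfolding Xh_def Yh_def by (rule P.limit_map_distorts)
  qed (fact ontoh inX(1,2) fne)+
  have dx: "(\<lambda>i. mdist X (ps (\<sigma> i)) (xs (\<sigma> i)) / r (\<sigma> i)) \<longlonglongrightarrow> mdist Xh (\<lambda>_. 0) xh"
    using P.dom.tendsto_limit_dist[OF c0 cx] unfolding Xh_def P.dom.mdist_limit E(2) .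
  have fdx: "(\<lambda>i. mdist Y (f (ps (\<sigma> i))) (f (xs (\<sigma> i))) / t (\<sigma> i)) \<longlonglongrightarrow>
      mdist Yh (P.limit_map (\<lambda>_. 0)) (P.limit_map xh)"
    using P.cod.tendsto_limit_dist[OF P.conv_map[OF c0] P.conv_map[OF cx]]
    unfolding Yh_def P.cod.mdist_limit G(2) .
  show ?thesis
    by (rule that[OF _ qsh inX dw fdw \<sigma>(1) dx fdx]) (use wtm in \<open>simp add: fh_def P.limit_map_base\<close>)
qed

end

section \<open>From tangents to logarithmic distortion\<close>

text \<open>At scales below \<open>\<delta>\<close>, replacing \<open>w\<close> by a point \<open>x\<close> that is up to \<open>1 / \<theta>\<close> times closer to \<open>p\<close>
  changes the expansion ratio of \<open>f\<close> at \<open>p\<close> by a factor of at most \<open>2 * L\<close>. It is stated with quotients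
  of distances within one space, since these do not change under rescaling.\<close>

definition steady_expansion ::
  "'a metric \<Rightarrow> 'b metric \<Rightarrow> ('a \<Rightarrow> 'b) \<Rightarrow> real \<Rightarrow> real \<Rightarrow> real \<Rightarrow> bool" where
  "steady_expansion X Y f L \<theta> \<delta> \<longleftrightarrow> (\<forall>p\<in>mspace X. \<forall>w\<in>mspace X. \<forall>x\<in>mspace X.
     p \<noteq> w \<and> mdist X p w < \<delta> \<and> \<theta> * mdist X p w \<le> mdist X p x \<and> mdist X p x \<le> mdist X p w \<longrightarrow>
     mdist Y (f p) (f x) / mdist Y (f p) (f w) \<le> 2 * L * (mdist X p x / mdist X p w) \<and>
     mdist X p x / mdist X p w \<le> 2 * L * (mdist Y (f p) (f x) / mdist Y (f p) (f w)))"

text \<open>If the comparison fails at all scales, blow up along a sequence of counterexamples. In the tangent the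
  distances of base point and \<open>wh\<close> and of their images are both \<open>1\<close>, so the tangent mapping is
  \<open>L\<close>-bi-Lipschitz. The limits of the two normalised ratios then differ by a factor of at most \<open>L\<close>.
  They are positive because of the lower bound \<open>\<theta>\<close>, so that with \<open>2 * L\<close> instead of \<open>L\<close> the
  inequalities are strict and must hold already for large indices.\<close>

lemma scale_comparison:
  fixes X :: "'a metric" and Y :: "'b metric" and f :: "'a \<Rightarrow> 'b" and \<eta> :: "real \<Rightarrow> real"
  assumes X: "compact_space (mtopology_of X)" "doubling X"
    and Y: "compact_space (mtopology_of Y)" "doubling Y"
    and qs: "quasisymmetric \<eta> X Y f"
    and L: "1 \<le> L" and tangents: "\<And>(Xh :: tangent_point metric) ph (Yh :: tangent_point metric) qh fh p w.
      weak_tangent_map X Y f (Xh, ph) (Yh, qh) fh \<Longrightarrow> quasisymmetric \<eta> Xh Yh fh \<Longrightarrow>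
      p \<in> mspace Xh \<Longrightarrow> w \<in> mspace Xh \<Longrightarrow> w \<noteq> p \<Longrightarrow> mdist Yh (fh p) (fh w) = mdist Xh p w \<Longrightarrow>
      bi_lipschitz L Xh Yh fh"
    and \<theta>: "0 < \<theta>"
  shows "\<exists>\<delta>>0. steady_expansion X Y f L \<theta> \<delta>"
proof (rule ccontr)
  define ok where "ok p w x \<longleftrightarrow>
     mdist Y (f p) (f x) / mdist Y (f p) (f w) \<le> 2 * L * (mdist X p x / mdist X p w) \<and>
     mdist X p x / mdist X p w \<le> 2 * L * (mdist Y (f p) (f x) / mdist Y (f p) (f w))" for p w x
  define bad where "bad \<delta> p w x \<longleftrightarrow> p \<in> mspace X \<and> w \<in> mspace X \<and> x \<in> mspace X \<and> p \<noteq> w \<and>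
     mdist X p w < \<delta> \<and> \<theta> * mdist X p w \<le> mdist X p x \<and> mdist X p x \<le> mdist X p w \<and> \<not> ok p w x"
    for \<delta> p w x
  assume "\<not> ?thesis"
  then have "\<exists>p w x. bad \<delta> p w x" if "0 < \<delta>" for \<delta>
    using that unfolding bad_def ok_def steady_expansion_def by blast
  then have "\<exists>p w x. bad (1 / (real i + 1)) p w x" for i by simp
  then obtain ps ws xs where b: "\<And>i. bad (1 / (real i + 1)) (ps i) (ws i) (xs i)" by metis
  have "(\<lambda>i. mdist X (ps i) (ws i)) \<longlonglongrightarrow> 0"
  proof (rule Lim_null_comparison)
    show "\<forall>\<^sub>F i in sequentially. norm (mdist X (ps i) (ws i)) \<le> 1 / (real i + 1)"
      using b unfolding bad_def by (simp add: less_imp_le)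
    show "(\<lambda>i. 1 / (real i + 1)) \<longlonglongrightarrow> 0"
      using LIMSEQ_inverse_real_of_nat by (simp add: inverse_eq_divide add.commute)
  qed
  moreover have eta: "homeomorphic_map (top_of_set {0..}) (top_of_set {0..}) \<eta>"
    using qs unfolding quasisymmetric_def by blast
  ultimately interpret T: tangent_data \<eta> X Y f ps ws xs
    using X Y qs half_line_homeomorphism[OF eta] b unfolding bad_def by unfold_locales auto
  obtain \<sigma> and Xh Yh :: "tangent_point metric" and fh o' wh xh where
    wt: "weak_tangent_map X Y f (Xh, o') (Yh, fh o') fh" "quasisymmetric \<eta> Xh Yh fh"
    and pts: "o' \<in> mspace Xh" "wh \<in> mspace Xh" "xh \<in> mspace Xh"
    and one: "mdist Xh o' wh = 1" "mdist Yh (fh o') (fh wh) = 1"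
    and \<sigma>: "strict_mono (\<sigma> :: nat \<Rightarrow> nat)"
    and limX: "(\<lambda>i. mdist X (ps (\<sigma> i)) (xs (\<sigma> i)) / T.r (\<sigma> i)) \<longlonglongrightarrow> mdist Xh o' xh"
    and limY: "(\<lambda>i. mdist Y (f (ps (\<sigma> i))) (f (xs (\<sigma> i))) / T.t (\<sigma> i)) \<longlonglongrightarrow> mdist Yh (fh o') (fh xh)"
    by (rule T.tangent_exists)
  have "wh \<noteq> o'" using one(1) pts by auto
  then have bl: "bi_lipschitz L Xh Yh fh" using tangents[OF wt pts(1,2)] one by simp
  define D where "D = mdist Xh o' xh"
  define P where "P = mdist Yh (fh o') (fh xh)"
  have "\<theta> \<le> mdist X (ps i) (xs i) / T.r i" for i
    using b[of i] T.r_pos[of i] unfolding bad_def T.r_def by (simp add: pos_le_divide_eq)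
  then have "\<theta> \<le> D" unfolding D_def by (intro LIMSEQ_le_const[OF limX]) auto
  then have D: "0 < D" using \<theta> by linarith
  have bl': "inverse L * D \<le> P" "P \<le> L * D" using bl pts unfolding bi_lipschitz_def D_def P_def by auto
  have "D \<le> L * P" using bl'(1) L by (simp add: field_simps)
  then have P2: "D < 2 * L * P" using D by linarith
  have P1: "P < 2 * L * D"
  proof -
    have "0 < L * D" using L D by simp
    then show ?thesis using bl'(2) by linarith
  qed
  have "(\<lambda>i. 2 * L * (mdist X (ps (\<sigma> i)) (xs (\<sigma> i)) / T.r (\<sigma> i)) -
      mdist Y (f (ps (\<sigma> i))) (f (xs (\<sigma> i))) / T.t (\<sigma> i)) \<longlonglongrightarrow> 2 * L * D - P"
    unfolding D_def P_def by (intro tendsto_diff tendsto_mult_left limX limY)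
  then have ev1: "\<forall>\<^sub>F i in sequentially. 0 < 2 * L * (mdist X (ps (\<sigma> i)) (xs (\<sigma> i)) / T.r (\<sigma> i)) -
      mdist Y (f (ps (\<sigma> i))) (f (xs (\<sigma> i))) / T.t (\<sigma> i)"
    by (rule order_tendstoD(1)) (use P1 in simp)
  have "(\<lambda>i. 2 * L * (mdist Y (f (ps (\<sigma> i))) (f (xs (\<sigma> i))) / T.t (\<sigma> i)) -
      mdist X (ps (\<sigma> i)) (xs (\<sigma> i)) / T.r (\<sigma> i)) \<longlonglongrightarrow> 2 * L * P - D"
    unfolding D_def P_def by (intro tendsto_diff tendsto_mult_left limX limY)
  then have ev2: "\<forall>\<^sub>F i in sequentially. 0 < 2 * L * (mdist Y (f (ps (\<sigma> i))) (f (xs (\<sigma> i))) / T.t (\<sigma> i)) -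
      mdist X (ps (\<sigma> i)) (xs (\<sigma> i)) / T.r (\<sigma> i)"
    by (rule order_tendstoD(1)) (use P2 in simp)
  have "\<forall>\<^sub>F i in sequentially. ok (ps (\<sigma> i)) (ws (\<sigma> i)) (xs (\<sigma> i))"
    using eventually_conj[OF ev1 ev2] by (rule eventually_mono) (simp add: ok_def T.r_def T.t_def)
  then obtain i where "ok (ps (\<sigma> i)) (ws (\<sigma> i)) (xs (\<sigma> i))"
    by (auto simp: eventually_sequentially)
  then show False using b[of "\<sigma> i"] unfolding bad_def by blast
qed

lemma abs_ln_le_between:
  fixes u :: real
  assumes "0 < a" "a \<le> u" "u \<le> b"
  shows "\<bar>ln u\<bar> \<le> \<bar>ln a\<bar> + \<bar>ln b\<bar>"
proof -
  have "ln a \<le> ln u" "ln u \<le> ln b" using assms by auto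
  then show ?thesis by linarith
qed

text \<open>Induction on the number of steps from the fixed scale \<open>\<delta>0\<close> down to \<open>mdist X p x\<close>. The contraction \<open>\<mu>\<close> of
  one step is chosen so small that the cost \<open>k = ln (2 * L)\<close> of a step is at most \<open>\<epsilon> / 2\<close> times its gain
  \<open>M = ln (1 / \<mu>)\<close>.\<close>

lemma quasi_lipschitz_from_scale_comparison:
  assumes fY: "f ` mspace X \<subseteq> mspace Y" and inj: "inj_on f (mspace X)"
    and up: "uniformly_perfect X"
    and bX: "0 < \<Delta>" "\<forall>x\<in>mspace X. \<forall>y\<in>mspace X. mdist X x y \<le> \<Delta>"
    and bY: "0 < \<Delta>'" "\<forall>x\<in>mspace Y. \<forall>y\<in>mspace Y. mdist Y x y \<le> \<Delta>'"
    and ab: "a \<in> mspace X" "b \<in> mspace X" "a \<noteq> b"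
    and lower: "\<And>s. 0 < s \<Longrightarrow> \<exists>c>0. \<forall>p\<in>mspace X. \<forall>x\<in>mspace X. s \<le> mdist X p x \<longrightarrow> c \<le> mdist Y (f p) (f x)"
    and L: "1 \<le> L"
    and comparison: "\<And>\<theta>. 0 < \<theta> \<Longrightarrow> \<exists>\<delta>>0. steady_expansion X Y f L \<theta> \<delta>"
  shows "quasi_lipschitz X Y f"
  unfolding quasi_lipschitz_def
proof (intro conjI allI impI)
  show "f ` mspace X \<subseteq> mspace Y" by (rule fY)
  fix \<epsilon> :: real assume e: "0 < \<epsilon>"
  obtain D where D: "1 \<le> D" "\<And>x r. x \<in> mspace X \<Longrightarrow> 0 < r \<Longrightarrow> mspace X - mcball_of X x r \<noteq> {} \<Longrightarrow>
      mcball_of X x r - mcball_of X x (r / D) \<noteq> {}"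
    using up unfolding uniformly_perfect_def by blast
  have posX: "0 < mdist X p x" if "p \<in> mspace X" "x \<in> mspace X" "p \<noteq> x" for p x
    using that by (simp add: order_less_le)
  have posY: "0 < mdist Y (f p) (f x)" if "p \<in> mspace X" "x \<in> mspace X" "p \<noteq> x" for p x
  proof -
    have "f p \<noteq> f x" using inj_onD[OF inj _ that(1,2)] that(3) by blast
    moreover have "f p \<in> mspace Y" "f x \<in> mspace Y" using fY that by auto
    ultimately show ?thesis by (simp add: order_less_le)
  qed
  define k where "k = ln (2 * L)"
  have k: "0 \<le> k" using L by (simp add: k_def)
  define M where "M = 2 * k / \<epsilon> + 1"
  have M: "0 < M" using k e by (simp add: M_def add_nonneg_pos)
  have kM: "k / M \<le> \<epsilon> / 2"
  proof -
    have "\<epsilon> / 2 * M = k + \<epsilon> / 2" using e by (simp add: M_def field_simps)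
    then show ?thesis using M e by (simp add: pos_divide_le_eq)
  qed
  define \<mu> where "\<mu> = exp (- M)"
  have \<mu>: "0 < \<mu>" "\<mu> \<le> 1" using M by (simp_all add: \<mu>_def)
  \<comment> \<open>Uniform perfectness locates the next point only up to the factor \<open>D\<close>; dividing by \<open>D\<close>
     ensures that a step still gains the full factor \<open>1 / \<mu>\<close>.\<close>
  define \<theta> where "\<theta> = \<mu> / D"
  have \<theta>: "0 < \<theta>" "\<theta> * D = \<mu>" using \<mu> D(1) by (simp_all add: \<theta>_def)
  from comparison[OF \<theta>(1)] obtain \<delta> where \<delta>: "0 < \<delta>" "steady_expansion X Y f L \<theta> \<delta>" by blast
  \<comment> \<open>Below half the distance of \<open>a\<close> and \<open>b\<close> no ball is the whole space, so that uniform
     perfectness applies.\<close>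
  define \<rho> where "\<rho> = min \<delta> (mdist X a b / 2)"
  have \<rho>: "0 < \<rho>" using \<delta>(1) posX[OF ab] by (simp add: \<rho>_def)
  define \<delta>0 where "\<delta>0 = \<theta> * \<rho>"
  have \<delta>0: "0 < \<delta>0" using \<theta> \<rho> by (simp add: \<delta>0_def)
  define q where "q p x = ln (mdist Y (f p) (f x) / mdist X p x)" for p x
  obtain c where c: "0 < c" "\<forall>p\<in>mspace X. \<forall>x\<in>mspace X. \<delta>0 \<le> mdist X p x \<longrightarrow> c \<le> mdist Y (f p) (f x)"
    using lower[OF \<delta>0] by blast
  define C where "C = \<bar>ln (c / \<Delta>)\<bar> + \<bar>ln (\<Delta>' / \<delta>0)\<bar>"
  have large: "\<bar>q p x\<bar> \<le> C" if p: "p \<in> mspace X" and x: "x \<in> mspace X" and far: "\<delta>0 \<le> mdist X p x" for p x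
    unfolding q_def C_def
  proof (rule abs_ln_le_between)
    have fp: "f p \<in> mspace Y" "f x \<in> mspace Y" using fY p x by auto
    have cle: "c \<le> mdist Y (f p) (f x)" and Dle: "mdist X p x \<le> \<Delta>" and D'le: "mdist Y (f p) (f x) \<le> \<Delta>'"
      using c(2) bX(2) bY(2) p x far fp by auto
    show "0 < c / \<Delta>" using c(1) bX(1) by simp
    show "c / \<Delta> \<le> mdist Y (f p) (f x) / mdist X p x"
      using cle Dle far \<delta>0 c(1) by (intro frac_le) linarith+
    show "mdist Y (f p) (f x) / mdist X p x \<le> \<Delta>' / \<delta>0"
      using D'le far \<delta>0 bY(1) by (intro frac_le) linarith+
  qed
  have step: "\<exists>z\<in>mspace X. z \<noteq> p \<and> mdist X p x / \<mu> \<le> mdist X p z \<and> \<bar>q p x\<bar> \<le> \<bar>q p z\<bar> + k"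
    if p: "p \<in> mspace X" and x: "x \<in> mspace X" and px: "p \<noteq> x" and near: "mdist X p x < \<delta>0" for p x
  proof -
    note d = posX[OF p x px]
    define R where "R = mdist X p x / \<theta>"
    have R: "0 < R" "R < \<rho>" "\<theta> * R = mdist X p x"
      using d \<theta>(1) near by (simp_all add: R_def \<delta>0_def pos_divide_less_eq mult.commute)
    obtain y where "y \<in> {a, b}" "mdist X a b / 2 \<le> mdist X p y" using far_point[OF ab(1,2) p] by blast
    then have "y \<in> mspace X - mcball_of X p R" using R(2) ab by (auto simp: \<rho>_def)
    then have "mspace X - mcball_of X p R \<noteq> {}" by blast
    then have "mcball_of X p R - mcball_of X p (R / D) \<noteq> {}" by (rule D(2)[OF p R(1)])
    then obtain z where "z \<in> mcball_of X p R - mcball_of X p (R / D)" by blast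
    then have z: "z \<in> mspace X" "mdist X p z \<le> R" "R / D < mdist X p z" using p by auto
    have zpos: "0 < mdist X p z" using z(3) R(1) D(1) by (meson divide_pos_pos less_le_trans less_trans zero_less_one)
    then have zp: "p \<noteq> z" using p by auto
    have "R / D = mdist X p x / \<mu>" by (simp add: R_def flip: \<theta>(2))
    then have le: "mdist X p x / \<mu> \<le> mdist X p z" using z(3) by simp
    have "mdist X p x \<le> mdist X p x / \<mu>" using \<mu> d by (simp add: pos_le_divide_eq mult_left_le)
    then have xz: "mdist X p x \<le> mdist X p z" using le by linarith
    have "\<theta> * mdist X p z \<le> \<theta> * R" using z(2) \<theta>(1) by (intro mult_left_mono) auto
    then have lz: "\<theta> * mdist X p z \<le> mdist X p x" using R(3) by simp
    have zd: "mdist X p z < \<delta>" using z(2) R(2) by (simp add: \<rho>_def)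
    define dx dz rx rz where "dx = mdist X p x" and "dz = mdist X p z"
      and "rx = mdist Y (f p) (f x)" and "rz = mdist Y (f p) (f z)"
    have pos: "0 < dx" "0 < dz" "0 < rx" "0 < rz"
      unfolding dx_def dz_def rx_def rz_def using d zpos posY[OF p x px] posY[OF p z(1) zp] by auto
    have cmp: "rx / rz \<le> 2 * L * (dx / dz)" "dx / dz \<le> 2 * L * (rx / rz)"
      unfolding dx_def dz_def rx_def rz_def using \<delta>(2)[unfolded steady_expansion_def] p z(1) x zp zd lz xz by blast+
    have ln_eqs: "ln (rx / rz) = ln rx - ln rz" "ln (2 * L * (dx / dz)) = k + (ln dx - ln dz)"
      "ln (dx / dz) = ln dx - ln dz" "ln (2 * L * (rx / rz)) = k + (ln rx - ln rz)"
      using pos L by (simp_all add: k_def ln_mult ln_div)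
    have "ln (rx / rz) \<le> ln (2 * L * (dx / dz))" using cmp(1) pos by (intro ln_mono) auto
    moreover have "ln (dx / dz) \<le> ln (2 * L * (rx / rz))" using cmp(2) pos by (intro ln_mono) auto
    moreover have "q p x = ln rx - ln dx" "q p z = ln rz - ln dz"
      using pos by (simp_all add: q_def dx_def dz_def rx_def rz_def ln_div)
    ultimately have "\<bar>q p x\<bar> \<le> \<bar>q p z\<bar> + k" unfolding ln_eqs by linarith
    then show ?thesis using z(1) zp le by (intro bexI[of _ z]) auto
  qed
  have iter: "\<bar>q p x\<bar> \<le> C + n * k"
    if "p \<in> mspace X" "x \<in> mspace X" "p \<noteq> x" "\<delta>0 * \<mu> ^ n \<le> mdist X p x" for n p x
    using that
  proof (induction n arbitrary: x)
    case 0
    then show ?case using large by simp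
  next
    case (Suc n)
    show ?case
    proof (cases "\<delta>0 \<le> mdist X p x")
      case True
      then have "\<bar>q p x\<bar> \<le> C" using large Suc.prems by blast
      moreover have "0 \<le> real (Suc n) * k" using k by (intro mult_nonneg_nonneg) auto
      ultimately show ?thesis by linarith
    next
      case False
      then obtain z where z: "z \<in> mspace X" "z \<noteq> p" "mdist X p x / \<mu> \<le> mdist X p z" "\<bar>q p x\<bar> \<le> \<bar>q p z\<bar> + k"
        using step[OF Suc.prems(1-3)] by auto
      have "\<delta>0 * \<mu> ^ n * \<mu> \<le> mdist X p x" using Suc.prems(4) by (simp add: mult_ac)
      then have "\<delta>0 * \<mu> ^ n \<le> mdist X p x / \<mu>" using \<mu>(1) by (simp add: pos_le_divide_eq)
      then have "\<bar>q p z\<bar> \<le> C + n * k" using z by (intro Suc.IH Suc.prems(1)) auto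
      then show ?thesis using z(4) by (simp add: algebra_simps)
    qed
  qed
  define C1 where "C1 = C + k + k / M * \<bar>ln \<delta>0\<bar>"
  have C1: "0 \<le> C1" using k M by (simp add: C1_def C_def)
  define \<delta>1 where "\<delta>1 = min \<delta>0 (exp (- (2 * C1 / \<epsilon> + 1)))"
  have "\<bar>ln (mdist Y (f x) (f y)) / ln (mdist X x y) - 1\<bar> < \<epsilon>"
    if x: "x \<in> mspace X" and y: "y \<in> mspace X" and xy: "x \<noteq> y" and near: "mdist X x y < \<delta>1" for x y
  proof -
    define d where "d = mdist X x y"
    have d: "0 < d" using posX[OF x y xy] by (simp add: d_def)
    define l where "l = - ln d"
    have "ln d < ln (exp (- (2 * C1 / \<epsilon> + 1)))"
      using near d by (subst ln_less_cancel_iff) (auto simp: \<delta>1_def d_def)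
    then have l: "2 * C1 / \<epsilon> + 1 < l" by (simp add: l_def)
    have l0: "0 < l" using l C1 e by (smt (verit) divide_nonneg_pos)
    \<comment> \<open>The real number of steps of size \<open>M\<close> from \<open>ln \<delta>0\<close> down to \<open>ln d\<close>.\<close>
    define s where "s = (ln \<delta>0 + l) / M"
    have "ln d \<le> ln \<delta>0" using near d \<delta>0 by (simp add: \<delta>1_def d_def)
    then have s0: "0 \<le> s" using M by (simp add: s_def l_def)
    define n where "n = nat \<lceil>s\<rceil>"
    have n: "s \<le> n" "n \<le> s + 1" using s0 by (simp_all add: n_def)
    have "\<delta>0 * \<mu> ^ n = exp (ln \<delta>0 - n * M)"
      using \<delta>0 by (simp add: \<mu>_def exp_diff exp_minus exp_of_nat_mult[symmetric] divide_inverse power_inverse)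
    also have "\<dots> \<le> exp (ln d)"
    proof -
      have "s * M \<le> n * M" using n(1) M by (intro mult_right_mono) auto
      moreover have "s * M = ln \<delta>0 - ln d" using M by (simp add: s_def l_def)
      ultimately show ?thesis by simp
    qed
    finally have "\<delta>0 * \<mu> ^ n \<le> mdist X x y" using d by (simp add: d_def)
    from iter[OF x y xy this] have "\<bar>q x y\<bar> \<le> C + n * k" .
    also have "\<dots> \<le> C + (s + 1) * k" using n(2) k by (intro add_left_mono mult_right_mono) auto
    also have "\<dots> = C + k + k / M * ln \<delta>0 + k / M * l" using M by (simp add: s_def field_simps)
    also have "\<dots> \<le> C1 + \<epsilon> / 2 * l"
    proof -
      have "k / M * ln \<delta>0 \<le> k / M * \<bar>ln \<delta>0\<bar>" using k M by (intro mult_left_mono) auto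
      moreover have "k / M * l \<le> \<epsilon> / 2 * l" using kM l0 by (intro mult_right_mono) auto
      ultimately have "k / M * ln \<delta>0 + k / M * l \<le> k / M * \<bar>ln \<delta>0\<bar> + \<epsilon> / 2 * l" by (rule add_mono)
      then show ?thesis unfolding C1_def by (simp only: add.assoc add_le_cancel_left)
    qed
    also have "C1 < \<epsilon> / 2 * l"
    proof -
      have "\<epsilon> / 2 * (2 * C1 / \<epsilon>) < \<epsilon> / 2 * l" using l e by (intro mult_strict_left_mono) auto
      then show ?thesis using e by simp
    qed
    finally have ql: "\<bar>q x y\<bar> < \<epsilon> * l" by simp
    have "q x y = ln (mdist Y (f x) (f y)) - ln d"
      using posY[OF x y xy] d by (simp add: q_def d_def ln_div)
    then have "ln (mdist Y (f x) (f y)) / ln d - 1 = - q x y / l"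
      using l0 by (simp add: l_def field_simps)
    then have "\<bar>ln (mdist Y (f x) (f y)) / ln d - 1\<bar> = \<bar>q x y\<bar> / l" using l0 by (simp add: abs_divide)
    also have "\<dots> < \<epsilon>" using ql l0 by (simp add: pos_divide_less_eq)
    finally show ?thesis by (simp add: d_def)
  qed
  then show "\<exists>\<delta>>0. \<forall>x\<in>mspace X. \<forall>y\<in>mspace X. x \<noteq> y \<and> mdist X x y < \<delta> \<longrightarrow>
      \<bar>ln (mdist Y (f x) (f y)) / ln (mdist X x y) - 1\<bar> < \<epsilon>"
    using \<delta>0 by (intro exI[of _ \<delta>1]) (simp add: \<delta>1_def)
qed

theorem theorem3p1:
  fixes X :: "'a metric" and Y :: "'b metric"
    and f :: "'a \<Rightarrow> 'b" and \<eta> :: "real \<Rightarrow> real"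
  assumes "compact_space (mtopology_of X)" "doubling X" "uniformly_perfect X"
    and "compact_space (mtopology_of Y)" "doubling Y" "uniformly_perfect Y"
    and "quasisymmetric \<eta> X Y f"
    and "\<exists>L\<ge>1. \<forall>(Xh :: tangent_point metric) ph (Yh :: tangent_point metric) qh fh.
           weak_tangent_map X Y f (Xh, ph) (Yh, qh) fh \<and> quasisymmetric \<eta> Xh Yh fh \<and>
           (\<exists>p\<in>mspace Xh. \<exists>w\<in>mspace Xh. w \<noteq> p \<and> mdist Yh (fh p) (fh w) = mdist Xh p w) \<longrightarrow>
           bi_lipschitz L Xh Yh fh"
  shows "quasi_lipschitz X Y f"
proof -
  have eta: "homeomorphic_map (top_of_set {0..}) (top_of_set {0..}) \<eta>"
    using assms(7) unfolding quasisymmetric_def by blast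
  interpret gauge \<eta>
    using half_line_homeomorphism[OF eta] by unfold_locales
  note f = distorts_of_quasisymmetric[OF assms(7)]
  show ?thesis
  proof (cases "\<exists>a\<in>mspace X. \<exists>b\<in>mspace X. a \<noteq> b")
    case False
    \<comment> \<open>A space with at most one point has no pairs to be compared.\<close>
    then have "\<not> (x \<in> mspace X \<and> y \<in> mspace X \<and> x \<noteq> y)" for x y by blast
    then show ?thesis
      unfolding quasi_lipschitz_def using f(2) by (auto intro!: exI[of _ 1])
  next
    case True
    then obtain a b where ab: "a \<in> mspace X" "b \<in> mspace X" "a \<noteq> b" by blast
    then have fab: "f a \<noteq> f b" using f(3) by (auto dest: inj_onD)
    obtain L where L: "1 \<le> L" "\<forall>(Xh :: tangent_point metric) ph (Yh :: tangent_point metric) qh fh.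
           weak_tangent_map X Y f (Xh, ph) (Yh, qh) fh \<and> quasisymmetric \<eta> Xh Yh fh \<and>
           (\<exists>p\<in>mspace Xh. \<exists>w\<in>mspace Xh. w \<noteq> p \<and> mdist Yh (fh p) (fh w) = mdist Xh p w) \<longrightarrow>
           bi_lipschitz L Xh Yh fh"
      using assms(8) by (elim exE conjE)
    obtain \<Delta> where \<Delta>: "0 < \<Delta>" "\<forall>x\<in>mspace X. \<forall>y\<in>mspace X. mdist X x y \<le> \<Delta>"
      using compact_space_bounded[OF assms(1)] by blast
    obtain \<Delta>' where \<Delta>': "0 < \<Delta>'" "\<forall>x\<in>mspace Y. \<forall>y\<in>mspace Y. mdist Y x y \<le> \<Delta>'"
      using compact_space_bounded[OF assms(4)] by blast
    show ?thesis
    proof (rule quasi_lipschitz_from_scale_comparison[OF _ f(3) assms(3) \<Delta> \<Delta>' ab _ L(1)])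
      show "f ` mspace X \<subseteq> mspace Y" using f(2) by simp
      show "\<exists>c>0. \<forall>p\<in>mspace X. \<forall>x\<in>mspace X. s \<le> mdist X p x \<longrightarrow> c \<le> mdist Y (f p) (f x)" if "0 < s" for s
        by (rule distorts_large_images[OF f(1) \<Delta>(2) ab(1,2) fab that])
    next
      fix \<theta> :: real assume "0 < \<theta>"
      then show "\<exists>\<delta>>0. steady_expansion X Y f L \<theta> \<delta>"
        using L(2) by (intro scale_comparison[OF assms(1,2,4,5,7) L(1)]) blast+
    qed
  qed
qed

end
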